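(* Let $k$ be a $\sigma$-field and let $R$ and $S$ be $k$-$\sigma$-algebras. Then, as subsets of $R\otimes_k S$, $$\pi_0^\sigma(R\otimes_k S)=\pi_0^\sigma(R)\otimes_k\pi_0^\sigma(S).$$
   Context: All rings are commutative. A $\sigma$-ring is a ring $R$ with a ring endomorphism $\sigma\colon R\to R$ (not assumed injective); a $\sigma$-field is a $\sigma$-ring whose underlying ring is a field. For a $\sigma$-field $k$, a $k$-$\sigma$-algebra is a $\sigma$-ring $R$ with a $\sigma$-equivariant ring morphism $k\to R$; a $k$-$\sigma$-subalgebra is a $k$-subalgebra stable under $\sigma$. Tensor products of $k$-$\sigma$-algebras carry $\sigma(r\otimes s)=\sigma(r)\otimes\sigma(s)$. $R$ is $\sigma$-separable over $k$ if $\sigma$ is injective on $R\otimes_k K$ for every $\sigma$-field extension $K|k$. $R$ is strongly $\sigma$-étale over $k$ if it is $\sigma$-separable over $k$ and étale as a $k$-algebra (i.e. $R\otimes_k\overline{k}$ is isomorphic to a finite product of copies of $\overline{k}$). The strong core $\pi_0^\sigma(R)=\pi_0^\sigma(R|k)$ is the union of all strongly $\sigma$-étale $k$-$\sigma$-subalgebras of $R$ (it is a $k$-$\sigma$-subalgebra of $R$). *)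

theory Defs
  imports "HOL-Algebra.Algebra"
begin

section \<open>Difference rings and difference algebras\<close>

record 'a diff_ring = "'a ring" +
  shift :: "'a \<Rightarrow> 'a"

record ('k, 'a) diff_alg = "'a diff_ring" +
  struct_map :: "'k \<Rightarrow> 'a"

locale difference_ring = cring R for R :: "('a, 'm) diff_ring_scheme" (structure) +
  assumes shift_hom: "shift R \<in> ring_hom R R"

locale difference_field = difference_ring R + field R for R :: "('a, 'm) diff_ring_scheme" (structure)

locale difference_algebra = base: difference_ring k + difference_ring R
  for k :: "('k, 'l) diff_ring_scheme" and R :: "('k, 'a, 'm) diff_alg_scheme" (structure) +
  assumes struct_map_hom: "struct_map R \<in> ring_hom k R"
    and struct_map_shift:
      "a \<in> carrier k \<Longrightarrow> shift R (struct_map R a) = struct_map R (shift k a)"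

definition difference_subalgebra ::
    "('k, 'm) ring_scheme \<Rightarrow> 'a set \<Rightarrow> ('k, 'a, 'n) diff_alg_scheme \<Rightarrow> bool"
  where "difference_subalgebra k A R \<longleftrightarrow>
    subring A R \<and> struct_map R ` carrier k \<subseteq> A \<and> shift R ` A \<subseteq> A"


section \<open>Tensor products\<close>

text \<open>The monoid ring of the multiplicative monoid \<open>R \<times> S\<close> over the integers. As an abelian group
  this is the free abelian group on \<open>carrier R \<times> carrier S\<close>.\<close>

definition pair_ring ::
    "('a, 'm) ring_scheme \<Rightarrow> ('b, 'n) ring_scheme \<Rightarrow> ('a \<times> 'b \<Rightarrow>\<^sub>0 int) ring"
  where "pair_ring R S =
    \<lparr>carrier = {c. Poly_Mapping.keys c \<subseteq> carrier R \<times> carrier S},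
     monoid.mult = (\<lambda>c d. frag_extend (\<lambda>(r, s). frag_extend
               (\<lambda>(r', s'). frag_of (r \<otimes>\<^bsub>R\<^esub> r', s \<otimes>\<^bsub>S\<^esub> s')) d) c),
     monoid.one = frag_of (\<one>\<^bsub>R\<^esub>, \<one>\<^bsub>S\<^esub>), ring.zero = 0, ring.add = (+)\<rparr>"

text \<open>The bilinearity relations of a tensor product over \<open>k\<close>, for the \<open>k\<close>-algebras
  given by \<open>\<phi> : k \<rightarrow> R\<close> and \<open>\<psi> : k \<rightarrow> S\<close>. Their additive span is stable under multiplication,
  so the ideal they generate is the usual group of relations.\<close>

definition tensor_relations ::
    "('k, 'l) ring_scheme \<Rightarrow> ('k \<Rightarrow> 'a) \<Rightarrow> ('a, 'm) ring_scheme \<Rightarrow>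
      ('k \<Rightarrow> 'b) \<Rightarrow> ('b, 'n) ring_scheme \<Rightarrow> ('a \<times> 'b \<Rightarrow>\<^sub>0 int) set"
  where "tensor_relations k \<phi> R \<psi> S =
    {frag_of (r \<oplus>\<^bsub>R\<^esub> r', s) - frag_of (r, s) - frag_of (r', s) | r r' s.
       r \<in> carrier R \<and> r' \<in> carrier R \<and> s \<in> carrier S} \<union>
    {frag_of (r, s \<oplus>\<^bsub>S\<^esub> s') - frag_of (r, s) - frag_of (r, s') | r s s'.
       r \<in> carrier R \<and> s \<in> carrier S \<and> s' \<in> carrier S} \<union>
    {frag_of (\<phi> a \<otimes>\<^bsub>R\<^esub> r, s) - frag_of (r, \<psi> a \<otimes>\<^bsub>S\<^esub> s) | a r s.
       a \<in> carrier k \<and> r \<in> carrier R \<and> s \<in> carrier S}"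

definition tensor_ideal where
  "tensor_ideal k \<phi> R \<psi> S = genideal (pair_ring R S) (tensor_relations k \<phi> R \<psi> S)"

definition tensor_ring where
  "tensor_ring k \<phi> R \<psi> S = pair_ring R S Quot tensor_ideal k \<phi> R \<psi> S"

definition pure_tensor where
  "pure_tensor k \<phi> R \<psi> S r s = a_r_coset (pair_ring R S) (tensor_ideal k \<phi> R \<psi> S) (frag_of (r, s))"

text \<open>The map \<open>f \<otimes> g\<close> with values in the tensor product of \<open>\<phi> : k \<rightarrow> R\<close> and \<open>\<psi> : k \<rightarrow> S\<close>. The
  source is not mentioned: an element of it is a coset \<open>Z\<close>, and for compatible \<open>f\<close> and \<open>g\<close> all
  members of the union below are one and the same coset.\<close>

definition pair_map :: "('a \<Rightarrow> 'c) \<Rightarrow> ('b \<Rightarrow> 'd) \<Rightarrow> ('a \<times> 'b \<Rightarrow>\<^sub>0 int) \<Rightarrow> ('c \<times> 'd \<Rightarrow>\<^sub>0 int)"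
  where "pair_map f g = frag_extend (\<lambda>(r, s). frag_of (f r, g s))"

definition tensor_map where
  "tensor_map k \<phi> R \<psi> S f g Z =
    (\<Union>c\<in>Z. a_r_coset (pair_ring R S) (tensor_ideal k \<phi> R \<psi> S) (pair_map f g c))"

definition tensor ::
    "('k, 'l) ring_scheme \<Rightarrow> ('k, 'a, 'm) diff_alg_scheme \<Rightarrow> ('k, 'b, 'n) diff_alg_scheme \<Rightarrow>
      ('k, ('a \<times> 'b \<Rightarrow>\<^sub>0 int) set) diff_alg"
  where "tensor k R S =
    ring.extend (tensor_ring k (struct_map R) R (struct_map S) S)
      \<lparr>shift = tensor_map k (struct_map R) R (struct_map S) S (shift R) (shift S),
       struct_map = (\<lambda>a. pure_tensor k (struct_map R) R (struct_map S) S (struct_map R a) \<one>\<^bsub>S\<^esub>)\<rparr>"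


section \<open>Separable and etale difference algebras, the strong core\<close>

text \<open>A definition cannot quantify over types, so the extensions \<open>K\<close> range over one type. This is no
  restriction: a failure of injectivity involves finitely many elements of \<open>K\<close>, and these
  generate over \<open>k\<close> a difference subfield of cardinality at most that of \<open>'k \<times> nat\<close>. The theorem
  \<open>sigma_separable_all_extensions\<close> below gives injectivity for \<open>K\<close> in an arbitrary type.\<close>

definition sigma_separable ::
    "('k, 'l) diff_ring_scheme \<Rightarrow> ('k, 'a, 'm) diff_alg_scheme \<Rightarrow> bool"
  where "sigma_separable k R \<longleftrightarrow>
    (\<forall>K :: ('k, ('k \<times> nat) set) diff_alg. difference_field K \<and> difference_algebra k K \<longrightarrow>
       inj_on (shift (tensor k R K)) (carrier (tensor k R K)))"

text \<open>The isomorphism is required to be one of algebras over the algebraic closure \<open>C\<close>; on the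
  right-hand side \<open>C\<close> acts diagonally.\<close>

definition etale :: "('k, 'l) ring_scheme \<Rightarrow> ('k \<Rightarrow> 'a) \<Rightarrow> ('a, 'm) ring_scheme \<Rightarrow> bool"
  where "etale k \<phi> R \<longleftrightarrow>
    (let C = field.alg_closure k; \<iota> = ring.indexed_const k in
     \<exists>n h. h \<in> ring_iso (tensor_ring k \<phi> R \<iota> C) (RDirProd_list (replicate n C)) \<and>
       (\<forall>c\<in>carrier C. h (pure_tensor k \<phi> R \<iota> C \<one>\<^bsub>R\<^esub> c) = replicate n c))"

definition strongly_sigma_etale ::
    "('k, 'l) diff_ring_scheme \<Rightarrow> ('k, 'a, 'm) diff_alg_scheme \<Rightarrow> bool"
  where "strongly_sigma_etale k R \<longleftrightarrow> sigma_separable k R \<and> etale k (struct_map R) R"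

definition strong_core ::
    "('k, 'l) diff_ring_scheme \<Rightarrow> ('k, 'a, 'm) diff_alg_scheme \<Rightarrow> 'a set"
  where "strong_core k R =
    \<Union>{A. difference_subalgebra k A R \<and> strongly_sigma_etale k (R\<lparr>carrier := A\<rparr>)}"

text \<open>The tensor product of two subalgebras as a subset of the tensor product of \<open>R\<close> and \<open>S\<close>,
  namely its image under the map induced by the inclusions (which is injective when \<open>k\<close> is a
  field).\<close>

definition tensor_image ::
    "('k, 'l) ring_scheme \<Rightarrow> ('k, 'a, 'm) diff_alg_scheme \<Rightarrow> ('k, 'b, 'n) diff_alg_scheme \<Rightarrow>
      'a set \<Rightarrow> 'b set \<Rightarrow> ('a \<times> 'b \<Rightarrow>\<^sub>0 int) set set"
  where "tensor_image k R S A B =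
    tensor_map k (struct_map R) R (struct_map S) S id id `
      carrier (tensor k (R\<lparr>carrier := A\<rparr>) (S\<lparr>carrier := B\<rparr>))"


section \<open>The tensor product is a difference algebra\<close>

lemma pair_ring_simps:
  "carrier (pair_ring R S) = {c. Poly_Mapping.keys c \<subseteq> carrier R \<times> carrier S}"
  "\<one>\<^bsub>pair_ring R S\<^esub> = frag_of (\<one>\<^bsub>R\<^esub>, \<one>\<^bsub>S\<^esub>)"
  "\<zero>\<^bsub>pair_ring R S\<^esub> = 0"
  "c \<oplus>\<^bsub>pair_ring R S\<^esub> d = c + d"
  by (simp_all add: pair_ring_def)

lemma frag_cmul_diff_distrib2: "frag_cmul n (a - b) = frag_cmul n a - frag_cmul n b"
  by (rule poly_mapping_eqI) (simp add: lookup_minus right_diff_distrib)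

lemma frag_extend_fun_diff:
  "frag_extend (\<lambda>x. f x - g x) c = frag_extend f c - frag_extend g c"
  by (simp add: frag_extend_def frag_cmul_diff_distrib2 sum_subtractf)

lemma pair_mult_of:
  "frag_of (r, s) \<otimes>\<^bsub>pair_ring R S\<^esub> frag_of (r', s') = frag_of (r \<otimes>\<^bsub>R\<^esub> r', s \<otimes>\<^bsub>S\<^esub> s')"
  by (simp add: pair_ring_def)

lemma pair_mult_0: "0 \<otimes>\<^bsub>pair_ring R S\<^esub> d = 0" "c \<otimes>\<^bsub>pair_ring R S\<^esub> 0 = 0"
  by (simp_all add: pair_ring_def frag_extend_eq_0 case_prod_unfold)

lemma pair_mult_diff:
  "(c - c') \<otimes>\<^bsub>pair_ring R S\<^esub> d = c \<otimes>\<^bsub>pair_ring R S\<^esub> d - c' \<otimes>\<^bsub>pair_ring R S\<^esub> d"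
  "c \<otimes>\<^bsub>pair_ring R S\<^esub> (d - d') = c \<otimes>\<^bsub>pair_ring R S\<^esub> d - c \<otimes>\<^bsub>pair_ring R S\<^esub> d'"
  by (simp_all add: pair_ring_def frag_extend_diff case_prod_unfold frag_extend_fun_diff)

lemma pair_mult_add:
  "(c + c') \<otimes>\<^bsub>pair_ring R S\<^esub> d = c \<otimes>\<^bsub>pair_ring R S\<^esub> d + c' \<otimes>\<^bsub>pair_ring R S\<^esub> d"
  "c \<otimes>\<^bsub>pair_ring R S\<^esub> (d + d') = c \<otimes>\<^bsub>pair_ring R S\<^esub> d + c \<otimes>\<^bsub>pair_ring R S\<^esub> d'"
  using pair_mult_diff(1)[of R S c "0 - c'" d] pair_mult_diff(1)[of R S 0 c' d]
    pair_mult_diff(2)[of R S c d "0 - d'"] pair_mult_diff(2)[of R S c 0 d']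
  by (simp_all add: pair_mult_0)

lemma keys_diff_subset:
  "Poly_Mapping.keys (c :: 'a \<Rightarrow>\<^sub>0 int) \<subseteq> A \<Longrightarrow> Poly_Mapping.keys d \<subseteq> A \<Longrightarrow> Poly_Mapping.keys (c - d) \<subseteq> A"
  using keys_diff[of c d] by blast

lemma pair_ring_cring:
  assumes "cring R" "cring S"
  shows "cring (pair_ring R S)"
proof -
  interpret R: cring R by fact
  interpret S: cring S by fact
  let ?P = "pair_ring R S"
  let ?C = "carrier R \<times> carrier S"
  have closed: "Poly_Mapping.keys (c \<otimes>\<^bsub>?P\<^esub> d) \<subseteq> ?C"
    if "Poly_Mapping.keys c \<subseteq> ?C" "Poly_Mapping.keys d \<subseteq> ?C" for c d
    using that(1)
  proof (induction c rule: frag_induction)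
    case (one x)
    show ?case using that(2)
    proof (induction d rule: frag_induction)
      case (one y)
      then show ?case using \<open>x \<in> ?C\<close> by (cases x; cases y) (auto simp: pair_mult_of)
    qed (use one in \<open>auto simp: pair_mult_0 pair_mult_diff intro!: keys_diff_subset del: subsetI\<close>)
  qed (auto simp: pair_mult_0 pair_mult_diff intro!: keys_diff_subset del: subsetI)
  have comm: "c \<otimes>\<^bsub>?P\<^esub> d = d \<otimes>\<^bsub>?P\<^esub> c"
    if "Poly_Mapping.keys c \<subseteq> ?C" "Poly_Mapping.keys d \<subseteq> ?C" for c d
    using that(1)
  proof (induction c rule: frag_induction)
    case (one x)
    show ?case using that(2)
    proof (induction d rule: frag_induction)
      case (one y)
      then show ?case using \<open>x \<in> ?C\<close>
        by (cases x; cases y) (auto simp: pair_mult_of R.m_comm S.m_comm)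
    qed (use one in \<open>auto simp: pair_mult_0 pair_mult_diff\<close>)
  qed (auto simp: pair_mult_0 pair_mult_diff)
  have assoc: "c \<otimes>\<^bsub>?P\<^esub> d \<otimes>\<^bsub>?P\<^esub> e = c \<otimes>\<^bsub>?P\<^esub> (d \<otimes>\<^bsub>?P\<^esub> e)"
    if "Poly_Mapping.keys c \<subseteq> ?C" "Poly_Mapping.keys d \<subseteq> ?C" "Poly_Mapping.keys e \<subseteq> ?C" for c d e
    using that(1)
  proof (induction c rule: frag_induction)
    case (one x)
    show ?case using that(2)
    proof (induction d rule: frag_induction)
      case (one y)
      show ?case using that(3)
      proof (induction e rule: frag_induction)
        case (one z)
        then show ?case using \<open>x \<in> ?C\<close> \<open>y \<in> ?C\<close>
          by (cases x; cases y; cases z) (auto simp: pair_mult_of R.m_assoc S.m_assoc)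
      qed (auto simp: pair_mult_0 pair_mult_diff)
    qed (auto simp: pair_mult_0 pair_mult_diff)
  qed (auto simp: pair_mult_0 pair_mult_diff)
  have one_l: "\<one>\<^bsub>?P\<^esub> \<otimes>\<^bsub>?P\<^esub> c = c" if "Poly_Mapping.keys c \<subseteq> ?C" for c
    using that
    by (induction c rule: frag_induction)
      (auto simp: pair_mult_0 pair_mult_diff pair_mult_of pair_ring_simps)
  show ?thesis
  proof (rule cringI)
    show "abelian_group ?P"
    proof (rule abelian_groupI)
      fix x assume "x \<in> carrier ?P"
      then show "\<exists>y\<in>carrier ?P. y \<oplus>\<^bsub>?P\<^esub> x = \<zero>\<^bsub>?P\<^esub>"
        by (intro bexI[of _ "- x"]) (auto simp: pair_ring_simps)
    qed (auto simp: pair_ring_simps add_ac dest: subsetD[OF keys_add])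
    show "Group.comm_monoid ?P"
      by (rule comm_monoidI)
        (use closed comm assoc one_l in \<open>auto simp: pair_ring_simps del: subsetI\<close>)
  qed (auto simp: pair_mult_add pair_ring_simps)
qed

lemma pair_map_simps [simp]:
  "pair_map f g 0 = 0" "pair_map f g (frag_of (r, s)) = frag_of (f r, g s)"
  "pair_map f g (c - d) = pair_map f g c - pair_map f g d"
  "pair_map f g (c + d) = pair_map f g c + pair_map f g d"
  by (simp_all add: pair_map_def frag_extend_diff frag_extend_add)

lemma pair_map_hom:
  assumes f: "f \<in> ring_hom R R'" and g: "g \<in> ring_hom S S'"
  shows "pair_map f g \<in> ring_hom (pair_ring R S) (pair_ring R' S')"
proof (rule ring_hom_memI)
  note fg = ring_hom_memE[OF f] ring_hom_memE[OF g]
  fix c assume c: "c \<in> carrier (pair_ring R S)"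
  then have c': "Poly_Mapping.keys c \<subseteq> carrier R \<times> carrier S"
    by (simp add: pair_ring_simps)
  then have "Poly_Mapping.keys (pair_map f g c) \<subseteq> carrier R' \<times> carrier S'"
  proof (induction c rule: frag_induction)
    case (one x) then show ?case by (cases x) (auto simp: fg)
  qed (auto intro!: keys_diff_subset del: subsetI)
  then show "pair_map f g c \<in> carrier (pair_ring R' S')"
    by (simp add: pair_ring_simps)
  fix d assume d: "d \<in> carrier (pair_ring R S)"
  then have d': "Poly_Mapping.keys d \<subseteq> carrier R \<times> carrier S"
    by (simp add: pair_ring_simps)
  show "pair_map f g (c \<otimes>\<^bsub>pair_ring R S\<^esub> d) = pair_map f g c \<otimes>\<^bsub>pair_ring R' S'\<^esub> pair_map f g d"
    using c'
  proof (induction c rule: frag_induction)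
    case (one x)
    show ?case using d'
    proof (induction d rule: frag_induction)
      case (one y) then show ?case using \<open>x \<in> _\<close>
        by (cases x; cases y) (auto simp: fg pair_mult_of)
    qed (auto simp: pair_mult_0 pair_mult_diff)
  qed (auto simp: pair_mult_0 pair_mult_diff)
qed (use ring_hom_memE[OF f] ring_hom_memE[OF g] in \<open>auto simp: pair_ring_simps\<close>)

lemma tensor_relationsI:
  "r \<in> carrier R \<Longrightarrow> r' \<in> carrier R \<Longrightarrow> s \<in> carrier S \<Longrightarrow>
    frag_of (r \<oplus>\<^bsub>R\<^esub> r', s) - frag_of (r, s) - frag_of (r', s) \<in> tensor_relations k \<phi> R \<psi> S"
  "r \<in> carrier R \<Longrightarrow> s \<in> carrier S \<Longrightarrow> s' \<in> carrier S \<Longrightarrow>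
    frag_of (r, s \<oplus>\<^bsub>S\<^esub> s') - frag_of (r, s) - frag_of (r, s') \<in> tensor_relations k \<phi> R \<psi> S"
  "a \<in> carrier k \<Longrightarrow> r \<in> carrier R \<Longrightarrow> s \<in> carrier S \<Longrightarrow>
    frag_of (\<phi> a \<otimes>\<^bsub>R\<^esub> r, s) - frag_of (r, \<psi> a \<otimes>\<^bsub>S\<^esub> s) \<in> tensor_relations k \<phi> R \<psi> S"
  unfolding tensor_relations_def by blast+

lemma tensor_relations_cases [consumes 1, case_names left right scalar]:
  assumes "c \<in> tensor_relations k \<phi> R \<psi> S"
  obtains r r' s where "c = frag_of (r \<oplus>\<^bsub>R\<^esub> r', s) - frag_of (r, s) - frag_of (r', s)"
      "r \<in> carrier R" "r' \<in> carrier R" "s \<in> carrier S"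
    | r s s' where "c = frag_of (r, s \<oplus>\<^bsub>S\<^esub> s') - frag_of (r, s) - frag_of (r, s')"
      "r \<in> carrier R" "s \<in> carrier S" "s' \<in> carrier S"
    | a r s where "c = frag_of (\<phi> a \<otimes>\<^bsub>R\<^esub> r, s) - frag_of (r, \<psi> a \<otimes>\<^bsub>S\<^esub> s)"
      "a \<in> carrier k" "r \<in> carrier R" "s \<in> carrier S"
proof -
  from assms show thesis
    unfolding tensor_relations_def
    apply (elim UnE CollectE exE conjE)
      apply (rule that(1); assumption)
     apply (rule that(2); assumption)
    apply (rule that(3); assumption)
    done
qed

locale tensor_setup = R: cring R + S: cring S
  for k :: "('k, 'l) ring_scheme" and \<phi> and R :: "('a, 'm) ring_scheme"
    and \<psi> and S :: "('b, 'n) ring_scheme" +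
  assumes phi: "\<And>a. a \<in> carrier k \<Longrightarrow> \<phi> a \<in> carrier R"
    and psi: "\<And>a. a \<in> carrier k \<Longrightarrow> \<psi> a \<in> carrier S"
begin

abbreviation "P \<equiv> pair_ring R S"
abbreviation "I \<equiv> tensor_ideal k \<phi> R \<psi> S"
abbreviation "T \<equiv> tensor_ring k \<phi> R \<psi> S"

sublocale P: cring P
  by (rule pair_ring_cring) unfold_locales

lemma minus_P: "d \<in> carrier P \<Longrightarrow> c \<ominus>\<^bsub>P\<^esub> d = c - d"
proof -
  assume d: "d \<in> carrier P"
  then have "- d \<in> carrier P" by (simp add: pair_ring_simps)
  then have "\<ominus>\<^bsub>P\<^esub> d = - d"
    using d by (intro P.minus_equality) (auto simp: pair_ring_simps)
  then show ?thesis by (simp add: a_minus_def pair_ring_simps)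
qed

lemma relations_subset: "tensor_relations k \<phi> R \<psi> S \<subseteq> carrier P"
proof -
  have of: "frag_of (r, s) \<in> carrier P" if "r \<in> carrier R" "s \<in> carrier S" for r s
    using that by (simp add: pair_ring_simps)
  have diff: "c - d \<in> carrier P" if "c \<in> carrier P" "d \<in> carrier P" for c d
    using P.minus_closed[OF that] that by (simp add: minus_P)
  show ?thesis
    unfolding tensor_relations_def by (auto intro!: of diff simp: phi psi)
qed

sublocale I: ideal I P
  unfolding tensor_ideal_def by (rule P.genideal_ideal[OF relations_subset])

sublocale T: cring T
  unfolding tensor_ring_def by (rule I.quotient_is_cring) unfold_locales

lemma relations_ideal: "tensor_relations k \<phi> R \<psi> S \<subseteq> I"
  unfolding tensor_ideal_def by (rule P.genideal_self[OF relations_subset])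

lemma coset_eq_iff:
  "c \<in> carrier P \<Longrightarrow> d \<in> carrier P \<Longrightarrow> a_r_coset P I c = a_r_coset P I d \<longleftrightarrow> c - d \<in> I"
  using P.quotient_eq_iff_same_a_r_cos[OF I.is_ideal, of c d] by (simp add: minus_P)

lemma T_cases:
  assumes "x \<in> carrier T" obtains c where "c \<in> carrier P" "x = a_r_coset P I c"
  using assms unfolding tensor_ring_def FactRing_def A_RCOSETS_def' by auto

lemma coset_hom: "a_r_coset P I \<in> ring_hom P T"
  unfolding tensor_ring_def by (rule I.rcos_ring_hom)

lemma ideal_least:
  assumes "ideal J P" "tensor_relations k \<phi> R \<psi> S \<subseteq> J" shows "I \<subseteq> J"
  unfolding tensor_ideal_def by (rule P.genideal_minimal[OF assms])

end

locale tensor_functor = A: tensor_setup k \<phi> R \<psi> S + B: tensor_setup k' \<phi>' R' \<psi>' S'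
  for k :: "('k, 'l) ring_scheme" and \<phi> and R :: "('a, 'm) ring_scheme"
    and \<psi> and S :: "('b, 'n) ring_scheme"
    and k' :: "('k', 'l') ring_scheme" and \<phi>' and R' :: "('a', 'm') ring_scheme"
    and \<psi>' and S' :: "('b', 'n') ring_scheme" +
  fixes \<tau> f g
  assumes f: "f \<in> ring_hom R R'" and g: "g \<in> ring_hom S S'"
    and tau: "\<And>a. a \<in> carrier k \<Longrightarrow> \<tau> a \<in> carrier k'"
    and f_tau: "\<And>a. a \<in> carrier k \<Longrightarrow> f (\<phi> a) = \<phi>' (\<tau> a)"
    and g_tau: "\<And>a. a \<in> carrier k \<Longrightarrow> g (\<psi> a) = \<psi>' (\<tau> a)"
begin

abbreviation "TM \<equiv> tensor_map k' \<phi>' R' \<psi>' S' f g"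

sublocale h: ring_hom_ring A.P B.P "pair_map f g"
  by (rule ring_hom_ringI2[OF A.P.ring_axioms B.P.ring_axioms pair_map_hom[OF f g]])

lemma map_ideal: "c \<in> A.I \<Longrightarrow> pair_map f g c \<in> B.I"
proof -
  have "A.I \<subseteq> {c \<in> carrier A.P. pair_map f g c \<in> B.I}"
  proof (rule A.ideal_least)
    show "ideal {c \<in> carrier A.P. pair_map f g c \<in> B.I} A.P"
      by (rule h.ideal_vimage[OF B.I.is_ideal])
    note fg = ring_hom_memE[OF f] ring_hom_memE[OF g]
    have "pair_map f g c \<in> tensor_relations k' \<phi>' R' \<psi>' S'"
      if "c \<in> tensor_relations k \<phi> R \<psi> S" for c
      using that
    proof (cases rule: tensor_relations_cases)
      case (left r r' s)
      then have "pair_map f g c = frag_of (f r \<oplus>\<^bsub>R'\<^esub> f r', g s) - frag_of (f r, g s) - frag_of (f r', g s)"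
        by (simp add: fg(3))
      with left show ?thesis by (simp only: tensor_relationsI(1) fg(1,5))
    next
      case (right r s s')
      then have "pair_map f g c = frag_of (f r, g s \<oplus>\<^bsub>S'\<^esub> g s') - frag_of (f r, g s) - frag_of (f r, g s')"
        by (simp add: fg(7))
      with right show ?thesis by (simp only: tensor_relationsI(2) fg(1,5))
    next
      case (scalar a r s)
      then have "pair_map f g c =
          frag_of (\<phi>' (\<tau> a) \<otimes>\<^bsub>R'\<^esub> f r, g s) - frag_of (f r, \<psi>' (\<tau> a) \<otimes>\<^bsub>S'\<^esub> g s)"
        by (simp add: fg(2,6) A.phi A.psi f_tau g_tau)
      with scalar show ?thesis by (simp only: tensor_relationsI(3) fg(1,5) tau)
    qed
    then show "tensor_relations k \<phi> R \<psi> S \<subseteq> {c \<in> carrier A.P. pair_map f g c \<in> B.I}"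
      using A.relations_subset B.relations_ideal by auto
  qed
  then show "c \<in> A.I \<Longrightarrow> pair_map f g c \<in> B.I" by auto
qed

lemma map_coset:
  assumes c: "c \<in> carrier A.P"
  shows "TM (a_r_coset A.P A.I c) = a_r_coset B.P B.I (pair_map f g c)"
proof -
  have "a_r_coset B.P B.I (pair_map f g d) = a_r_coset B.P B.I (pair_map f g c)"
    if "d \<in> a_r_coset A.P A.I c" for d
  proof -
    from that obtain i where "i \<in> A.I" "d = i + c"
      by (auto simp: a_r_coset_def' pair_ring_simps)
    moreover from this have "d \<in> carrier A.P"
      using c A.I.Icarr A.P.a_closed[of i c] by (simp add: pair_ring_simps)
    ultimately show ?thesis
      using c map_ideal[of i] h.hom_closed[of d] h.hom_closed[of c] by (subst B.coset_eq_iff) auto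
  qed
  then have "TM (a_r_coset A.P A.I c) =
      (\<Union>d\<in>a_r_coset A.P A.I c. a_r_coset B.P B.I (pair_map f g c))"
    unfolding tensor_map_def by (intro SUP_cong refl)
  also have "\<dots> = a_r_coset B.P B.I (pair_map f g c)"
    using A.I.a_rcos_self[OF c] by (intro SUP_const) blast
  finally show ?thesis .
qed

lemma map_hom: "TM \<in> ring_hom A.T B.T"
proof (rule ring_hom_memI)
  note q = ring_hom_memE[OF A.coset_hom] ring_hom_memE[OF B.coset_hom]
  fix x y assume x: "x \<in> carrier A.T" and y: "y \<in> carrier A.T"
  obtain c where c: "c \<in> carrier A.P" "x = a_r_coset A.P A.I c"
    by (rule A.T_cases[OF x])
  obtain d where d: "d \<in> carrier A.P" "y = a_r_coset A.P A.I d"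
    by (rule A.T_cases[OF y])
  show "TM x \<in> carrier B.T" using c q by (simp add: map_coset)
  have "TM (x \<otimes>\<^bsub>A.T\<^esub> y) = TM (a_r_coset A.P A.I (c \<otimes>\<^bsub>A.P\<^esub> d))"
    using c d by (simp add: q(2))
  also have "\<dots> = a_r_coset B.P B.I (pair_map f g (c \<otimes>\<^bsub>A.P\<^esub> d))"
    using c d by (intro map_coset A.P.m_closed)
  also have "\<dots> = TM x \<otimes>\<^bsub>B.T\<^esub> TM y"
    using c d by (simp add: q(6) map_coset)
  finally show "TM (x \<otimes>\<^bsub>A.T\<^esub> y) = TM x \<otimes>\<^bsub>B.T\<^esub> TM y" .
  have "TM (x \<oplus>\<^bsub>A.T\<^esub> y) = TM (a_r_coset A.P A.I (c \<oplus>\<^bsub>A.P\<^esub> d))"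
    using c d by (simp add: q(3))
  also have "\<dots> = a_r_coset B.P B.I (pair_map f g (c \<oplus>\<^bsub>A.P\<^esub> d))"
    using c d by (intro map_coset A.P.a_closed)
  also have "\<dots> = TM x \<oplus>\<^bsub>B.T\<^esub> TM y"
    using c d by (simp add: q(7) map_coset)
  finally show "TM (x \<oplus>\<^bsub>A.T\<^esub> y) = TM x \<oplus>\<^bsub>B.T\<^esub> TM y" .
next
  have "TM \<one>\<^bsub>A.T\<^esub> = TM (a_r_coset A.P A.I \<one>\<^bsub>A.P\<^esub>)"
    by (simp add: ring_hom_memE(4)[OF A.coset_hom])
  also have "\<dots> = a_r_coset B.P B.I (pair_map f g \<one>\<^bsub>A.P\<^esub>)"
    by (intro map_coset A.P.one_closed)
  also have "\<dots> = \<one>\<^bsub>B.T\<^esub>"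
    by (simp add: ring_hom_memE(4)[OF B.coset_hom])
  finally show "TM \<one>\<^bsub>A.T\<^esub> = \<one>\<^bsub>B.T\<^esub>" .
qed

end


lemma tensor_simps [simp]:
  "carrier (tensor k R S) = carrier (tensor_ring k (struct_map R) R (struct_map S) S)"
  "x \<otimes>\<^bsub>tensor k R S\<^esub> y = x \<otimes>\<^bsub>tensor_ring k (struct_map R) R (struct_map S) S\<^esub> y"
  "x \<oplus>\<^bsub>tensor k R S\<^esub> y = x \<oplus>\<^bsub>tensor_ring k (struct_map R) R (struct_map S) S\<^esub> y"
  "\<one>\<^bsub>tensor k R S\<^esub> = \<one>\<^bsub>tensor_ring k (struct_map R) R (struct_map S) S\<^esub>"
  "\<zero>\<^bsub>tensor k R S\<^esub> = \<zero>\<^bsub>tensor_ring k (struct_map R) R (struct_map S) S\<^esub>"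
  "shift (tensor k R S) = tensor_map k (struct_map R) R (struct_map S) S (shift R) (shift S)"
  "struct_map (tensor k R S) a =
    pure_tensor k (struct_map R) R (struct_map S) S (struct_map R a) \<one>\<^bsub>S\<^esub>"
  by (simp_all add: tensor_def ring.defs)

lemma cring_cong:
  assumes "cring A" "carrier B = carrier A" "\<one>\<^bsub>B\<^esub> = \<one>\<^bsub>A\<^esub>" "\<zero>\<^bsub>B\<^esub> = \<zero>\<^bsub>A\<^esub>"
    "\<And>x y. x \<in> carrier A \<Longrightarrow> y \<in> carrier A \<Longrightarrow> x \<otimes>\<^bsub>B\<^esub> y = x \<otimes>\<^bsub>A\<^esub> y"
    "\<And>x y. x \<in> carrier A \<Longrightarrow> y \<in> carrier A \<Longrightarrow> x \<oplus>\<^bsub>B\<^esub> y = x \<oplus>\<^bsub>A\<^esub> y"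
  shows "cring B"
proof -
  interpret A: cring A by fact
  show ?thesis
  proof (rule cringI)
    show "abelian_group B"
    proof (rule abelian_groupI)
      fix x assume "x \<in> carrier B"
      then show "\<exists>y\<in>carrier B. y \<oplus>\<^bsub>B\<^esub> x = \<zero>\<^bsub>B\<^esub>"
        by (intro bexI[of _ "\<ominus>\<^bsub>A\<^esub> x"]) (simp_all add: assms A.l_neg)
    qed (simp_all add: assms A.a_ac)
    show "Group.comm_monoid B"
      by (rule comm_monoidI) (simp_all add: assms A.m_ac)
  qed (simp_all add: assms A.l_distr)
qed

lemma tensor_setup_of_algebras:
  assumes "difference_algebra k R" "difference_algebra k S"
  shows "tensor_setup k (struct_map R) R (struct_map S) S"
proof -
  interpret R: difference_algebra k R by fact
  interpret S: difference_algebra k S by fact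
  show ?thesis
    by unfold_locales
      (fact ring_hom_memE(1)[OF R.struct_map_hom] ring_hom_memE(1)[OF S.struct_map_hom])+
qed

lemma tensor_shift_functor:
  assumes "difference_algebra k R" "difference_algebra k S"
  shows "tensor_functor k (struct_map R) R (struct_map S) S k (struct_map R) R (struct_map S) S
    (shift k) (shift R) (shift S)"
proof -
  interpret R: difference_algebra k R by fact
  interpret S: difference_algebra k S by fact
  interpret tensor_setup k "struct_map R" R "struct_map S" S
    by (rule tensor_setup_of_algebras[OF assms])
  show ?thesis
    by unfold_locales
      (fact R.shift_hom S.shift_hom ring_hom_memE(1)[OF R.base.shift_hom]
         R.struct_map_shift S.struct_map_shift)+
qed

lemma tensor_difference_algebra:
  assumes "difference_algebra k R" "difference_algebra k S"
  shows "difference_algebra k (tensor k R S)"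
proof -
  interpret R: difference_algebra k R by fact
  interpret S: difference_algebra k S by fact
  interpret tensor_functor k "struct_map R" R "struct_map S" S k "struct_map R" R "struct_map S" S
    "shift k" "shift R" "shift S"
    by (rule tensor_shift_functor[OF assms])
  note sR = ring_hom_memE[OF R.struct_map_hom]
  note hR = ring_hom_memE[OF R.shift_hom] and hS = ring_hom_memE[OF S.shift_hom]
  note q = ring_hom_memE[OF A.coset_hom]
  have "cring (tensor k R S)"
    by (rule cring_cong[OF A.T.is_cring]) simp_all
  then interpret T': cring "tensor k R S" .
  have of: "frag_of (r, s) \<in> carrier A.P" if "r \<in> carrier R" "s \<in> carrier S" for r s
    using that by (simp add: pair_ring_simps)
  show ?thesis
  proof unfold_locales
    show "shift (tensor k R S) \<in> ring_hom (tensor k R S) (tensor k R S)"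
      using map_hom by (auto simp: ring_hom_def)
    show "struct_map (tensor k R S) \<in> ring_hom k (tensor k R S)"
    proof (rule ring_hom_memI)
      fix a b assume a: "a \<in> carrier k" and b: "b \<in> carrier k"
      show "struct_map (tensor k R S) a \<in> carrier (tensor k R S)"
        using a by (simp add: pure_tensor_def q of sR)
      show "struct_map (tensor k R S) (a \<otimes>\<^bsub>k\<^esub> b) =
          struct_map (tensor k R S) a \<otimes>\<^bsub>tensor k R S\<^esub> struct_map (tensor k R S) b"
        using a b by (simp add: pure_tensor_def sR of q(2)[symmetric] pair_mult_of)
      have "a_r_coset A.P A.I (frag_of (struct_map R a \<oplus>\<^bsub>R\<^esub> struct_map R b, \<one>\<^bsub>S\<^esub>)) =
        a_r_coset A.P A.I (frag_of (struct_map R a, \<one>\<^bsub>S\<^esub>) \<oplus>\<^bsub>A.P\<^esub> frag_of (struct_map R b, \<one>\<^bsub>S\<^esub>))"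
        using a b A.relations_ideal
          tensor_relationsI(1)[of "struct_map R a" R "struct_map R b" "\<one>\<^bsub>S\<^esub>" S k "struct_map R" "struct_map S"]
        by (subst A.coset_eq_iff) (auto simp: sR of intro!: A.P.a_closed, simp add: pair_ring_simps(4) diff_diff_eq, blast)
      then show "struct_map (tensor k R S) (a \<oplus>\<^bsub>k\<^esub> b) =
          struct_map (tensor k R S) a \<oplus>\<^bsub>tensor k R S\<^esub> struct_map (tensor k R S) b"
        using a b by (simp add: pure_tensor_def sR of q(3)[symmetric])
    next
      show "struct_map (tensor k R S) \<one>\<^bsub>k\<^esub> = \<one>\<^bsub>tensor k R S\<^esub>"
        by (simp add: pure_tensor_def sR q(4)[symmetric] pair_ring_simps)
    qed
    fix a assume a: "a \<in> carrier k"
    then show "shift (tensor k R S) (struct_map (tensor k R S) a) =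
        struct_map (tensor k R S) (shift k a)"
      by (simp add: pure_tensor_def map_coset of sR hS R.struct_map_shift)
  qed
qed


section \<open>Separability refers to extensions in every type\<close>

lemma countable_closure_card:
  fixes X0 :: "'u set"
  assumes "infinite C" "|X0| \<le>o |C|" "\<And>Y. |Y| \<le>o |C| \<Longrightarrow> |step Y| \<le>o |C|"
  shows "|\<Union>n. rec_nat X0 (\<lambda>_. step) n| \<le>o |C|"
proof (rule card_of_UNION_ordLeq_infinite[OF assms(1)])
  show "|UNIV :: nat set| \<le>o |C|"
    using assms(1) by (simp add: infinite_iff_card_of_nat)
  have "|rec_nat X0 (\<lambda>_. step) n| \<le>o |C|" for n
    by (induction n) (use assms in auto)
  then show "\<forall>n\<in>UNIV. |rec_nat X0 (\<lambda>_. step) n| \<le>o |C|" by blast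
qed

lemma small_difference_subfield:
  fixes K :: "('k, 'u, 'm) diff_alg_scheme"
  assumes K: "difference_field K" and kK: "difference_algebra k K"
    and F: "finite F" "F \<subseteq> carrier K"
  obtains L where "F \<subseteq> L" "subfield L K" "struct_map K ` carrier k \<subseteq> L" "shift K ` L \<subseteq> L"
    "\<exists>\<iota> :: 'u \<Rightarrow> ('k \<times> nat) set. inj_on \<iota> L"
proof -
  interpret K: difference_field K by fact
  interpret kK: difference_algebra k K by fact
  let ?C = "UNIV :: ('k \<times> nat) set"
  have C: "infinite ?C" by (simp add: finite_prod)
  define X0 where "X0 = F \<union> struct_map K ` carrier k \<union> {\<one>\<^bsub>K\<^esub>}"
  define step where "step Y = Y \<union> (\<lambda>(x, y). x \<oplus>\<^bsub>K\<^esub> y) ` (Y \<times> Y) \<union> (\<lambda>(x, y). x \<otimes>\<^bsub>K\<^esub> y) ` (Y \<times> Y) \<union>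
    (\<lambda>x. \<ominus>\<^bsub>K\<^esub> x) ` Y \<union> (\<lambda>x. inv\<^bsub>K\<^esub> x) ` (Y - {\<zero>\<^bsub>K\<^esub>}) \<union> shift K ` Y" for Y
  define L where "L = (\<Union>n. rec_nat X0 (\<lambda>_. step) n)"
  have im: "|f ` Y| \<le>o |?C|" if "|Y| \<le>o |?C|" for f :: "'z \<Rightarrow> 'u" and Y
    using ordLeq_transitive[OF card_of_image that] .
  have fin: "|Y| \<le>o |?C|" if "finite Y" for Y :: "'u set"
    using C that by (simp add: ordLess_imp_ordLeq)
  have "|carrier k| \<le>o |?C|"
    by (rule card_of_ordLeqI[of "\<lambda>a. (a, 0)"]) (auto simp: inj_on_def)
  then have X0: "|X0| \<le>o |?C|"
    unfolding X0_def using F C by (intro card_of_Un_ordLeq_infinite im fin) auto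
  have step: "|step Y| \<le>o |?C|" if Y: "|Y| \<le>o |?C|" for Y
    unfolding step_def
    by (intro card_of_Un_ordLeq_infinite C im card_of_Times_ordLeq_infinite Y
        ordLeq_transitive[OF card_of_mono1[OF Diff_subset] Y])
  have "|L| \<le>o |?C|"
    unfolding L_def by (rule countable_closure_card[OF C X0 step])
  then obtain j :: "'u \<Rightarrow> 'k \<times> nat" where "inj_on j L"
    by (auto simp flip: card_of_ordLeq)
  then have inj: "inj_on (\<lambda>x. {j x}) L" by (auto simp: inj_on_def)
  have X0_L: "X0 \<subseteq> L" unfolding L_def by (rule order_trans[OF _ UN_upper[of 0]]) simp_all
  have sub: "Y \<subseteq> step Y" for Y by (auto simp: step_def)
  have "mono (\<lambda>n. rec_nat X0 (\<lambda>_. step) n)"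
    by (rule incseq_SucI) (simp add: sub)
  then have step_L: "step L \<subseteq> L"
  proof -
    have two: "\<exists>n. x \<in> rec_nat X0 (\<lambda>_. step) n \<and> y \<in> rec_nat X0 (\<lambda>_. step) n" if "x \<in> L" "y \<in> L" for x y
    proof -
      from that obtain n m where "x \<in> rec_nat X0 (\<lambda>_. step) n" "y \<in> rec_nat X0 (\<lambda>_. step) m" by (auto simp: L_def)
      then show ?thesis
        using monoD[OF \<open>mono _\<close>, of n "max n m"] monoD[OF \<open>mono _\<close>, of m "max n m"] by fastforce
    qed
    show ?thesis
    proof
      fix z assume "z \<in> step L"
      then obtain x y where "x \<in> L" "y \<in> L" "z \<in> step {x, y}"
        unfolding step_def by blast
      moreover obtain n where "{x, y} \<subseteq> rec_nat X0 (\<lambda>_. step) n"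
        using two[OF \<open>x \<in> L\<close> \<open>y \<in> L\<close>] by blast
      moreover have "step A \<subseteq> step B" if "A \<subseteq> B" for A B
        using that unfolding step_def by blast
      ultimately have "z \<in> step (rec_nat X0 (\<lambda>_. step) n)" by blast
      then have "z \<in> rec_nat X0 (\<lambda>_. step) (Suc n)" by simp
      then show "z \<in> L" unfolding L_def by blast
    qed
  qed
  have closed: "x \<oplus>\<^bsub>K\<^esub> y \<in> L" "x \<otimes>\<^bsub>K\<^esub> y \<in> L" "\<ominus>\<^bsub>K\<^esub> x \<in> L" "shift K x \<in> L"
    if "x \<in> L" "y \<in> L" for x y
    using that by (auto intro!: subsetD[OF step_L] simp: step_def)
  have inv: "inv\<^bsub>K\<^esub> x \<in> L" if "x \<in> L - {\<zero>\<^bsub>K\<^esub>}" for x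
    using that by (auto intro!: subsetD[OF step_L] simp: step_def)
  have step_K: "step Y \<subseteq> carrier K" if "Y \<subseteq> carrier K" for Y
  proof -
    have "inv\<^bsub>K\<^esub> x \<in> carrier K" if "x \<in> carrier K" "x \<noteq> \<zero>\<^bsub>K\<^esub>" for x
      using that by (intro K.Units_inv_closed) (simp add: K.field_Units)
    then show ?thesis
      using that ring_hom_memE(1)[OF K.shift_hom] unfolding step_def by auto
  qed
  have "rec_nat X0 (\<lambda>_. step) n \<subseteq> carrier K" for n
  proof (induction n)
    case 0 show ?case using F ring_hom_memE(1)[OF kK.struct_map_hom] by (auto simp: X0_def)
  qed (simp add: step_K)
  then have L_K: "L \<subseteq> carrier K" by (auto simp: L_def)
  have "subfield L K"
    by (intro K.subfieldI' K.subringI) (use L_K X0_L closed inv in \<open>auto simp: X0_def\<close>)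
  then show ?thesis
    using that[of L] X0_L inj closed(4) by (auto simp: X0_def)
qed

lemma (in tensor_setup) ideal_finite_support:
  assumes "c \<in> I"
  shows "\<exists>F. finite F \<and> F \<subseteq> carrier S \<and>
    (\<forall>L. F \<subseteq> L \<longrightarrow> subring L S \<longrightarrow> \<psi> ` carrier k \<subseteq> L \<longrightarrow>
      c \<in> tensor_ideal k \<phi> R \<psi> (S\<lparr>carrier := L\<rparr>))"
proof -
  define G where "G F c \<longleftrightarrow> finite F \<and> F \<subseteq> carrier S \<and>
    (\<forall>L. F \<subseteq> L \<longrightarrow> subring L S \<longrightarrow> \<psi> ` carrier k \<subseteq> L \<longrightarrow>
      c \<in> tensor_ideal k \<phi> R \<psi> (S\<lparr>carrier := L\<rparr>))" for F c
  have stp: "tensor_setup k \<phi> R \<psi> (S\<lparr>carrier := L\<rparr>)" if "subring L S" "\<psi> ` carrier k \<subseteq> L" for L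
  proof -
    have "cring (S\<lparr>carrier := L\<rparr>)"
      using that(1) S.subcring_iff S.subcringI' subringE(1) by blast
    then show ?thesis
      using that(2) phi by (auto simp: tensor_setup_def tensor_setup_axioms_def R.is_cring)
  qed
  have mult: "c \<otimes>\<^bsub>pair_ring R (S\<lparr>carrier := L\<rparr>)\<^esub> d = c \<otimes>\<^bsub>P\<^esub> d" for L c d
    by (simp add: pair_ring_def)
  define J where "J = {c \<in> carrier P. \<exists>F. G F c}"
  have J_mult: "c \<otimes>\<^bsub>P\<^esub> d \<in> J" if c: "c \<in> carrier P" and d: "d \<in> J" for c d
  proof -
    from d obtain F where F: "G F d" by (auto simp: J_def)
    have "G (F \<union> snd ` Poly_Mapping.keys c) (c \<otimes>\<^bsub>P\<^esub> d)"
      unfolding G_def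
    proof (intro conjI allI impI)
      fix L assume L: "F \<union> snd ` Poly_Mapping.keys c \<subseteq> L" "subring L S" "\<psi> ` carrier k \<subseteq> L"
      interpret L: tensor_setup k \<phi> R \<psi> "S\<lparr>carrier := L\<rparr>" by (rule stp[OF L(2,3)])
      have "c \<in> carrier L.P" using c L(1) by (force simp: pair_ring_simps)
      then show "c \<otimes>\<^bsub>P\<^esub> d \<in> L.I"
        using L.I.I_l_closed[of d c] F L by (simp add: mult G_def)
    qed (use F c in \<open>auto simp: G_def pair_ring_simps\<close>)
    then show ?thesis using c d by (auto simp: J_def)
  qed
  have J_diff: "c - d \<in> J" if c: "c \<in> J" and d: "d \<in> J" for c d
  proof -
    from c obtain F where F: "G F c" by (auto simp: J_def)
    from d obtain F' where F': "G F' d" by (auto simp: J_def)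
    have "G (F \<union> F') (c - d)"
      unfolding G_def
    proof (intro conjI allI impI)
      fix L assume L: "F \<union> F' \<subseteq> L" "subring L S" "\<psi> ` carrier k \<subseteq> L"
      interpret L: tensor_setup k \<phi> R \<psi> "S\<lparr>carrier := L\<rparr>" by (rule stp[OF L(2,3)])
      have cd: "c \<in> L.I" "d \<in> L.I" using F F' L by (auto simp: G_def)
      then have "c \<ominus>\<^bsub>L.P\<^esub> d \<in> L.I"
        unfolding a_minus_def by (intro L.I.a_closed L.I.a_inv_closed)
      then show "c - d \<in> L.I" using L.minus_P[of d c] cd L.I.Icarr by simp
    qed (use F F' in \<open>auto simp: G_def\<close>)
    moreover have "c - d \<in> carrier P"
      using c d P.minus_closed[of c d] minus_P[of d c] by (simp add: J_def)
    ultimately show ?thesis by (auto simp: J_def)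
  qed
  have "ideal J P"
  proof (rule idealI[OF P.ring_axioms])
    have "0 \<in> J"
    proof -
      have "G {} 0" unfolding G_def
      proof (intro conjI allI impI)
        fix L assume L: "subring L S" "\<psi> ` carrier k \<subseteq> L"
        interpret L: tensor_setup k \<phi> R \<psi> "S\<lparr>carrier := L\<rparr>" by (rule stp[OF L])
        show "0 \<in> L.I" using L.I.zero_closed by (simp add: pair_ring_simps)
      qed auto
      then show ?thesis using P.zero_closed by (auto simp: J_def pair_ring_simps)
    qed
    have minus: "\<ominus>\<^bsub>P\<^esub> c = - c" if "c \<in> carrier P" for c
      using minus_P[OF that, of 0] that by (simp add: a_minus_def pair_ring_simps)
    show "subgroup J (add_monoid P)"
    proof (rule P.add.subgroupI)
      fix a b assume a: "a \<in> J" and b: "b \<in> J"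
      show "\<ominus>\<^bsub>P\<^esub> a \<in> J"
        using J_diff[OF \<open>0 \<in> J\<close> a] a minus[of a] by (simp add: J_def)
      show "a \<oplus>\<^bsub>P\<^esub> b \<in> J"
        using J_diff[OF a J_diff[OF \<open>0 \<in> J\<close> b]] by (simp add: pair_ring_simps)
    qed (use \<open>0 \<in> J\<close> in \<open>auto simp: J_def\<close>)
    fix a x assume a: "a \<in> J" and x: "x \<in> carrier P"
    show "x \<otimes>\<^bsub>P\<^esub> a \<in> J" by (rule J_mult[OF x a])
    then show "a \<otimes>\<^bsub>P\<^esub> x \<in> J" using a x P.m_comm[of a x] by (simp add: J_def)
  qed
  moreover have "tensor_relations k \<phi> R \<psi> S \<subseteq> J"
  proof
    fix c assume c: "c \<in> tensor_relations k \<phi> R \<psi> S"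
    have main: "G F c" if F: "finite F" "F \<subseteq> carrier S"
      "\<And>L. F \<subseteq> L \<Longrightarrow> c \<in> tensor_relations k \<phi> R \<psi> (S\<lparr>carrier := L\<rparr>)" for F
      unfolding G_def
    proof (intro conjI allI impI F)
      fix L assume L: "F \<subseteq> L" "subring L S" "\<psi> ` carrier k \<subseteq> L"
      interpret L: tensor_setup k \<phi> R \<psi> "S\<lparr>carrier := L\<rparr>" by (rule stp[OF L(2,3)])
      show "c \<in> L.I" using L.relations_ideal F(3)[OF L(1)] by blast
    qed
    have "\<exists>F. G F c"
      using c
    proof (cases rule: tensor_relations_cases)
      case (left r r' s)
      have "G {s} c"
        by (rule main)
          (use left tensor_relationsI(1)[of r R r' s "S\<lparr>carrier := _\<rparr>" k \<phi> \<psi>] in auto)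
      then show ?thesis ..
    next
      case (right r s s')
      have "G {s, s'} c"
        by (rule main)
          (use right tensor_relationsI(2)[of r R s "S\<lparr>carrier := _\<rparr>" s' k \<phi> \<psi>] in auto)
      then show ?thesis ..
    next
      case (scalar a r s)
      have "G {s} c"
        by (rule main)
          (use scalar tensor_relationsI(3)[of a k r R s "S\<lparr>carrier := _\<rparr>" \<phi> \<psi>] in auto)
      then show ?thesis ..
    qed
    then show "c \<in> J" using c relations_subset by (auto simp: J_def)
  qed
  ultimately have "I \<subseteq> J" by (rule ideal_least)
  with assms show ?thesis by (auto simp: J_def G_def)
qed


lemma pair_map_comp_eq:
  assumes "Poly_Mapping.keys c \<subseteq> A \<times> B"
    and "\<And>a b. a \<in> A \<Longrightarrow> b \<in> B \<Longrightarrow> f' (f a) = h' (h a) \<and> g' (g b) = l' (l b)"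
  shows "pair_map f' g' (pair_map f g c) = pair_map h' l' (pair_map h l c)"
  using assms(1)
proof (induction c rule: frag_induction)
  case (one x)
  then show ?case using assms(2) by (cases x) auto
qed auto

theorem sigma_separable_all_extensions:
  fixes K :: "('k, 'u, 'n) diff_alg_scheme"
  assumes R: "difference_algebra k R" and sep: "sigma_separable k R"
    and K: "difference_field K" and kK: "difference_algebra k K"
  shows "inj_on (shift (tensor k R K)) (carrier (tensor k R K))"
proof (rule inj_onI)
  interpret R: difference_algebra k R by fact
  interpret K: difference_field K by fact
  interpret kK: difference_algebra k K by fact
  let ?sR = "struct_map R" and ?sK = "struct_map K"
  interpret RK: tensor_functor k ?sR R ?sK K k ?sR R ?sK K "shift k" "shift R" "shift K"
    by (rule tensor_shift_functor[OF R kK])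
  fix x y assume "x \<in> carrier (tensor k R K)" "y \<in> carrier (tensor k R K)"
    and eq: "shift (tensor k R K) x = shift (tensor k R K) y"
  then have xy: "x \<in> carrier RK.A.T" "y \<in> carrier RK.A.T" by simp_all
  obtain c where c: "c \<in> carrier RK.A.P" "x = a_r_coset RK.A.P RK.A.I c"
    by (rule RK.A.T_cases[OF xy(1)])
  obtain d where d: "d \<in> carrier RK.A.P" "y = a_r_coset RK.A.P RK.A.I d"
    by (rule RK.A.T_cases[OF xy(2)])
  define e where "e = pair_map (shift R) (shift K) c - pair_map (shift R) (shift K) d"
  have "a_r_coset RK.A.P RK.A.I (pair_map (shift R) (shift K) c) =
      a_r_coset RK.A.P RK.A.I (pair_map (shift R) (shift K) d)"
    using eq c d by (simp add: RK.map_coset)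
  then have "e \<in> RK.A.I"
    unfolding e_def by (subst (asm) RK.A.coset_eq_iff) (use c d in simp_all)
  then obtain F where F: "finite F" "F \<subseteq> carrier K"
    "\<And>L. F \<subseteq> L \<Longrightarrow> subring L K \<Longrightarrow> ?sK ` carrier k \<subseteq> L \<Longrightarrow>
       e \<in> tensor_ideal k ?sR R ?sK (K\<lparr>carrier := L\<rparr>)"
    using RK.A.ideal_finite_support by meson
  have cd_K: "Poly_Mapping.keys c \<subseteq> carrier R \<times> carrier K" "Poly_Mapping.keys d \<subseteq> carrier R \<times> carrier K"
    using c d by (simp_all add: pair_ring_simps)
  obtain L where L: "F \<union> snd ` Poly_Mapping.keys c \<union> snd ` Poly_Mapping.keys d \<subseteq> L"
    "subfield L K" "?sK ` carrier k \<subseteq> L" "shift K ` L \<subseteq> L"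
    "\<exists>\<iota> :: 'u \<Rightarrow> ('k \<times> nat) set. inj_on \<iota> L"
  proof (rule small_difference_subfield[OF K kK])
    show "finite (F \<union> snd ` Poly_Mapping.keys c \<union> snd ` Poly_Mapping.keys d)" using F by simp
    show "F \<union> snd ` Poly_Mapping.keys c \<union> snd ` Poly_Mapping.keys d \<subseteq> carrier K"
      using F cd_K by auto
  qed
  then obtain \<iota> :: "'u \<Rightarrow> ('k \<times> nat) set" where \<iota>: "inj_on \<iota> L" by blast
  define j where "j = inv_into L \<iota>"
  have j [simp]: "j (\<iota> z) = z" if "z \<in> L" for z
    using \<iota> that by (simp add: j_def)
  let ?KL = "K\<lparr>carrier := L\<rparr>"
  define K1 :: "('k, ('k \<times> nat) set) diff_alg" where "K1 =
    \<lparr>carrier = \<iota> ` L, monoid.mult = (\<lambda>a b. \<iota> (j a \<otimes>\<^bsub>K\<^esub> j b)), monoid.one = \<iota> \<one>\<^bsub>K\<^esub>, ring.zero = \<iota> \<zero>\<^bsub>K\<^esub>,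
     ring.add = (\<lambda>a b. \<iota> (j a \<oplus>\<^bsub>K\<^esub> j b)), shift = (\<lambda>a. \<iota> (shift K (j a))),
     struct_map = (\<lambda>a. \<iota> (?sK a))\<rparr>"
  have L_K: "L \<subseteq> carrier K" using L(2) by (rule subfieldE(3))
  note closed = subringE[OF subfieldE(1)[OF L(2)]]
  interpret KL: field ?KL by (rule K.subfield_iff(2)[OF L(2)])
  note sh = ring_hom_memE[OF K.shift_hom] and sK = ring_hom_memE[OF kK.struct_map_hom]
  have sL: "shift K z \<in> L" if "z \<in> L" for z using that L(4) by blast
  have kL: "?sK a \<in> L" if "a \<in> carrier k" for a using that L(3) by blast
  have LK: "z \<in> carrier K" if "z \<in> L" for z using that L_K by blast
  have iso: "\<iota> \<in> ring_iso ?KL K1"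
    using \<iota> by (auto simp: ring_iso_def ring_hom_def bij_betw_def K1_def)
  have "K1\<lparr>ring.zero := \<iota> \<zero>\<^bsub>?KL\<^esub>\<rparr> = K1" by (simp add: K1_def)
  then interpret K1: field K1
    using KL.ring_iso_imp_img_field[OF iso] by simp
  have K1: "difference_field K1"
  proof unfold_locales
    show "shift K1 \<in> ring_hom K1 K1"
      by (rule ring_hom_memI) (auto simp: K1_def sL closed sh LK)
  qed
  have kK1: "difference_algebra k K1"
  proof (unfold_locales)
    show "shift K1 \<in> ring_hom K1 K1"
      using K1 by (simp add: difference_field_def difference_ring_def difference_ring_axioms_def)
    show "struct_map K1 \<in> ring_hom k K1"
      by (rule ring_hom_memI) (auto simp: K1_def kL sK)
    show "shift K1 (struct_map K1 a) = struct_map K1 (shift k a)" if "a \<in> carrier k" for a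
      using that by (simp add: K1_def kL kK.struct_map_shift)
  qed
  interpret RK1: tensor_functor k ?sR R "struct_map K1" K1 k ?sR R "struct_map K1" K1
    "shift k" "shift R" "shift K1"
    by (rule tensor_shift_functor[OF R kK1])
  have id_hom: "id \<in> ring_hom A A" for A :: "('z, 'zz) ring_scheme"
    by (auto simp: ring_hom_def)
  interpret RL: tensor_setup k ?sR R ?sK ?KL
    by (intro tensor_setup.intro tensor_setup_axioms.intro R.is_cring KL.is_cring)
      (simp_all add: kL RK.A.phi)
  interpret up: tensor_functor k ?sR R ?sK ?KL k ?sR R "struct_map K1" K1 id id \<iota>
  proof -
    have "\<iota> \<in> ring_hom ?KL K1" using iso by (simp add: ring_iso_def)
    then show "tensor_functor k ?sR R ?sK ?KL k ?sR R (struct_map K1) K1 id id \<iota>"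
      by (intro tensor_functor.intro tensor_functor_axioms.intro RL.tensor_setup_axioms
          RK1.A.tensor_setup_axioms id_hom) (simp_all add: K1_def)
  qed
  have j_hom: "j \<in> ring_hom K1 K"
    by (rule ring_hom_memI) (auto simp: K1_def closed LK)
  interpret down: tensor_functor k ?sR R "struct_map K1" K1 k ?sR R ?sK K id id j
    by (intro tensor_functor.intro tensor_functor_axioms.intro RK1.A.tensor_setup_axioms
        RK.A.tensor_setup_axioms id_hom j_hom) (simp_all add: K1_def kL)
  have e: "e \<in> RL.I"
    using F(3)[of L] L subfieldE(1)[OF L(2)] by blast
  have cd_L: "Poly_Mapping.keys c \<subseteq> carrier R \<times> L" "Poly_Mapping.keys d \<subseteq> carrier R \<times> L"
    using cd_K L(1) by force+
  define c1 d1 where "c1 = pair_map id \<iota> c" and "d1 = pair_map id \<iota> d"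
  have "c \<in> carrier RL.P" "d \<in> carrier RL.P"
    using cd_L by (simp_all add: pair_ring_simps)
  then have cd1: "c1 \<in> carrier RK1.A.P" "d1 \<in> carrier RK1.A.P"
    unfolding c1_def d1_def by (simp_all only: up.h.hom_closed)
  have up_shift: "pair_map id \<iota> (pair_map (shift R) (shift K) b) =
      pair_map (shift R) (shift K1) (pair_map id \<iota> b)"
    if "Poly_Mapping.keys b \<subseteq> carrier R \<times> L" for b
    by (rule pair_map_comp_eq[OF that]) (simp add: K1_def)
  have down_up: "pair_map id j (pair_map id \<iota> b) = b"
    if "Poly_Mapping.keys b \<subseteq> carrier R \<times> L" for b
    using that
  proof (induction b rule: frag_induction)
    case (one z) then show ?case by (cases z) auto
  qed auto
  have "pair_map (shift R) (shift K1) c1 - pair_map (shift R) (shift K1) d1 \<in> RK1.A.I"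
    using up.map_ideal[OF e] by (simp add: e_def up_shift cd_L c1_def d1_def)
  then have "shift (tensor k R K1) (a_r_coset RK1.A.P RK1.A.I c1) =
      shift (tensor k R K1) (a_r_coset RK1.A.P RK1.A.I d1)"
    using cd1 by (simp add: RK1.map_coset RK1.A.coset_eq_iff)
  moreover have "inj_on (shift (tensor k R K1)) (carrier (tensor k R K1))"
    using sep K1 kK1 unfolding sigma_separable_def by blast
  ultimately have "a_r_coset RK1.A.P RK1.A.I c1 = a_r_coset RK1.A.P RK1.A.I d1"
    using cd1 ring_hom_memE(1)[OF RK1.A.coset_hom] by (simp add: inj_on_eq_iff)
  then have "c1 - d1 \<in> RK1.A.I"
    using cd1 by (simp add: RK1.A.coset_eq_iff)
  from down.map_ideal[OF this] have "c - d \<in> RK.A.I"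
    by (simp add: c1_def d1_def down_up cd_L)
  then show "x = y"
    using c d by (simp add: RK.A.coset_eq_iff)
qed

end

theory Submission
  imports Defs
begin

text \<open>Being etale over a field \<open>k\<close> means having a separability idempotent, an element \<open>u\<close> of
  \<open>A \<otimes> A\<close> with \<open>(x \<otimes> 1) u = (1 \<otimes> x) u\<close> for all \<open>x\<close> and product \<open>1\<close>; and an etale difference
  algebra is \<open>\<sigma>\<close>-separable if and only if it is spanned over \<open>k\<close> by the image of \<open>\<sigma>\<close>. Both conditions
  are inherited by every algebra generated by the images of two such algebras, which makes the
  strong core a subalgebra and gives one inclusion.

  For the other one let \<open>C\<close> be a strongly \<open>\<sigma>\<close>-etale subalgebra of \<open>R \<otimes> S\<close>, and let \<open>V\<close> be the smallest
  subspace of \<open>R\<close> with \<open>C \<subseteq> V \<otimes> S\<close>, which consists of the slices \<open>(id \<otimes> \<xi>)(c)\<close> for linear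
  forms \<open>\<xi>\<close> on \<open>S\<close>. Since \<open>\<sigma>(C)\<close> spans \<open>C\<close>, the span of \<open>\<sigma>(V)\<close> contains \<open>V\<close>, and a comparison of
  dimensions shows that it is \<open>V\<close>. The subalgebra of \<open>R\<close> generated by \<open>V\<close> is unramified because \<open>C\<close>
  is, hence it has a separability idempotent by Nakayama's lemma; no base change to the
  algebraic closure is needed. So \<open>V\<close> lies in the strong core of \<open>R\<close>.\<close>


section \<open>Linear spans and linear forms\<close>

text \<open>Spans of shifts control \<sigma>-separability in finite dimension because the shift is
  semilinear. If the shifts of a basis again form a basis, then on R \<otimes> K the shift acts on
  coordinates through the shift of the field K, which is injective. Conversely, a linear dependence
  among the shifts of a basis becomes a failure of injectivity as soon as its coefficients acquire
  preimages under the shift.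

  The obstacle in the second inclusion is that elements of C are not pure tensors and have no
  components in R; slices replace the components. That the slices inherit unramifiedness is seen in
  R \<otimes> R \<otimes> S: the two copies of C agree modulo J \<otimes> S, where J is generated by
  the differences of the two copies of the slices, and the separability idempotent of C forces the
  difference of the copies of C into J^2 \<otimes> S. Slicing along S brings this back to J = J^2.

  All this only places C in pi(R) \<otimes> S, with pi the strong core. Exchanging the factors
  places it in R \<otimes> pi(S), and slices also show that an element of both subsets lies in pi(R)
  \<otimes> pi(S).\<close>

inductive_set lspan :: "('k, 'l) ring_scheme \<Rightarrow> ('k \<Rightarrow> 'a) \<Rightarrow> ('a, 'm) ring_scheme \<Rightarrow> 'a set \<Rightarrow> 'a set"
  for k \<phi> R B where
  zero: "\<zero>\<^bsub>R\<^esub> \<in> lspan k \<phi> R B"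
| step: "a \<in> carrier k \<Longrightarrow> x \<in> B \<Longrightarrow> y \<in> lspan k \<phi> R B \<Longrightarrow> \<phi> a \<otimes>\<^bsub>R\<^esub> x \<oplus>\<^bsub>R\<^esub> y \<in> lspan k \<phi> R B"

definition linear_forms :: "('k, 'l) ring_scheme \<Rightarrow> ('k \<Rightarrow> 'a) \<Rightarrow> ('a, 'm) ring_scheme \<Rightarrow> ('a \<Rightarrow> 'k) set"
  where "linear_forms k \<phi> R = {\<xi>. (\<forall>r\<in>carrier R. \<xi> r \<in> carrier k) \<and>
    (\<forall>r\<in>carrier R. \<forall>s\<in>carrier R. \<xi> (r \<oplus>\<^bsub>R\<^esub> s) = \<xi> r \<oplus>\<^bsub>k\<^esub> \<xi> s) \<and>
    (\<forall>a\<in>carrier k. \<forall>r\<in>carrier R. \<xi> (\<phi> a \<otimes>\<^bsub>R\<^esub> r) = a \<otimes>\<^bsub>k\<^esub> \<xi> r)}"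

lemma linear_formsD:
  assumes "\<xi> \<in> linear_forms k \<phi> R"
  shows "r \<in> carrier R \<Longrightarrow> \<xi> r \<in> carrier k"
    "r \<in> carrier R \<Longrightarrow> s \<in> carrier R \<Longrightarrow> \<xi> (r \<oplus>\<^bsub>R\<^esub> s) = \<xi> r \<oplus>\<^bsub>k\<^esub> \<xi> s"
    "a \<in> carrier k \<Longrightarrow> r \<in> carrier R \<Longrightarrow> \<xi> (\<phi> a \<otimes>\<^bsub>R\<^esub> r) = a \<otimes>\<^bsub>k\<^esub> \<xi> r"
  using assms by (auto simp: linear_forms_def)

locale field_algebra = k: field k + R: cring R
  for k :: "('k, 'l) ring_scheme" and \<phi> :: "'k \<Rightarrow> 'a" and R :: "('a, 'm) ring_scheme" (structure) +
  assumes hom: "\<phi> \<in> ring_hom k R"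
begin

abbreviation "sp \<equiv> lspan k \<phi> R"

lemmas hom_simps = ring_hom_memE[OF hom]
lemmas phi_closed [simp, intro] = hom_simps(1)

lemma phi_zero [simp]: "\<phi> \<zero>\<^bsub>k\<^esub> = \<zero>"
  using ring_hom_zero[OF hom k.ring_axioms R.ring_axioms] .

lemma phi_minus: "a \<in> carrier k \<Longrightarrow> \<phi> (\<ominus>\<^bsub>k\<^esub> a) = \<ominus> \<phi> a"
proof -
  interpret h: ring_hom_ring k R \<phi>
    by (rule ring_hom_ringI2[OF k.ring_axioms R.ring_axioms hom])
  show "a \<in> carrier k \<Longrightarrow> \<phi> (\<ominus>\<^bsub>k\<^esub> a) = \<ominus> \<phi> a" by simp
qed

lemma sp_closed: "y \<in> sp B \<Longrightarrow> B \<subseteq> carrier R \<Longrightarrow> y \<in> carrier R"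
  by (induction rule: lspan.induct) auto

lemma sp_subset: "B \<subseteq> carrier R \<Longrightarrow> sp B \<subseteq> carrier R"
  using sp_closed by blast

lemma sp_base: "x \<in> B \<Longrightarrow> B \<subseteq> carrier R \<Longrightarrow> x \<in> sp B"
proof -
  assume x: "x \<in> B" "B \<subseteq> carrier R"
  then have "\<phi> \<one>\<^bsub>k\<^esub> \<otimes> x \<oplus> \<zero> \<in> sp B"
    by (intro lspan.step lspan.zero) auto
  then show ?thesis using x by (auto simp: hom_simps subset_iff)
qed

lemma sp_add: "y \<in> sp B \<Longrightarrow> z \<in> sp B \<Longrightarrow> B \<subseteq> carrier R \<Longrightarrow> y \<oplus> z \<in> sp B"
proof (induction rule: lspan.induct)
  case (step a x y)
  then have "\<phi> a \<otimes> x \<oplus> y \<oplus> z = \<phi> a \<otimes> x \<oplus> (y \<oplus> z)"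
    using sp_closed by (intro R.a_assoc) auto
  with step show ?case by (simp add: lspan.step)
qed (auto simp: sp_closed)

lemma sp_smult: "y \<in> sp B \<Longrightarrow> a \<in> carrier k \<Longrightarrow> B \<subseteq> carrier R \<Longrightarrow> \<phi> a \<otimes> y \<in> sp B"
proof (induction rule: lspan.induct)
  case (step b x y)
  then have "x \<in> carrier R" "y \<in> carrier R" using sp_closed by auto
  then have "\<phi> a \<otimes> (\<phi> b \<otimes> x \<oplus> y) = \<phi> (a \<otimes>\<^bsub>k\<^esub> b) \<otimes> x \<oplus> \<phi> a \<otimes> y"
    using step by (simp add: R.r_distr hom_simps(2) R.m_assoc)
  with step show ?case by (simp add: lspan.step)
qed (auto intro: lspan.zero)

lemma sp_minus: "y \<in> sp B \<Longrightarrow> B \<subseteq> carrier R \<Longrightarrow> \<ominus> y \<in> sp B"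
  using sp_smult[of y B "\<ominus>\<^bsub>k\<^esub> \<one>\<^bsub>k\<^esub>"] by (simp add: phi_minus hom_simps sp_closed R.l_minus)

lemma sp_least:
  assumes "Y \<subseteq> carrier R" "\<zero> \<in> Y" "\<And>x y. x \<in> Y \<Longrightarrow> y \<in> Y \<Longrightarrow> x \<oplus> y \<in> Y"
    "\<And>a y. a \<in> carrier k \<Longrightarrow> y \<in> Y \<Longrightarrow> \<phi> a \<otimes> y \<in> Y" "B \<subseteq> Y"
  shows "sp B \<subseteq> Y"
proof
  fix y assume "y \<in> sp B"
  then show "y \<in> Y" by (induction rule: lspan.induct) (use assms in auto)
qed

lemma sp_idem: "B \<subseteq> sp Y \<Longrightarrow> Y \<subseteq> carrier R \<Longrightarrow> sp B \<subseteq> sp Y"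
  by (rule sp_least) (auto simp: sp_add sp_smult intro: lspan.zero sp_closed)

lemma sp_mono: "B \<subseteq> Y \<Longrightarrow> Y \<subseteq> carrier R \<Longrightarrow> sp B \<subseteq> sp Y"
  by (rule sp_idem) (auto intro: sp_base)

lemma sp_insert:
  assumes "y \<in> sp (insert x B)" "x \<in> carrier R" "B \<subseteq> carrier R"
  obtains a z where "a \<in> carrier k" "z \<in> sp B" "y = \<phi> a \<otimes> x \<oplus> z"
proof -
  have "\<exists>a\<in>carrier k. \<exists>z\<in>sp B. y = \<phi> a \<otimes> x \<oplus> z"
    using assms(1)
  proof (induction rule: lspan.induct)
    case zero
    show ?case using assms
      by (intro bexI[of _ "\<zero>\<^bsub>k\<^esub>"] bexI[of _ \<zero>]) (auto intro: lspan.zero)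
  next
    case (step b w y)
    then obtain a z where az: "a \<in> carrier k" "z \<in> sp B" "y = \<phi> a \<otimes> x \<oplus> z" by blast
    have z: "z \<in> carrier R" using az assms sp_closed by blast
    show ?case
    proof (cases "w = x")
      case True
      have "\<phi> b \<otimes> w \<oplus> y = \<phi> (b \<oplus>\<^bsub>k\<^esub> a) \<otimes> x \<oplus> z"
        using True az z step assms by (simp add: hom_simps R.l_distr R.a_assoc)
      with az step show ?thesis by blast
    next
      case False
      then have w: "w \<in> B" using step by simp
      then have "\<phi> b \<otimes> w \<oplus> y = \<phi> a \<otimes> x \<oplus> (\<phi> b \<otimes> w \<oplus> z)"
        using az z step assms by (simp add: subset_iff R.a_lcomm)
      with az step w show ?thesis by (blast intro: lspan.step)
    qed
  qed
  then show ?thesis using that by blast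
qed

text \<open>The coefficient of \<open>x\<close> in \<open>y\<close> is nonzero, as otherwise
  \<open>y\<close> would lie in \<open>sp B\<close>; dividing by it solves for
  \<open>x\<close>.\<close>

lemma sp_exchange:
  assumes "y \<in> sp (insert x B)" "y \<notin> sp B" "x \<in> carrier R" "B \<subseteq> carrier R"
  shows "x \<in> sp (insert y B)"
proof -
  obtain a z where az: "a \<in> carrier k" "z \<in> sp B" "y = \<phi> a \<otimes> x \<oplus> z"
    using sp_insert[OF assms(1,3,4)] .
  have z: "z \<in> carrier R" using az assms sp_closed by blast
  then have y: "y \<in> carrier R" using az assms by auto
  have "a \<noteq> \<zero>\<^bsub>k\<^esub>" using az z assms by auto
  then have a: "inv\<^bsub>k\<^esub> a \<in> carrier k" "inv\<^bsub>k\<^esub> a \<otimes>\<^bsub>k\<^esub> a = \<one>\<^bsub>k\<^esub>"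
    using az(1) k.field_Units by auto
  have "\<phi> (inv\<^bsub>k\<^esub> a) \<otimes> (y \<oplus> \<ominus> z) = \<phi> (inv\<^bsub>k\<^esub> a) \<otimes> (\<phi> a \<otimes> x)"
    using az z assms by (simp add: R.a_assoc R.r_neg)
  also have "\<dots> = x"
    using a az assms by (simp add: R.m_assoc[symmetric] hom_simps(2)[symmetric] hom_simps(4))
  finally have "x = \<phi> (inv\<^bsub>k\<^esub> a) \<otimes> (y \<oplus> \<ominus> z)" ..
  moreover have "z \<in> sp (insert y B)"
    using az sp_mono[of B "insert y B"] y assms by auto
  ultimately show ?thesis
    using a y assms sp_base[of y "insert y B"] by (auto intro!: sp_smult sp_add sp_minus)
qed

section \<open>Independence, exchange and bases\<close>

definition indep :: "'a set \<Rightarrow> bool"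
  where "indep B \<longleftrightarrow> B \<subseteq> carrier R \<and> (\<forall>x\<in>B. x \<notin> sp (B - {x}))"

lemma indep_insert:
  assumes B: "indep B" and y: "y \<in> carrier R" "y \<notin> sp B"
  shows "indep (insert y B)"
proof -
  have BR: "B \<subseteq> carrier R" using B by (simp add: indep_def)
  have "x \<notin> sp (insert y B - {x})" if x: "x \<in> B" for x
  proof
    assume *: "x \<in> sp (insert y B - {x})"
    have "x \<noteq> y" using sp_base x y BR by blast
    then have "x \<in> sp (insert y (B - {x}))" using * by (simp add: insert_Diff_if)
    then have "y \<in> sp (insert x (B - {x}))"
      using sp_exchange[of x y "B - {x}"] B x y BR by (auto simp: indep_def)
    then show False using x y by (simp add: insert_absorb)
  qed
  moreover have "y \<notin> sp (insert y B - {y})"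
    using y sp_mono[of "insert y B - {y}" B] BR by blast
  ultimately show ?thesis using BR y by (auto simp: indep_def)
qed

lemma indep_mono: "indep B \<Longrightarrow> Y \<subseteq> B \<Longrightarrow> indep Y"
proof -
  assume B: "indep B" and Y: "Y \<subseteq> B"
  then have BR: "B \<subseteq> carrier R" by (simp add: indep_def)
  have "x \<notin> sp (Y - {x})" if "x \<in> Y" for x
    using sp_mono[of "Y - {x}" "B - {x}"] that B Y BR by (auto simp: indep_def)
  then show ?thesis using Y BR by (auto simp: indep_def)
qed

text \<open>Members of \<open>F\<close> outside \<open>G\<close> are exchanged one at a time. For
  such an \<open>f\<close> some \<open>g\<close> in \<open>G\<close> avoids the span of
  \<open>F - {f}\<close>, since otherwise \<open>f\<close>, lying in \<open>sp G\<close>, would lie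
  in that span. Putting \<open>g\<close> in place of \<open>f\<close> keeps \<open>F\<close>
  independent and of the same size and lowers \<open>card (F - G)\<close>.\<close>

lemma steinitz:
  assumes "finite F" "finite G" "indep F" "F \<subseteq> sp G" "G \<subseteq> carrier R"
  shows "card F \<le> card G"
  using assms
proof (induction "card (F - G)" arbitrary: F)
  case 0
  then show ?case by (simp add: card_mono)
next
  case (Suc n)
  then obtain f where f: "f \<in> F" "f \<notin> G"
    by (metis Diff_eq_empty_iff card.empty nat.distinct(1) subsetI)
  have FR: "F \<subseteq> carrier R" and nf: "f \<notin> sp (F - {f})"
    using Suc.prems f by (auto simp: indep_def)
  have "\<not> G \<subseteq> sp (F - {f})"
    using sp_idem[of G "F - {f}"] Suc.prems f FR nf by blast
  then obtain g where g: "g \<in> G" "g \<notin> sp (F - {f})" by blast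
  then have gF: "g \<notin> F - {f}" using sp_base[of g "F - {f}"] FR by blast
  let ?F = "insert g (F - {f})"
  have "indep ?F"
    by (rule indep_insert) (use indep_mono[of F] Suc.prems g in auto)
  moreover have "?F - G = (F - G) - {f}" using g by auto
  then have "card (?F - G) = n" using Suc.hyps(2) f Suc.prems by simp
  moreover have "?F \<subseteq> sp G" using Suc.prems g sp_base by blast
  ultimately have "card ?F \<le> card G" using Suc by blast
  moreover have "card ?F = card F"
    using card_insert_disjoint[OF _ gF] card_Suc_Diff1[OF Suc.prems(1) f(1)] Suc.prems(1) by simp
  ultimately show ?case by simp
qed

lemma basis_exists:
  assumes "finite F" "F \<subseteq> carrier R"
  obtains G where "G \<subseteq> F" "indep G" "sp G = sp F"
proof -
  have "\<exists>G\<subseteq>F. indep G \<and> sp G = sp F"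
    using assms
  proof (induction F)
    case empty
    then show ?case by (auto simp: indep_def)
  next
    case (insert x F)
    then obtain G where G: "G \<subseteq> F" "indep G" "sp G = sp F" by auto
    have GR: "G \<subseteq> carrier R" using G by (simp add: indep_def)
    show ?case
    proof (cases "x \<in> sp G")
      case True
      then have "insert x F \<subseteq> sp G" using G insert sp_base[of _ F] by auto
      then have "sp (insert x F) = sp G"
        using sp_idem[OF _ GR] sp_mono[of G "insert x F"] G insert.prems by blast
      then show ?thesis using G by blast
    next
      case False
      then have "indep (insert x G)" using indep_insert G insert.prems by simp
      moreover have "insert x F \<subseteq> sp (insert x G)"
        using sp_base[of _ "insert x G"] sp_base[of _ F] sp_mono[of G "insert x G"] G GR insert.prems by blast
      then have "sp (insert x F) = sp (insert x G)"
        using sp_idem[of "insert x F" "insert x G"] sp_mono[of "insert x G" "insert x F"] G GR insert.prems by blast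
      ultimately show ?thesis using G by blast
    qed
  qed
  then show ?thesis using that by blast
qed

text \<open>An element of a span involves finitely many generators, and in a chain these lie in a
  single member. This is the chain condition for Zorn's lemma below.\<close>

lemma sp_chain_Union:
  assumes "y \<in> sp (\<Union>\<C>)" "subset.chain \<A> \<C>" "\<C> \<noteq> {}" "\<Union>\<C> \<subseteq> carrier R"
  shows "\<exists>Z\<in>\<C>. y \<in> sp Z"
  using assms(1)
proof (induction rule: lspan.induct)
  case zero
  then show ?case using assms(3) lspan.zero by blast
next
  case (step a x y)
  then obtain Z W where ZW: "Z \<in> \<C>" "y \<in> sp Z" "W \<in> \<C>" "x \<in> W" by blast
  then consider "W \<subseteq> Z" | "Z \<subseteq> W" using assms(2) unfolding subset_chain_def by blast
  then show ?case
  proof cases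
    case 1
    then have "\<phi> a \<otimes> x \<oplus> y \<in> sp Z" using ZW step.hyps(1) by (intro lspan.step) auto
    then show ?thesis using ZW(1) ..
  next
    case 2
    have "W \<subseteq> carrier R" using ZW(3) assms(4) by (auto simp: Sup_le_iff)
    then have "y \<in> sp W" using ZW(2) sp_mono[OF 2] by auto
    then have "\<phi> a \<otimes> x \<oplus> y \<in> sp W" using ZW step.hyps(1) by (intro lspan.step) auto
    then show ?thesis using ZW(3) ..
  qed
qed

text \<open>\<open>R\<close> may have infinite dimension, so a complement of the line through
  \<open>y\<close> comes from Zorn's lemma: if \<open>Z\<close> is maximal among the supersets of
  \<open>B\<close> whose span avoids \<open>y\<close>, then \<open>sp Z\<close> is such a
  complement, and the form reads off the coefficient of \<open>y\<close>.\<close>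

lemma linear_form_exists:
  assumes B: "B \<subseteq> carrier R" and y: "y \<in> carrier R" "y \<notin> sp B"
  obtains \<xi> where "\<xi> \<in> linear_forms k \<phi> R" "\<xi> y = \<one>\<^bsub>k\<^esub>" "\<And>x. x \<in> B \<Longrightarrow> \<xi> x = \<zero>\<^bsub>k\<^esub>"
proof -
  define \<A> where "\<A> = {Z. B \<subseteq> Z \<and> Z \<subseteq> carrier R \<and> y \<notin> sp Z}"
  have "\<A> \<noteq> {}" using B y by (auto simp: \<A>_def)
  moreover have "\<Union>\<C> \<in> \<A>" if "\<C> \<noteq> {}" "subset.chain \<A> \<C>" for \<C>
  proof -
    have "\<C> \<subseteq> \<A>" using that by (simp add: subset_chain_def)
    then have C: "Z \<subseteq> carrier R \<and> B \<subseteq> Z \<and> y \<notin> sp Z" if "Z \<in> \<C>" for Z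
      using that by (auto simp: \<A>_def)
    then have "\<Union>\<C> \<subseteq> carrier R" "B \<subseteq> \<Union>\<C>" using that(1) by blast+
    moreover have "y \<notin> sp (\<Union>\<C>)"
      using sp_chain_Union[OF _ that(2,1), of y] C \<open>\<Union>\<C> \<subseteq> carrier R\<close> by blast
    ultimately show ?thesis by (simp add: \<A>_def)
  qed
  ultimately obtain Z where Z: "Z \<in> \<A>" and max: "\<And>W. W \<in> \<A> \<Longrightarrow> Z \<subseteq> W \<Longrightarrow> W = Z"
    using subset_Zorn_nonempty[of \<A>] by blast
  have ZR: "Z \<subseteq> carrier R" and BZ: "B \<subseteq> Z" and yZ: "y \<notin> sp Z" using Z by (auto simp: \<A>_def)
  \<comment> \<open>Existence of the coefficient: for \<open>r\<close> outside \<open>Z\<close>,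
    maximality puts \<open>y\<close> into the span of \<open>insert r Z\<close>, and exchange then
    puts \<open>r\<close> into the span of \<open>insert y Z\<close>.\<close>
  have ex: "\<exists>a\<in>carrier k. r \<oplus> \<ominus> (\<phi> a \<otimes> y) \<in> sp Z" if r: "r \<in> carrier R" for r
  proof -
    have "r \<in> sp (insert y Z)"
    proof (cases "r \<in> Z")
      case True then show ?thesis using sp_base[of r "insert y Z"] ZR y by auto
    next
      case False
      then have "insert r Z \<notin> \<A>" using max[of "insert r Z"] by auto
      then have "y \<in> sp (insert r Z)" using r ZR BZ by (auto simp: \<A>_def)
      then show ?thesis using sp_exchange yZ r ZR by blast
    qed
    then obtain a z where az: "a \<in> carrier k" "z \<in> sp Z" "r = \<phi> a \<otimes> y \<oplus> z"
      using sp_insert y ZR by metis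
    have z: "z \<in> carrier R" using az ZR sp_closed by blast
    have "r \<oplus> \<ominus> (\<phi> a \<otimes> y) = z"
      using az z y by (simp add: R.a_ac R.r_neg1 R.r_neg)
    then show ?thesis using az(1,2) by (intro bexI[of _ a]) simp_all
  qed
  \<comment> \<open>Two coefficients of \<open>r\<close> differ by some \<open>c\<close> with
    \<open>\<phi> c \<otimes> y\<close> in \<open>sp Z\<close>; if \<open>c\<close> were nonzero,
    division by it would put \<open>y\<close> there.\<close>
  have uniq: "a = b" if a: "a \<in> carrier k" "b \<in> carrier k" and r: "r \<in> carrier R"
    and 1: "r \<oplus> \<ominus> (\<phi> a \<otimes> y) \<in> sp Z" and 2: "r \<oplus> \<ominus> (\<phi> b \<otimes> y) \<in> sp Z" for a b r
  proof (rule ccontr)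
    assume ne: "a \<noteq> b"
    define c where "c = b \<oplus>\<^bsub>k\<^esub> \<ominus>\<^bsub>k\<^esub> a"
    have "c \<noteq> \<zero>\<^bsub>k\<^esub>" using ne a k.r_right_minus_eq[of b a] by (auto simp: c_def a_minus_def)
    then have c: "c \<in> carrier k" "inv\<^bsub>k\<^esub> c \<in> carrier k" "inv\<^bsub>k\<^esub> c \<otimes>\<^bsub>k\<^esub> c = \<one>\<^bsub>k\<^esub>"
      using a k.field_Units by (auto simp: c_def)
    have "\<phi> c \<otimes> y = (r \<oplus> \<ominus> (\<phi> a \<otimes> y)) \<oplus> \<ominus> (r \<oplus> \<ominus> (\<phi> b \<otimes> y))"
      using a r y by (simp add: c_def hom_simps phi_minus R.l_distr R.l_minus R.minus_add R.a_ac R.r_neg1 R.r_neg2)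
    then have "\<phi> c \<otimes> y \<in> sp Z"
      using sp_add[OF 1 sp_minus[OF 2]] ZR by simp
    then have "\<phi> (inv\<^bsub>k\<^esub> c) \<otimes> (\<phi> c \<otimes> y) \<in> sp Z" using sp_smult ZR c by blast
    moreover have "\<phi> (inv\<^bsub>k\<^esub> c) \<otimes> (\<phi> c \<otimes> y) = y"
      using c y by (simp add: R.m_assoc[symmetric] hom_simps(2)[symmetric] hom_simps(4))
    ultimately show False using yZ by simp
  qed
  define \<xi> where "\<xi> r = (THE a. a \<in> carrier k \<and> r \<oplus> \<ominus> (\<phi> a \<otimes> y) \<in> sp Z)" for r
  have lam: "\<xi> r \<in> carrier k \<and> r \<oplus> \<ominus> (\<phi> (\<xi> r) \<otimes> y) \<in> sp Z" if "r \<in> carrier R" for r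
    unfolding \<xi>_def by (rule theI') (use ex uniq that in blast)
  have lamI: "\<xi> r = a" if "r \<in> carrier R" "a \<in> carrier k" "r \<oplus> \<ominus> (\<phi> a \<otimes> y) \<in> sp Z" for r a
    using uniq lam that by blast
  have "\<xi> \<in> linear_forms k \<phi> R"
    unfolding linear_forms_def
  proof (intro CollectI conjI ballI)
    fix r s assume rs: "r \<in> carrier R" "s \<in> carrier R"
    note l = lam[OF rs(1)] lam[OF rs(2)]
    have "r \<oplus> s \<oplus> \<ominus> (\<phi> (\<xi> r \<oplus>\<^bsub>k\<^esub> \<xi> s) \<otimes> y) = (r \<oplus> \<ominus> (\<phi> (\<xi> r) \<otimes> y)) \<oplus> (s \<oplus> \<ominus> (\<phi> (\<xi> s) \<otimes> y))"
      using rs l y by (simp add: hom_simps R.l_distr R.minus_add R.a_ac)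
    then show "\<xi> (r \<oplus> s) = \<xi> r \<oplus>\<^bsub>k\<^esub> \<xi> s"
      using rs l ZR by (intro lamI) (auto intro: sp_add)
  next
    fix a r assume a: "a \<in> carrier k" and r: "r \<in> carrier R"
    note l = lam[OF r]
    have "\<phi> a \<otimes> r \<oplus> \<ominus> (\<phi> (a \<otimes>\<^bsub>k\<^esub> \<xi> r) \<otimes> y) = \<phi> a \<otimes> (r \<oplus> \<ominus> (\<phi> (\<xi> r) \<otimes> y))"
      using a r l y by (simp add: hom_simps R.r_distr R.r_minus R.m_assoc)
    then show "\<xi> (\<phi> a \<otimes> r) = a \<otimes>\<^bsub>k\<^esub> \<xi> r"
      using a r l ZR by (intro lamI) (auto intro: sp_smult)
  qed (use lam in auto)
  moreover have "\<xi> y = \<one>\<^bsub>k\<^esub>"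
    using y by (intro lamI) (auto simp: hom_simps R.r_neg intro: lspan.zero)
  moreover have "\<xi> x = \<zero>\<^bsub>k\<^esub>" if "x \<in> B" for x
  proof (rule lamI)
    show "x \<in> carrier R" using that B by blast
    then show "x \<oplus> \<ominus> (\<phi> \<zero>\<^bsub>k\<^esub> \<otimes> y) \<in> sp Z"
      using that BZ ZR y sp_base[of x Z] by auto
  qed simp
  ultimately show ?thesis using that by blast
qed

end


section \<open>Calculus of tensor products\<close>

text \<open>For subspaces \<open>A\<close> and \<open>B\<close> this is the image of A \<otimes> B
  in R \<otimes> S. Keeping all such images inside one ambient ring makes it possible to compare and
  intersect them.\<close>

inductive_set tspan :: "('k, 'l) ring_scheme \<Rightarrow> ('k \<Rightarrow> 'a) \<Rightarrow> ('a, 'm) ring_scheme \<Rightarrow> ('k \<Rightarrow> 'b) \<Rightarrow>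
    ('b, 'n) ring_scheme \<Rightarrow> 'a set \<Rightarrow> 'b set \<Rightarrow> ('a \<times> 'b \<Rightarrow>\<^sub>0 int) set set"
  for k \<phi> R \<psi> S A B where
  zero: "\<zero>\<^bsub>tensor_ring k \<phi> R \<psi> S\<^esub> \<in> tspan k \<phi> R \<psi> S A B"
| step: "r \<in> A \<Longrightarrow> s \<in> B \<Longrightarrow> x \<in> tspan k \<phi> R \<psi> S A B \<Longrightarrow>
    pure_tensor k \<phi> R \<psi> S r s \<oplus>\<^bsub>tensor_ring k \<phi> R \<psi> S\<^esub> x \<in> tspan k \<phi> R \<psi> S A B"

definition balanced :: "('k, 'l) ring_scheme \<Rightarrow> ('k \<Rightarrow> 'a) \<Rightarrow> ('a, 'm) ring_scheme \<Rightarrow> ('k \<Rightarrow> 'b) \<Rightarrow>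
    ('b, 'n) ring_scheme \<Rightarrow> ('c, 'p) ring_scheme \<Rightarrow> ('a \<Rightarrow> 'b \<Rightarrow> 'c) \<Rightarrow> bool"
  where "balanced k \<phi> R \<psi> S M f \<longleftrightarrow>
    (\<forall>r\<in>carrier R. \<forall>s\<in>carrier S. f r s \<in> carrier M) \<and>
    (\<forall>r\<in>carrier R. \<forall>r'\<in>carrier R. \<forall>s\<in>carrier S. f (r \<oplus>\<^bsub>R\<^esub> r') s = f r s \<oplus>\<^bsub>M\<^esub> f r' s) \<and>
    (\<forall>r\<in>carrier R. \<forall>s\<in>carrier S. \<forall>s'\<in>carrier S. f r (s \<oplus>\<^bsub>S\<^esub> s') = f r s \<oplus>\<^bsub>M\<^esub> f r s') \<and>
    (\<forall>a\<in>carrier k. \<forall>r\<in>carrier R. \<forall>s\<in>carrier S. f (\<phi> a \<otimes>\<^bsub>R\<^esub> r) s = f r (\<psi> a \<otimes>\<^bsub>S\<^esub> s))"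

text \<open>The additive map induced by a balanced map \<open>f\<close>. Values on pure tensors and
  additivity fix it on the carrier. Only an abelian group is expected as target, so that slices,
  which are not multiplicative, are covered as well as ring homomorphisms.\<close>

definition tlift :: "('k, 'l) ring_scheme \<Rightarrow> ('k \<Rightarrow> 'a) \<Rightarrow> ('a, 'm) ring_scheme \<Rightarrow> ('k \<Rightarrow> 'b) \<Rightarrow>
    ('b, 'n) ring_scheme \<Rightarrow> ('c, 'p) ring_scheme \<Rightarrow> ('a \<Rightarrow> 'b \<Rightarrow> 'c) \<Rightarrow> ('a \<times> 'b \<Rightarrow>\<^sub>0 int) set \<Rightarrow> 'c"
  where "tlift k \<phi> R \<psi> S M f = (SOME F.
    (\<forall>x\<in>carrier (tensor_ring k \<phi> R \<psi> S). F x \<in> carrier M) \<and>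
    (\<forall>x\<in>carrier (tensor_ring k \<phi> R \<psi> S). \<forall>y\<in>carrier (tensor_ring k \<phi> R \<psi> S).
       F (x \<oplus>\<^bsub>tensor_ring k \<phi> R \<psi> S\<^esub> y) = F x \<oplus>\<^bsub>M\<^esub> F y) \<and>
    (\<forall>r\<in>carrier R. \<forall>s\<in>carrier S. F (pure_tensor k \<phi> R \<psi> S r s) = f r s))"

locale algebra_tensor = R: field_algebra k \<phi> R + S: field_algebra k \<psi> S
  for k :: "('k, 'l) ring_scheme" and \<phi> :: "'k \<Rightarrow> 'a" and R :: "('a, 'm) ring_scheme"
    and \<psi> :: "'k \<Rightarrow> 'b" and S :: "('b, 'n) ring_scheme"
begin

sublocale ts: tensor_setup k \<phi> R \<psi> S
  by unfold_locales auto

abbreviation "P \<equiv> pair_ring R S"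
abbreviation "I \<equiv> tensor_ideal k \<phi> R \<psi> S"
abbreviation "T \<equiv> tensor_ring k \<phi> R \<psi> S"
abbreviation "pt \<equiv> pure_tensor k \<phi> R \<psi> S"

lemma frag_of_closed: "r \<in> carrier R \<Longrightarrow> s \<in> carrier S \<Longrightarrow> frag_of (r, s) \<in> carrier P"
  by (simp add: pair_ring_simps)

lemma P_add: "c \<in> carrier P \<Longrightarrow> d \<in> carrier P \<Longrightarrow> c + d \<in> carrier P"
  using ts.P.a_closed[of c d] by (simp add: pair_ring_simps(4))

lemma P_diff: "c \<in> carrier P \<Longrightarrow> d \<in> carrier P \<Longrightarrow> c - d \<in> carrier P"
  using ts.P.minus_closed[of c d] by (simp add: ts.minus_P)

lemma coset_add: "c \<in> carrier P \<Longrightarrow> d \<in> carrier P \<Longrightarrow>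
    a_r_coset P I (c + d) = a_r_coset P I c \<oplus>\<^bsub>T\<^esub> a_r_coset P I d"
  using ring_hom_memE(3)[OF ts.coset_hom, of c d] by (simp add: pair_ring_simps(4))

lemma coset_closed: "c \<in> carrier P \<Longrightarrow> a_r_coset P I c \<in> carrier T"
  by (rule ring_hom_memE(1)[OF ts.coset_hom])

lemma coset_diff: "c \<in> carrier P \<Longrightarrow> d \<in> carrier P \<Longrightarrow>
    a_r_coset P I (c - d) = a_r_coset P I c \<ominus>\<^bsub>T\<^esub> a_r_coset P I d"
proof -
  interpret h: ring_hom_ring P T "a_r_coset P I"
    by (rule ring_hom_ringI2[OF ts.P.ring_axioms ts.T.ring_axioms ts.coset_hom])
  assume "c \<in> carrier P" "d \<in> carrier P"
  then show ?thesis by (simp add: ts.minus_P[symmetric] a_minus_def)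
qed

lemma coset_0: "a_r_coset P I 0 = \<zero>\<^bsub>T\<^esub>"
  using ring_hom_zero[OF ts.coset_hom ts.P.ring_axioms ts.T.ring_axioms] by (simp add: pair_ring_simps(3))

lemma pt_closed [simp, intro]: "r \<in> carrier R \<Longrightarrow> s \<in> carrier S \<Longrightarrow> pt r s \<in> carrier T"
  unfolding pure_tensor_def by (intro coset_closed frag_of_closed)

lemma pt_mult: "r \<in> carrier R \<Longrightarrow> s \<in> carrier S \<Longrightarrow> r' \<in> carrier R \<Longrightarrow> s' \<in> carrier S \<Longrightarrow>
    pt r s \<otimes>\<^bsub>T\<^esub> pt r' s' = pt (r \<otimes>\<^bsub>R\<^esub> r') (s \<otimes>\<^bsub>S\<^esub> s')"
  unfolding pure_tensor_def
  by (simp add: ring_hom_memE(2)[OF ts.coset_hom, symmetric] frag_of_closed pair_mult_of)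

lemma pt_one: "pt \<one>\<^bsub>R\<^esub> \<one>\<^bsub>S\<^esub> = \<one>\<^bsub>T\<^esub>"
  unfolding pure_tensor_def ring_hom_memE(4)[OF ts.coset_hom, symmetric] by (simp add: pair_ring_simps)

lemma pt_addl: "r \<in> carrier R \<Longrightarrow> r' \<in> carrier R \<Longrightarrow> s \<in> carrier S \<Longrightarrow>
    pt (r \<oplus>\<^bsub>R\<^esub> r') s = pt r s \<oplus>\<^bsub>T\<^esub> pt r' s"
  unfolding pure_tensor_def
  using ts.relations_ideal tensor_relationsI(1)[of r R r' s S k \<phi> \<psi>]
  by (subst coset_add[symmetric])
    (auto simp: frag_of_closed P_add ts.coset_eq_iff diff_diff_eq)

lemma pt_addr: "r \<in> carrier R \<Longrightarrow> s \<in> carrier S \<Longrightarrow> s' \<in> carrier S \<Longrightarrow>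
    pt r (s \<oplus>\<^bsub>S\<^esub> s') = pt r s \<oplus>\<^bsub>T\<^esub> pt r s'"
  unfolding pure_tensor_def
  using ts.relations_ideal tensor_relationsI(2)[of r R s S s' k \<phi> \<psi>]
  by (subst coset_add[symmetric])
    (auto simp: frag_of_closed P_add ts.coset_eq_iff diff_diff_eq)

lemma pt_balance: "a \<in> carrier k \<Longrightarrow> r \<in> carrier R \<Longrightarrow> s \<in> carrier S \<Longrightarrow>
    pt (\<phi> a \<otimes>\<^bsub>R\<^esub> r) s = pt r (\<psi> a \<otimes>\<^bsub>S\<^esub> s)"
  unfolding pure_tensor_def
  using ts.relations_ideal tensor_relationsI(3)[of a k r R s S \<phi> \<psi>]
  by (auto simp: frag_of_closed ts.coset_eq_iff)



lemma pt_zero_left: "s \<in> carrier S \<Longrightarrow> pt \<zero>\<^bsub>R\<^esub> s = \<zero>\<^bsub>T\<^esub>"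
  using pt_addl[of "\<zero>\<^bsub>R\<^esub>" "\<zero>\<^bsub>R\<^esub>" s] ts.T.add.l_cancel_one'[of "pt \<zero>\<^bsub>R\<^esub> s" "pt \<zero>\<^bsub>R\<^esub> s"] by simp

lemma pt_zero_right: "r \<in> carrier R \<Longrightarrow> pt r \<zero>\<^bsub>S\<^esub> = \<zero>\<^bsub>T\<^esub>"
  using pt_addr[of r "\<zero>\<^bsub>S\<^esub>" "\<zero>\<^bsub>S\<^esub>"] ts.T.add.l_cancel_one'[of "pt r \<zero>\<^bsub>S\<^esub>" "pt r \<zero>\<^bsub>S\<^esub>"] by simp

lemma pt_minus: "r \<in> carrier R \<Longrightarrow> s \<in> carrier S \<Longrightarrow> pt (\<ominus>\<^bsub>R\<^esub> r) s = \<ominus>\<^bsub>T\<^esub> pt r s"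
  using pt_addl[of "\<ominus>\<^bsub>R\<^esub> r" r s]
  by (intro ts.T.minus_equality[symmetric]) (auto simp: R.R.l_neg pt_zero_left)

lemma pt_minus_right: "r \<in> carrier R \<Longrightarrow> s \<in> carrier S \<Longrightarrow> pt r (\<ominus>\<^bsub>S\<^esub> s) = \<ominus>\<^bsub>T\<^esub> pt r s"
  using pt_addr[of r "\<ominus>\<^bsub>S\<^esub> s" s]
  by (intro ts.T.minus_equality[symmetric]) (auto simp: S.R.l_neg pt_zero_right)

abbreviation "tsp \<equiv> tspan k \<phi> R \<psi> S"

lemma tsp_closed: "x \<in> tsp A B \<Longrightarrow> A \<subseteq> carrier R \<Longrightarrow> B \<subseteq> carrier S \<Longrightarrow> x \<in> carrier T"
  by (induction rule: tspan.induct) (auto simp: subset_iff)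

lemma tsp_add: "x \<in> tsp A B \<Longrightarrow> y \<in> tsp A B \<Longrightarrow> A \<subseteq> carrier R \<Longrightarrow> B \<subseteq> carrier S \<Longrightarrow> x \<oplus>\<^bsub>T\<^esub> y \<in> tsp A B"
proof (induction rule: tspan.induct)
  case (step r s x)
  then have "pt r s \<oplus>\<^bsub>T\<^esub> x \<oplus>\<^bsub>T\<^esub> y = pt r s \<oplus>\<^bsub>T\<^esub> (x \<oplus>\<^bsub>T\<^esub> y)"
    using tsp_closed[of _ A B] by (intro ts.T.a_assoc) (auto simp: subset_iff)
  with step show ?case by (simp add: tspan.step)
qed (auto simp: tsp_closed)

lemma tsp_base: "r \<in> A \<Longrightarrow> s \<in> B \<Longrightarrow> A \<subseteq> carrier R \<Longrightarrow> B \<subseteq> carrier S \<Longrightarrow> pt r s \<in> tsp A B"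
proof -
  assume *: "r \<in> A" "s \<in> B" "A \<subseteq> carrier R" "B \<subseteq> carrier S"
  then have "pt r s \<oplus>\<^bsub>T\<^esub> \<zero>\<^bsub>T\<^esub> \<in> tsp A B" by (intro tspan.step tspan.zero)
  then show ?thesis using * by (auto simp: subset_iff)
qed

lemma tsp_minus: "x \<in> tsp A B \<Longrightarrow> A \<subseteq> carrier R \<Longrightarrow> B \<subseteq> carrier S \<Longrightarrow>
    (\<And>r. r \<in> A \<Longrightarrow> \<ominus>\<^bsub>R\<^esub> r \<in> A) \<Longrightarrow> \<ominus>\<^bsub>T\<^esub> x \<in> tsp A B"
proof (induction rule: tspan.induct)
  case (step r s x)
  then have "\<ominus>\<^bsub>T\<^esub> (pt r s \<oplus>\<^bsub>T\<^esub> x) = pt (\<ominus>\<^bsub>R\<^esub> r) s \<oplus>\<^bsub>T\<^esub> (\<ominus>\<^bsub>T\<^esub> x)"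
    using tsp_closed[of x A B] by (subst ts.T.minus_add) (auto simp: subset_iff pt_minus)
  with step show ?case by (simp add: tspan.step)
qed (auto simp: tspan.zero)

lemma tsp_mono: "A \<subseteq> A' \<Longrightarrow> B \<subseteq> B' \<Longrightarrow> tsp A B \<subseteq> tsp A' B'"
proof
  fix x assume *: "A \<subseteq> A'" "B \<subseteq> B'" "x \<in> tsp A B"
  show "x \<in> tsp A' B'" using *(3) by (induction rule: tspan.induct) (use * in \<open>auto intro: tspan.intros\<close>)
qed

lemma tsp_carrier: "tsp (carrier R) (carrier S) = carrier T"
proof
  show "carrier T \<subseteq> tsp (carrier R) (carrier S)"
  proof
    fix x assume "x \<in> carrier T"
    then obtain c where c: "c \<in> carrier P" "x = a_r_coset P I c" by (rule ts.T_cases)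
    have "Poly_Mapping.keys c \<subseteq> carrier R \<times> carrier S" using c by (simp add: pair_ring_simps)
    then have "c \<in> carrier P \<and> a_r_coset P I c \<in> tsp (carrier R) (carrier S)"
    proof (induction c rule: frag_induction)
      case zero then show ?case by (simp add: coset_0 tspan.zero pair_ring_simps)
    next
      case (one z)
      then show ?case using tsp_base[of "fst z" "carrier R" "snd z" "carrier S"]
        by (cases z) (auto simp: frag_of_closed pure_tensor_def)
    next
      case (diff a b)
      then show ?case by (auto simp: coset_diff P_diff a_minus_def intro!: tsp_add tsp_minus)
    qed
    with c show "x \<in> tsp (carrier R) (carrier S)" by simp
  qed
qed (auto intro: tsp_closed)

text \<open>Two cases suffice: zero is the pure tensor of two zeros, and a minus sign is absorbed by
  the left factor.\<close>

lemma T_induct [consumes 1, case_names pure add]: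
  assumes "x \<in> carrier T" "\<And>r s. r \<in> carrier R \<Longrightarrow> s \<in> carrier S \<Longrightarrow> Q (pt r s)"
    "\<And>x y. x \<in> carrier T \<Longrightarrow> y \<in> carrier T \<Longrightarrow> Q x \<Longrightarrow> Q y \<Longrightarrow> Q (x \<oplus>\<^bsub>T\<^esub> y)"
  shows "Q x"
proof -
  have "x \<in> tsp (carrier R) (carrier S)" using assms tsp_carrier by simp
  then show ?thesis
  proof (induction rule: tspan.induct)
    case zero
    have "Q (pt \<zero>\<^bsub>R\<^esub> \<zero>\<^bsub>S\<^esub>)" by (intro assms(2)) auto
    then show ?case by (simp add: pt_zero_left)
  next
    case (step r s x)
    then show ?case by (intro assms(2,3)) (auto simp: tsp_carrier)
  qed
qed

text \<open>The tensor ideal is generated as a ring ideal, so the additive extension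
  \<open>h\<close> of \<open>f\<close> must kill all multiples of the relations and not just the
  relations. It does, because a relation multiplied by a generator \<open>frag_of (r0, s0)\<close>
  is a relation of the same kind.\<close>

lemma tlift_exists:
  assumes "abelian_group M" and f: "balanced k \<phi> R \<psi> S M f"
  shows "\<exists>F. (\<forall>x\<in>carrier T. F x \<in> carrier M) \<and>
    (\<forall>x\<in>carrier T. \<forall>y\<in>carrier T. F (x \<oplus>\<^bsub>T\<^esub> y) = F x \<oplus>\<^bsub>M\<^esub> F y) \<and>
    (\<forall>r\<in>carrier R. \<forall>s\<in>carrier S. F (pt r s) = f r s)"
proof -
  interpret M: abelian_group M by fact
  note fD = f[unfolded balanced_def]
  have f1: "f r s \<in> carrier M" if "r \<in> carrier R" "s \<in> carrier S" for r s using fD that by blast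
  obtain h where h: "h \<in> Group.hom (free_Abelian_group (carrier R \<times> carrier S)) (add_monoid M)"
    "\<And>x. x \<in> carrier R \<times> carrier S \<Longrightarrow> h (frag_of x) = case_prod f x"
    using M.a_comm_group comm_group.free_Abelian_group_universal[of "add_monoid M" "case_prod f" "carrier R \<times> carrier S"]
      f1 by (auto simp: image_subset_iff)
  have h_closed: "h c \<in> carrier M" if "c \<in> carrier P" for c
    using h(1) that by (auto simp: Group.hom_def pair_ring_simps)
  have h_add: "h (c + d) = h c \<oplus>\<^bsub>M\<^esub> h d" if "c \<in> carrier P" "d \<in> carrier P" for c d
    using h(1) that by (auto simp: Group.hom_def pair_ring_simps)
  have h_diff: "h (c - d) = h c \<ominus>\<^bsub>M\<^esub> h d" if "c \<in> carrier P" "d \<in> carrier P" for c d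
  proof -
    have cd: "h (c - d) \<in> carrier M" "h d \<in> carrier M" using h_closed P_diff that by blast+
    have "h c = h (c - d) \<oplus>\<^bsub>M\<^esub> h d" using h_add[of "c - d" d] that P_diff by simp
    then show ?thesis
      using cd by (simp add: a_minus_def M.a_assoc M.r_neg)
  qed
  have h_pure: "h (frag_of (r, s)) = f r s" if "r \<in> carrier R" "s \<in> carrier S" for r s
    using h(2)[of "(r, s)"] that by simp
  \<comment> \<open>The largest ideal contained in the kernel of \<open>h\<close>. By minimality of
    the tensor ideal it is enough to find the relations in \<open>N\<close>.\<close>
  define N where "N = {c \<in> carrier P. \<forall>d\<in>carrier P. h (d \<otimes>\<^bsub>P\<^esub> c) = \<zero>\<^bsub>M\<^esub>}"
  have "ideal N P"
  proof (rule idealI[OF ts.P.ring_axioms])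
    have 0: "0 \<in> carrier P" by (simp add: pair_ring_simps)
    show "subgroup N (add_monoid P)"
    proof (rule ts.P.add.subgroupI)
      show "N \<noteq> {}"
        using 0 h_diff[OF 0 0] h_closed[OF 0] M.r_neg[of "h 0"] by (auto simp: N_def pair_mult_0 a_minus_def)
      fix a b assume a: "a \<in> N" and b: "b \<in> N"
      show "\<ominus>\<^bsub>P\<^esub> a \<in> N"
      proof -
        have "d \<otimes>\<^bsub>P\<^esub> (\<ominus>\<^bsub>P\<^esub> a) = (\<ominus>\<^bsub>P\<^esub> d) \<otimes>\<^bsub>P\<^esub> a" if "d \<in> carrier P" for d
          using that a by (simp add: N_def ts.P.l_minus ts.P.r_minus)
        then show ?thesis using a by (simp add: N_def)
      qed
      show "a \<oplus>\<^bsub>P\<^esub> b \<in> N"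
        using a b by (auto simp: N_def pair_ring_simps(4) pair_mult_add h_add P_add)
    qed (auto simp: N_def)
    fix a x assume a: "a \<in> N" and x: "x \<in> carrier P"
    show "x \<otimes>\<^bsub>P\<^esub> a \<in> N"
      using a x by (auto simp: N_def ts.P.m_assoc[symmetric])
    then show "a \<otimes>\<^bsub>P\<^esub> x \<in> N" using a x ts.P.m_comm[of a x] by (simp add: N_def)
  qed
  moreover have "tensor_relations k \<phi> R \<psi> S \<subseteq> N"
  proof
    fix c assume c: "c \<in> tensor_relations k \<phi> R \<psi> S"
    have "h (d \<otimes>\<^bsub>P\<^esub> c) = \<zero>\<^bsub>M\<^esub>" if d: "d \<in> carrier P" for d
    proof -
      have cP: "c \<in> carrier P" using c ts.relations_subset by blast
      have "Poly_Mapping.keys d \<subseteq> carrier R \<times> carrier S" using d by (simp add: pair_ring_simps)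
      then have "d \<in> carrier P \<and> h (d \<otimes>\<^bsub>P\<^esub> c) = \<zero>\<^bsub>M\<^esub>"
      proof (induction d rule: frag_induction)
        case zero
        have 0: "0 \<in> carrier P" by (simp add: pair_ring_simps)
        show ?case using 0 h_diff[OF 0 0] h_closed[OF 0] M.r_neg[of "h 0"] by (auto simp: pair_mult_0 a_minus_def)
      next
        case (diff a b)
        then show ?case using cP by (simp add: P_diff pair_mult_diff h_diff a_minus_def)
      next
        case (one z)
        obtain r0 s0 where z: "z = (r0, s0)" "r0 \<in> carrier R" "s0 \<in> carrier S" using one by (cases z) auto
        have "h (frag_of z \<otimes>\<^bsub>P\<^esub> c) = \<zero>\<^bsub>M\<^esub>"
          using c
        proof (cases rule: tensor_relations_cases)
          case (left r r' s)
          then show ?thesis using z fD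
            by (simp add: pair_mult_diff pair_mult_of R.R.r_distr h_diff P_diff frag_of_closed h_pure f1
                a_minus_def M.add.inv_mult_group M.a_ac M.r_neg M.r_neg1 M.r_neg2)
        next
          case (right r s s')
          then show ?thesis using z fD
            by (simp add: pair_mult_diff pair_mult_of S.R.r_distr h_diff P_diff frag_of_closed h_pure f1
                a_minus_def M.add.inv_mult_group M.a_ac M.r_neg M.r_neg1 M.r_neg2)
        next
          case (scalar a r s)
          have "f (\<phi> a \<otimes>\<^bsub>R\<^esub> (r0 \<otimes>\<^bsub>R\<^esub> r)) (s0 \<otimes>\<^bsub>S\<^esub> s) = f (r0 \<otimes>\<^bsub>R\<^esub> r) (\<psi> a \<otimes>\<^bsub>S\<^esub> (s0 \<otimes>\<^bsub>S\<^esub> s))"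
            using fD z scalar by simp
          moreover have "\<phi> a \<otimes>\<^bsub>R\<^esub> (r0 \<otimes>\<^bsub>R\<^esub> r) = r0 \<otimes>\<^bsub>R\<^esub> (\<phi> a \<otimes>\<^bsub>R\<^esub> r)" "\<psi> a \<otimes>\<^bsub>S\<^esub> (s0 \<otimes>\<^bsub>S\<^esub> s) = s0 \<otimes>\<^bsub>S\<^esub> (\<psi> a \<otimes>\<^bsub>S\<^esub> s)"
            using z scalar by (simp_all add: R.R.m_lcomm S.R.m_lcomm)
          ultimately show ?thesis using z scalar
            by (simp add: pair_mult_diff pair_mult_of h_diff P_diff frag_of_closed h_pure f1 a_minus_def M.r_neg)
        qed
        then show ?case using z by (simp add: frag_of_closed)
      qed
      then show ?thesis ..
    qed
    then show "c \<in> N" using c ts.relations_subset by (auto simp: N_def)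
  qed
  ultimately have IN: "I \<subseteq> N" by (rule ts.ideal_least)
  have h_I: "h c = \<zero>\<^bsub>M\<^esub>" if "c \<in> I" for c
    using IN that ts.P.one_closed ts.P.l_one[of c] by (force simp: N_def)
  define F where "F Z = h (SOME c. c \<in> carrier P \<and> Z = a_r_coset P I c)" for Z
  have F: "F (a_r_coset P I c) = h c" if c: "c \<in> carrier P" for c
  proof -
    define d where "d = (SOME d. d \<in> carrier P \<and> a_r_coset P I c = a_r_coset P I d)"
    have d: "d \<in> carrier P \<and> a_r_coset P I c = a_r_coset P I d"
      unfolding d_def by (rule someI[of _ c]) (use c in simp)
    then have "c - d \<in> I" using c ts.coset_eq_iff by blast
    then have "h (c - d) = \<zero>\<^bsub>M\<^esub>" by (rule h_I)
    then have "h c = h d"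
      using h_add[of "c - d" d] h_closed[of d] P_diff c d by simp
    then show ?thesis by (simp add: F_def d_def)
  qed
  show ?thesis
  proof (intro exI conjI ballI)
    fix x assume "x \<in> carrier T"
    then obtain c where c: "c \<in> carrier P" "x = a_r_coset P I c" by (rule ts.T_cases)
    show "F x \<in> carrier M" using c h_closed F by simp
    fix y assume "y \<in> carrier T"
    then obtain d where d: "d \<in> carrier P" "y = a_r_coset P I d" by (rule ts.T_cases)
    show "F (x \<oplus>\<^bsub>T\<^esub> y) = F x \<oplus>\<^bsub>M\<^esub> F y"
      using c d by (simp add: coset_add[symmetric] F P_add h_add)
  next
    fix r s assume "r \<in> carrier R" "s \<in> carrier S"
    then show "F (pt r s) = f r s" by (simp add: pure_tensor_def F frag_of_closed h_pure)
  qed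
qed

abbreviation "lift \<equiv> tlift k \<phi> R \<psi> S"

lemma
  assumes "abelian_group M" and "balanced k \<phi> R \<psi> S M f"
  shows tlift_closed: "x \<in> carrier T \<Longrightarrow> lift M f x \<in> carrier M"
    and tlift_add: "x \<in> carrier T \<Longrightarrow> y \<in> carrier T \<Longrightarrow> lift M f (x \<oplus>\<^bsub>T\<^esub> y) = lift M f x \<oplus>\<^bsub>M\<^esub> lift M f y"
    and tlift_pure: "r \<in> carrier R \<Longrightarrow> s \<in> carrier S \<Longrightarrow> lift M f (pt r s) = f r s"
  using someI_ex[OF tlift_exists[OF assms], folded tlift_def] by blast+

lemma left_hom: "(\<lambda>r. pt r \<one>\<^bsub>S\<^esub>) \<in> ring_hom R T"
  by (rule ring_hom_memI) (auto simp: pt_mult pt_addl pt_one)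

lemma right_hom: "(\<lambda>s. pt \<one>\<^bsub>R\<^esub> s) \<in> ring_hom S T"
  by (rule ring_hom_memI) (auto simp: pt_mult pt_addr pt_one)

lemma scalar_right: "a \<in> carrier k \<Longrightarrow> pt (\<phi> a) \<one>\<^bsub>S\<^esub> = pt \<one>\<^bsub>R\<^esub> (\<psi> a)"
  using pt_balance[of a "\<one>\<^bsub>R\<^esub>" "\<one>\<^bsub>S\<^esub>"] by simp

sublocale T: field_algebra k "\<lambda>a. pt (\<phi> a) \<one>\<^bsub>S\<^esub>" T
  by unfold_locales (use ring_hom_trans[OF R.hom left_hom] in \<open>simp add: comp_def\<close>)

end

context field_algebra
begin

lemma lform_zero: "\<xi> \<in> linear_forms k \<phi> R \<Longrightarrow> \<xi> \<zero> = \<zero>\<^bsub>k\<^esub>"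
  using linear_formsD(3)[of \<xi> k \<phi> R "\<zero>\<^bsub>k\<^esub>" \<zero>] linear_formsD(1)[of \<xi> k \<phi> R \<zero>] by simp

text \<open>Each form comes from \<open>linear_form_exists\<close> for \<open>g\<close> against
  \<open>G - {g}\<close>. The forms are defined on all of \<open>R\<close>, while the expansion
  holds on \<open>sp G\<close> only.\<close>

lemma dual_basis:
  assumes "finite G" and G: "indep G"
  obtains \<xi> where "\<And>g. g \<in> G \<Longrightarrow> \<xi> g \<in> linear_forms k \<phi> R"
    "\<And>r. r \<in> sp G \<Longrightarrow> r = (\<Oplus>g\<in>G. \<phi> (\<xi> g r) \<otimes> g)"
    "\<And>g h. g \<in> G \<Longrightarrow> h \<in> G \<Longrightarrow> \<xi> g h = (if g = h then \<one>\<^bsub>k\<^esub> else \<zero>\<^bsub>k\<^esub>)"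
proof -
  have GR: "G \<subseteq> carrier R" using G by (simp add: indep_def)
  have "\<exists>\<xi>. \<xi> \<in> linear_forms k \<phi> R \<and> \<xi> g = \<one>\<^bsub>k\<^esub> \<and> (\<forall>h\<in>G - {g}. \<xi> h = \<zero>\<^bsub>k\<^esub>)" if "g \<in> G" for g
  proof -
    have "G - {g} \<subseteq> carrier R" "g \<in> carrier R" "g \<notin> sp (G - {g})" using that GR G by (auto simp: indep_def)
    then obtain \<xi> where "\<xi> \<in> linear_forms k \<phi> R" "\<xi> g = \<one>\<^bsub>k\<^esub>" "\<And>h. h \<in> G - {g} \<Longrightarrow> \<xi> h = \<zero>\<^bsub>k\<^esub>"
      by (rule linear_form_exists) blast
    then show ?thesis by blast
  qed
  then have "\<exists>\<xi>. \<forall>g\<in>G. \<xi> g \<in> linear_forms k \<phi> R \<and> \<xi> g g = \<one>\<^bsub>k\<^esub> \<and> (\<forall>h\<in>G - {g}. \<xi> g h = \<zero>\<^bsub>k\<^esub>)"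
    by (intro bchoice) blast
  then obtain \<xi> where \<xi>: "\<And>g. g \<in> G \<Longrightarrow> \<xi> g \<in> linear_forms k \<phi> R"
    "\<And>g. g \<in> G \<Longrightarrow> \<xi> g g = \<one>\<^bsub>k\<^esub>" "\<And>g h. g \<in> G \<Longrightarrow> h \<in> G \<Longrightarrow> g \<noteq> h \<Longrightarrow> \<xi> g h = \<zero>\<^bsub>k\<^esub>"
    by auto
  note lf = linear_formsD[OF \<xi>(1)]
  have "r = (\<Oplus>g\<in>G. \<phi> (\<xi> g r) \<otimes> g)" if "r \<in> sp G" for r
    using that
  proof (induction rule: lspan.induct)
    case zero
    have "(\<Oplus>g\<in>G. \<phi> (\<xi> g \<zero>) \<otimes> g) = (\<Oplus>g\<in>G. \<zero>)"
      by (rule R.finsum_cong') (auto simp: lform_zero[OF \<xi>(1)] subsetD[OF GR])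
    then show ?case by simp
  next
    case (step a x y)
    have xy: "x \<in> carrier R" "y \<in> carrier R" using step GR sp_closed by auto
    have gR: "g \<in> carrier R" if "g \<in> G" for g using GR that by blast
    have "(\<Oplus>g\<in>G. \<phi> (\<xi> g (\<phi> a \<otimes> x \<oplus> y)) \<otimes> g) =
        (\<Oplus>g\<in>G. (if x = g then \<phi> a \<otimes> x else \<zero>) \<oplus> \<phi> (\<xi> g y) \<otimes> g)"
    proof (rule R.finsum_cong')
      fix g assume g: "g \<in> G"
      have "\<xi> g (\<phi> a \<otimes> x \<oplus> y) = a \<otimes>\<^bsub>k\<^esub> \<xi> g x \<oplus>\<^bsub>k\<^esub> \<xi> g y"
        using g xy step.hyps(1) by (simp add: lf)
      moreover have "\<xi> g x = (if x = g then \<one>\<^bsub>k\<^esub> else \<zero>\<^bsub>k\<^esub>)" using \<xi>(2,3) g step.hyps(2) by auto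
      ultimately show "\<phi> (\<xi> g (\<phi> a \<otimes> x \<oplus> y)) \<otimes> g = (if x = g then \<phi> a \<otimes> x else \<zero>) \<oplus> \<phi> (\<xi> g y) \<otimes> g"
        using g xy step.hyps(1) gR[OF g] lf(1)[OF g xy(2)] by (auto simp: hom_simps(3) R.l_distr)
    qed (use xy step.hyps(1) gR lf(1) in auto)
    also have "\<dots> = (\<Oplus>g\<in>G. if x = g then \<phi> a \<otimes> x else \<zero>) \<oplus> (\<Oplus>g\<in>G. \<phi> (\<xi> g y) \<otimes> g)"
      by (rule R.finsum_addf) (use xy step.hyps(1) gR lf(1) in auto)
    also have "(\<Oplus>g\<in>G. if x = g then \<phi> a \<otimes> x else \<zero>) = \<phi> a \<otimes> x"
      using R.finsum_singleton[of x G "\<lambda>_. \<phi> a \<otimes> x"] assms(1) step.hyps xy by auto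
    finally show ?case using step.IH by simp
  qed
  with \<xi> show ?thesis by (intro that[of \<xi>]) auto
qed

end

section \<open>Slices: a linear form applied to one tensor factor\<close>

context algebra_tensor
begin

text \<open>The map id \<otimes> \<xi> from R \<otimes> S to R \<otimes> k = R.\<close>

definition lslice :: "('b \<Rightarrow> 'k) \<Rightarrow> ('a \<times> 'b \<Rightarrow>\<^sub>0 int) set \<Rightarrow> 'a"
  where "lslice \<xi> = lift R (\<lambda>r s. \<phi> (\<xi> s) \<otimes>\<^bsub>R\<^esub> r)"

lemma lslice_balanced:
  assumes \<xi>: "\<xi> \<in> linear_forms k \<psi> S"
  shows "balanced k \<phi> R \<psi> S R (\<lambda>r s. \<phi> (\<xi> s) \<otimes>\<^bsub>R\<^esub> r)"
  unfolding balanced_def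
  by (intro conjI ballI)
    (simp_all add: linear_formsD[OF \<xi>] R.hom_simps R.R.l_distr R.R.r_distr R.R.m_assoc R.R.m_lcomm)

lemmas lslice_closed = tlift_closed[OF R.R.abelian_group_axioms lslice_balanced, folded lslice_def]
lemmas lslice_add = tlift_add[OF R.R.abelian_group_axioms lslice_balanced, folded lslice_def]
lemmas lslice_pure = tlift_pure[OF R.R.abelian_group_axioms lslice_balanced, folded lslice_def]

lemma lslice_zero: "\<xi> \<in> linear_forms k \<psi> S \<Longrightarrow> lslice \<xi> \<zero>\<^bsub>T\<^esub> = \<zero>\<^bsub>R\<^esub>"
  using lslice_pure[of \<xi> "\<zero>\<^bsub>R\<^esub>" "\<zero>\<^bsub>S\<^esub>"] linear_formsD(1)[of \<xi> k \<psi> S "\<zero>\<^bsub>S\<^esub>"]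
  by (simp add: pt_zero_left)

lemma lslice_mult_left:
  assumes \<xi>: "\<xi> \<in> linear_forms k \<psi> S" and r: "r \<in> carrier R" and x: "x \<in> carrier T"
  shows "lslice \<xi> (pt r \<one>\<^bsub>S\<^esub> \<otimes>\<^bsub>T\<^esub> x) = r \<otimes>\<^bsub>R\<^esub> lslice \<xi> x"
  using x
proof (induction rule: T_induct)
  case (pure r' s)
  then show ?case
    using r linear_formsD(1)[OF \<xi>] by (simp add: pt_mult lslice_pure[OF \<xi>] R.R.m_lcomm)
next
  case (add x y)
  then show ?case using r by (simp add: ts.T.r_distr lslice_add[OF \<xi>] R.R.r_distr lslice_closed[OF \<xi>])
qed

lemma lslice_tsp:
  assumes \<xi>: "\<xi> \<in> linear_forms k \<psi> S" and A: "A \<subseteq> carrier R" "B \<subseteq> carrier S" and "x \<in> tsp A B"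
  shows "lslice \<xi> x \<in> R.sp A"
  using assms(4)
proof (induction rule: tspan.induct)
  case zero
  then show ?case by (simp add: lslice_zero \<xi> lspan.zero)
next
  case (step r s x)
  have "x \<in> carrier T" "r \<in> carrier R" "s \<in> carrier S" using step A tsp_closed by auto
  then have "lslice \<xi> (pt r s \<oplus>\<^bsub>T\<^esub> x) = \<phi> (\<xi> s) \<otimes>\<^bsub>R\<^esub> r \<oplus>\<^bsub>R\<^esub> lslice \<xi> x" "\<xi> s \<in> carrier k"
    by (simp_all add: lslice_add[OF \<xi>] lslice_pure[OF \<xi>] linear_formsD(1)[OF \<xi>])
  then show ?case using step by (simp add: lspan.step)
qed

lemma tsp_finite:
  assumes "x \<in> tsp A B"
  obtains A' B' where "finite A'" "finite B'" "A' \<subseteq> A" "B' \<subseteq> B" "x \<in> tsp A' B'"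
proof -
  have "\<exists>A' B'. finite A' \<and> finite B' \<and> A' \<subseteq> A \<and> B' \<subseteq> B \<and> x \<in> tsp A' B'"
    using assms
  proof (induction rule: tspan.induct)
    case zero
    show ?case by (rule exI[of _ "{}"], rule exI[of _ "{}"]) (simp add: tspan.zero)
  next
    case (step r s x)
    then obtain A' B' where *: "finite A'" "finite B'" "A' \<subseteq> A" "B' \<subseteq> B" "x \<in> tsp A' B'" by blast
    then have "x \<in> tsp (insert r A') (insert s B')"
      using tsp_mono[of A' "insert r A'" B' "insert s B'"] by blast
    then have "pt r s \<oplus>\<^bsub>T\<^esub> x \<in> tsp (insert r A') (insert s B')" by (intro tspan.step) auto
    with * step show ?case
      by (intro exI[of _ "insert r A'"] exI[of _ "insert s B'"]) auto
  qed
  then show ?thesis using that by blast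
qed

lemma finsum_tsp:
  assumes "finite G" "A \<subseteq> carrier R" "B \<subseteq> carrier S" "\<And>g. g \<in> G \<Longrightarrow> f g \<in> tsp A B"
  shows "(\<Oplus>\<^bsub>T\<^esub>g\<in>G. f g) \<in> tsp A B"
  using assms(1,4)
proof (induction G)
  case (insert g G)
  then show ?case using tsp_closed[OF _ assms(2,3)]
    by (subst ts.T.finsum_insert) (auto intro!: tsp_add assms(2,3))
qed (simp add: tspan.zero)

lemma pt_finsum:
  assumes "finite G" "r \<in> carrier R" "\<And>g. g \<in> G \<Longrightarrow> f g \<in> carrier S"
  shows "pt r (\<Oplus>\<^bsub>S\<^esub>g\<in>G. f g) = (\<Oplus>\<^bsub>T\<^esub>g\<in>G. pt r (f g))"
  using assms(1,3)
proof (induction G)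
  case (insert g G)
  have "(\<Oplus>\<^bsub>S\<^esub>g\<in>G. f g) \<in> carrier S" using insert by (intro S.R.finsum_closed) auto
  moreover have "(\<Oplus>\<^bsub>S\<^esub>g\<in>insert g G. f g) = f g \<oplus>\<^bsub>S\<^esub> (\<Oplus>\<^bsub>S\<^esub>g\<in>G. f g)"
    using insert by (intro S.R.finsum_insert) auto
  moreover have "(\<Oplus>\<^bsub>T\<^esub>g\<in>insert g G. pt r (f g)) = pt r (f g) \<oplus>\<^bsub>T\<^esub> (\<Oplus>\<^bsub>T\<^esub>g\<in>G. pt r (f g))"
    using insert assms(2) by (intro ts.T.finsum_insert) auto
  ultimately show ?case using insert assms(2) by (simp add: pt_addr)
qed (simp add: pt_zero_right assms(2))

text \<open>For a pure tensor the right factor is expanded in \<open>G\<close> and its coefficients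
  are moved across the tensor sign; the general case follows by additivity. So the slices along the
  coordinate forms are the coefficients of \<open>x\<close>, whatever representation of
  \<open>x\<close> is given.\<close>

lemma slice_expansion:
  assumes fG: "finite G" and GS: "G \<subseteq> carrier S"
    and \<xi>: "\<And>g. g \<in> G \<Longrightarrow> \<xi> g \<in> linear_forms k \<psi> S"
      "\<And>s. s \<in> S.sp G \<Longrightarrow> s = (\<Oplus>\<^bsub>S\<^esub>g\<in>G. \<psi> (\<xi> g s) \<otimes>\<^bsub>S\<^esub> g)"
    and x: "x \<in> tsp (carrier R) (S.sp G)"
  shows "x = (\<Oplus>\<^bsub>T\<^esub>g\<in>G. pt (lslice (\<xi> g) x) g)"
proof -
  have gS: "g \<in> carrier S" if "g \<in> G" for g using that GS by blast
  have cl: "lslice (\<xi> g) y \<in> carrier R" if "g \<in> G" "y \<in> carrier T" for g y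
    using \<xi>(1) that lslice_closed by blast
  have "x \<in> carrier T \<and> x = (\<Oplus>\<^bsub>T\<^esub>g\<in>G. pt (lslice (\<xi> g) x) g)"
    using x
  proof (induction rule: tspan.induct)
    case zero
    have "(\<Oplus>\<^bsub>T\<^esub>g\<in>G. pt (lslice (\<xi> g) \<zero>\<^bsub>T\<^esub>) g) = (\<Oplus>\<^bsub>T\<^esub>g\<in>G. \<zero>\<^bsub>T\<^esub>)"
      by (rule ts.T.finsum_cong') (use gS in \<open>auto simp: lslice_zero[OF \<xi>(1)] pt_zero_left\<close>)
    then show ?case by simp
  next
    case (step r s x)
    have rs: "r \<in> carrier R" "s \<in> carrier S" "x \<in> carrier T" using step S.sp_subset[OF GS] by auto
    note s = \<xi>(2)[OF step.hyps(2)]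
    have k: "\<xi> g s \<in> carrier k" if "g \<in> G" for g using linear_formsD(1)[OF \<xi>(1)] that rs by blast
    have "pt r s = pt r (\<Oplus>\<^bsub>S\<^esub>g\<in>G. \<psi> (\<xi> g s) \<otimes>\<^bsub>S\<^esub> g)" using s by simp
    also have "\<dots> = (\<Oplus>\<^bsub>T\<^esub>g\<in>G. pt r (\<psi> (\<xi> g s) \<otimes>\<^bsub>S\<^esub> g))"
      by (rule pt_finsum) (use fG rs gS k in auto)
    finally have 1: "pt r s = (\<Oplus>\<^bsub>T\<^esub>g\<in>G. pt r (\<psi> (\<xi> g s) \<otimes>\<^bsub>S\<^esub> g))" .
    have "(\<Oplus>\<^bsub>T\<^esub>g\<in>G. pt (lslice (\<xi> g) (pt r s \<oplus>\<^bsub>T\<^esub> x)) g) =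
        (\<Oplus>\<^bsub>T\<^esub>g\<in>G. pt r (\<psi> (\<xi> g s) \<otimes>\<^bsub>S\<^esub> g) \<oplus>\<^bsub>T\<^esub> pt (lslice (\<xi> g) x) g)"
    proof (rule ts.T.finsum_cong')
      fix g assume g: "g \<in> G"
      then show "pt (lslice (\<xi> g) (pt r s \<oplus>\<^bsub>T\<^esub> x)) g = pt r (\<psi> (\<xi> g s) \<otimes>\<^bsub>S\<^esub> g) \<oplus>\<^bsub>T\<^esub> pt (lslice (\<xi> g) x) g"
        using rs gS[OF g] k[OF g] cl[OF g rs(3)]
        by (simp add: lslice_add[OF \<xi>(1)[OF g]] lslice_pure[OF \<xi>(1)[OF g]] pt_addl pt_balance)
    qed (use rs gS k cl in auto)
    also have "\<dots> = pt r s \<oplus>\<^bsub>T\<^esub> x"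
      unfolding 1 using step.IH
      by (subst ts.T.finsum_addf) (use rs gS k cl in auto)
    finally show ?case using rs by simp
  qed
  then show ?thesis ..
qed

text \<open>Writing the finitely many right factors in a basis \<open>G\<close> turns the left
  factors into slices. Together with \<open>lslice_tsp\<close> this shows that the slices of
  \<open>x\<close> span the smallest space of left factors. As \<open>G\<close> is chosen inside
  \<open>B\<close>, the right factors stay in \<open>B\<close>, which is what allows intersections
  of two such spans to be computed.\<close>

lemma slice_support:
  assumes B: "B \<subseteq> carrier S" and x: "x \<in> tsp (carrier R) B"
  obtains W where "finite W" "W \<subseteq> (\<lambda>\<xi>. lslice \<xi> x) ` linear_forms k \<psi> S" "x \<in> tsp W B"
proof -
  obtain A' F where F: "finite F" "F \<subseteq> B" "x \<in> tsp A' F" "A' \<subseteq> carrier R"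
    using tsp_finite[OF x] by metis
  have FS: "F \<subseteq> carrier S" using F B by blast
  obtain G where G: "G \<subseteq> F" "S.indep G" "S.sp G = S.sp F"
    using S.basis_exists[OF F(1) FS] by blast
  have fG: "finite G" using G F finite_subset by blast
  have GS: "G \<subseteq> carrier S" using G FS by blast
  obtain \<xi> where \<xi>: "\<And>g. g \<in> G \<Longrightarrow> \<xi> g \<in> linear_forms k \<psi> S"
    "\<And>s. s \<in> S.sp G \<Longrightarrow> s = (\<Oplus>\<^bsub>S\<^esub>g\<in>G. \<psi> (\<xi> g s) \<otimes>\<^bsub>S\<^esub> g)"
    using S.dual_basis[OF fG G(2)] by metis
  have "F \<subseteq> S.sp G" using G(3) S.sp_base FS by blast
  then have "x \<in> tsp (carrier R) (S.sp G)" using F(3,4) tsp_mono by blast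
  then have x: "x \<in> carrier T" "x = (\<Oplus>\<^bsub>T\<^esub>g\<in>G. pt (lslice (\<xi> g) x) g)"
    using tsp_closed[OF _ subset_refl S.sp_subset[OF GS]] slice_expansion[OF fG GS \<xi>] by auto
  have cl: "lslice (\<xi> g) x \<in> carrier R" if "g \<in> G" for g
    using \<xi>(1) that lslice_closed x(1) by blast
  let ?W = "(\<lambda>g. lslice (\<xi> g) x) ` G"
  have "(\<Oplus>\<^bsub>T\<^esub>g\<in>G. pt (lslice (\<xi> g) x) g) \<in> tsp ?W B"
    by (rule finsum_tsp[OF fG _ B]) (use cl G(1) F(2) B in \<open>auto intro!: tsp_base\<close>)
  then have "x \<in> tsp ?W B" using x(2) by simp
  then show ?thesis using fG \<xi>(1) by (intro that[of ?W]) auto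
qed

text \<open>By \<open>slice_support\<close> the left factors can be taken among the slices, which
  all vanish here. This yields injectivity of the maps that inclusions induce on tensor
  products.\<close>

lemma slices_zero:
  assumes x: "x \<in> carrier T" and 0: "\<And>\<xi>. \<xi> \<in> linear_forms k \<psi> S \<Longrightarrow> lslice \<xi> x = \<zero>\<^bsub>R\<^esub>"
  shows "x = \<zero>\<^bsub>T\<^esub>"
proof -
  have "x \<in> tsp (carrier R) (carrier S)" using x tsp_carrier by simp
  then obtain W where W: "W \<subseteq> (\<lambda>\<xi>. lslice \<xi> x) ` linear_forms k \<psi> S" "x \<in> tsp W (carrier S)"
    by (rule slice_support[OF subset_refl]) blast
  have "W \<subseteq> {\<zero>\<^bsub>R\<^esub>}" using W(1) 0 by auto
  then have "x \<in> tsp {\<zero>\<^bsub>R\<^esub>} (carrier S)" using W(2) tsp_mono by blast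
  then show ?thesis
    by (induction rule: tspan.induct) (auto simp: pt_zero_left)
qed

end


section \<open>Separability idempotents\<close>

definition separable_algebra :: "('k, 'l) ring_scheme \<Rightarrow> ('k \<Rightarrow> 'a) \<Rightarrow> ('a, 'm) ring_scheme \<Rightarrow> bool"
  where "separable_algebra k \<phi> A \<longleftrightarrow> (\<exists>u\<in>carrier (tensor_ring k \<phi> A \<phi> A).
    (\<forall>x\<in>carrier A. pure_tensor k \<phi> A \<phi> A x \<one>\<^bsub>A\<^esub> \<otimes>\<^bsub>tensor_ring k \<phi> A \<phi> A\<^esub> u =
       pure_tensor k \<phi> A \<phi> A \<one>\<^bsub>A\<^esub> x \<otimes>\<^bsub>tensor_ring k \<phi> A \<phi> A\<^esub> u) \<and>
    tlift k \<phi> A \<phi> A A (monoid.mult A) u = \<one>\<^bsub>A\<^esub>)"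

text \<open>This and the next two lemmas serve for maps such as slices, which are additive without
  being multiplicative.\<close>

lemma additive_zero:
  assumes "abelian_group G" "abelian_group H"
    and F: "\<And>x. x \<in> carrier G \<Longrightarrow> F x \<in> carrier H"
    and add: "\<And>x y. x \<in> carrier G \<Longrightarrow> y \<in> carrier G \<Longrightarrow> F (x \<oplus>\<^bsub>G\<^esub> y) = F x \<oplus>\<^bsub>H\<^esub> F y"
  shows "F \<zero>\<^bsub>G\<^esub> = \<zero>\<^bsub>H\<^esub>"
proof -
  interpret G: abelian_group G by fact
  interpret H: abelian_group H by fact
  show ?thesis using add[of "\<zero>\<^bsub>G\<^esub>" "\<zero>\<^bsub>G\<^esub>"] F[of "\<zero>\<^bsub>G\<^esub>"] H.add.l_cancel_one'[of "F \<zero>\<^bsub>G\<^esub>" "F \<zero>\<^bsub>G\<^esub>"] by simp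
qed

lemma additive_minus:
  assumes "abelian_group G" "abelian_group H"
    and F: "\<And>x. x \<in> carrier G \<Longrightarrow> F x \<in> carrier H"
    and add: "\<And>x y. x \<in> carrier G \<Longrightarrow> y \<in> carrier G \<Longrightarrow> F (x \<oplus>\<^bsub>G\<^esub> y) = F x \<oplus>\<^bsub>H\<^esub> F y"
    and x: "x \<in> carrier G"
  shows "F (\<ominus>\<^bsub>G\<^esub> x) = \<ominus>\<^bsub>H\<^esub> F x"
proof -
  interpret G: abelian_group G by fact
  interpret H: abelian_group H by fact
  have "F (\<ominus>\<^bsub>G\<^esub> x) \<oplus>\<^bsub>H\<^esub> F x = \<zero>\<^bsub>H\<^esub>"
    using add[of "\<ominus>\<^bsub>G\<^esub> x" x] x additive_zero[OF assms(1-4)] by (simp add: G.l_neg)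
  then show ?thesis using F x by (metis G.a_inv_closed H.minus_equality)
qed

lemma additive_finsum:
  assumes "abelian_group G" "abelian_group H"
    and F: "\<And>x. x \<in> carrier G \<Longrightarrow> F x \<in> carrier H"
    and add: "\<And>x y. x \<in> carrier G \<Longrightarrow> y \<in> carrier G \<Longrightarrow> F (x \<oplus>\<^bsub>G\<^esub> y) = F x \<oplus>\<^bsub>H\<^esub> F y"
    and "finite N" "\<And>i. i \<in> N \<Longrightarrow> f i \<in> carrier G"
  shows "F (finsum G f N) = (\<Oplus>\<^bsub>H\<^esub>i\<in>N. F (f i))"
proof -
  interpret G: abelian_group G by fact
  interpret H: abelian_group H by fact
  show ?thesis using assms(5,6)
  proof (induction N)
    case empty
    then show ?case by (simp add: additive_zero[OF assms(1-4)])
  next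
    case (insert i N)
    then have "finsum G f (insert i N) = f i \<oplus>\<^bsub>G\<^esub> finsum G f N" by (intro G.finsum_insert) auto
    moreover have "(\<Oplus>\<^bsub>H\<^esub>i\<in>insert i N. F (f i)) = F (f i) \<oplus>\<^bsub>H\<^esub> (\<Oplus>\<^bsub>H\<^esub>i\<in>N. F (f i))"
      using insert F by (intro H.finsum_insert) auto
    moreover have "finsum G f N \<in> carrier G" using insert by (intro G.finsum_closed) auto
    ultimately show ?case using insert by (simp add: add)
  qed
qed

lemma (in tensor_functor) map_pure:
  "r \<in> carrier R \<Longrightarrow> s \<in> carrier S \<Longrightarrow> TM (pure_tensor k \<phi> R \<psi> S r s) = pure_tensor k' \<phi>' R' \<psi>' S' (f r) (g s)"
  unfolding pure_tensor_def by (subst map_coset) (auto simp: pair_ring_simps)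

context field_algebra
begin

abbreviation "AT \<equiv> tensor_ring k \<phi> R \<phi> R"
abbreviation "apt \<equiv> pure_tensor k \<phi> R \<phi> R"
abbreviation "mu \<equiv> tlift k \<phi> R \<phi> R R (monoid.mult R)"

lemma square: "algebra_tensor k \<phi> R \<phi> R"
  by (rule algebra_tensor.intro) unfold_locales

interpretation AA: algebra_tensor k \<phi> R \<phi> R
  by (rule square)

lemma mult_balanced: "balanced k \<phi> R \<phi> R R (monoid.mult R)"
  unfolding balanced_def
  by (intro conjI ballI) (simp_all add: R.l_distr R.r_distr R.m_assoc R.m_lcomm)

lemmas mu_closed = AA.tlift_closed[OF R.abelian_group_axioms mult_balanced]
lemmas mu_add = AA.tlift_add[OF R.abelian_group_axioms mult_balanced]
lemmas mu_pure = AA.tlift_pure[OF R.abelian_group_axioms mult_balanced]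

lemma mu_mult:
  assumes x: "x \<in> carrier AT" and y: "y \<in> carrier AT"
  shows "mu (x \<otimes>\<^bsub>AT\<^esub> y) = mu x \<otimes> mu y"
  using x
proof (induction rule: AA.T_induct)
  case (pure r s)
  show ?case using y
  proof (induction rule: AA.T_induct)
    case (pure r' s')
    then show ?case using \<open>r \<in> carrier R\<close> \<open>s \<in> carrier R\<close>
      by (simp add: AA.pt_mult mu_pure R.m_assoc R.m_lcomm)
  next
    case (add x y)
    then show ?case using \<open>r \<in> carrier R\<close> \<open>s \<in> carrier R\<close>
      by (simp add: AA.ts.T.r_distr mu_add mu_closed R.r_distr)
  qed
next
  case (add x z)
  then show ?case using y by (simp add: AA.ts.T.l_distr mu_add mu_closed R.l_distr)
qed

lemma mu_one: "mu \<one>\<^bsub>AT\<^esub> = \<one>"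
  by (simp add: AA.pt_one[symmetric] mu_pure)

lemma mu_hom: "mu \<in> ring_hom AT R"
  by (rule ring_hom_memI) (auto simp: mu_closed mu_mult mu_add mu_one)

text \<open>Reduces the commutation condition of a separability idempotent to generators of the
  ring. For products the two factors are moved across \<open>u\<close> one after the other, by
  commutativity of the tensor product.\<close>

lemma commuting_subring:
  assumes u: "u \<in> carrier AT"
  shows "subring {x \<in> carrier R. apt x \<one> \<otimes>\<^bsub>AT\<^esub> u = apt \<one> x \<otimes>\<^bsub>AT\<^esub> u} R" (is "subring ?Z R")
proof (rule R.subringI)
  fix x y assume x: "x \<in> ?Z" and y: "y \<in> ?Z"
  show "\<ominus> x \<in> ?Z"
    using x u by (auto simp: AA.pt_minus AA.pt_minus_right AA.ts.T.l_minus)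
  show "x \<oplus> y \<in> ?Z"
    using x y u by (auto simp: AA.pt_addl AA.pt_addr AA.ts.T.l_distr)
  have xy: "x \<in> carrier R" "y \<in> carrier R" using x y by auto
  have "apt (x \<otimes> y) \<one> \<otimes>\<^bsub>AT\<^esub> u = apt x \<one> \<otimes>\<^bsub>AT\<^esub> (apt y \<one> \<otimes>\<^bsub>AT\<^esub> u)"
    using xy u by (simp add: AA.ts.T.m_assoc[symmetric] AA.pt_mult)
  also have "\<dots> = apt x \<one> \<otimes>\<^bsub>AT\<^esub> (apt \<one> y \<otimes>\<^bsub>AT\<^esub> u)"
    using y by simp
  also have "\<dots> = apt \<one> y \<otimes>\<^bsub>AT\<^esub> (apt x \<one> \<otimes>\<^bsub>AT\<^esub> u)"
    using xy u by (intro AA.ts.T.m_lcomm) auto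
  also have "\<dots> = apt \<one> y \<otimes>\<^bsub>AT\<^esub> (apt \<one> x \<otimes>\<^bsub>AT\<^esub> u)"
    using x by simp
  also have "\<dots> = apt \<one> (x \<otimes> y) \<otimes>\<^bsub>AT\<^esub> u"
    using xy u by (simp add: AA.ts.T.m_assoc[symmetric] AA.pt_mult R.m_comm[of y x])
  finally show "x \<otimes> y \<in> ?Z" using x y by simp
qed (use u in auto)

text \<open>Let the idempotent \<open>u\<close> involve finite sets \<open>A\<close> and
  \<open>B\<close> of left and right factors. Multiplying \<open>u\<close> by \<open>x\<close> on
  one side keeps the right factors in \<open>B\<close>, on the other side the left factors in
  \<open>A\<close>. Both give the same element, which therefore lies in \<open>sp A\<close>
  \<otimes> \<open>B\<close>, and multiplication maps it to \<open>x\<close>.\<close>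

lemma separable_finite:
  assumes "separable_algebra k \<phi> R"
  obtains F where "finite F" "F \<subseteq> carrier R" "carrier R = sp F"
proof -
  obtain u where u: "u \<in> carrier AT" "\<And>x. x \<in> carrier R \<Longrightarrow> apt x \<one> \<otimes>\<^bsub>AT\<^esub> u = apt \<one> x \<otimes>\<^bsub>AT\<^esub> u" "mu u = \<one>"
    using assms unfolding separable_algebra_def by blast
  have "u \<in> AA.tsp (carrier R) (carrier R)" using u(1) AA.tsp_carrier by simp
  then obtain A B where AB: "finite A" "finite B" "A \<subseteq> carrier R" "B \<subseteq> carrier R" "u \<in> AA.tsp A B"
    by (rule AA.tsp_finite)
  let ?F = "(\<lambda>(a, b). a \<otimes> b) ` (A \<times> B)"
  have FR: "?F \<subseteq> carrier R" using AB by auto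
  have "x \<in> sp ?F" if x: "x \<in> carrier R" for x
  proof -
    have left: "apt \<one> x \<otimes>\<^bsub>AT\<^esub> v \<in> AA.tsp A (carrier R)" if "v \<in> AA.tsp A B" for v
      using that
    proof (induction rule: tspan.induct)
      case zero then show ?case using x by (simp add: tspan.zero)
    next
      case (step r s v)
      then have "v \<in> carrier AT" "r \<in> carrier R" "s \<in> carrier R" using AB AA.tsp_closed by auto
      then have "apt \<one> x \<otimes>\<^bsub>AT\<^esub> (apt r s \<oplus>\<^bsub>AT\<^esub> v) = apt r (x \<otimes> s) \<oplus>\<^bsub>AT\<^esub> apt \<one> x \<otimes>\<^bsub>AT\<^esub> v"
        using x by (simp add: AA.ts.T.r_distr AA.pt_mult)
      then show ?case using step \<open>s \<in> carrier R\<close> x by (simp add: tspan.step)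
    qed
    have right: "apt x \<one> \<otimes>\<^bsub>AT\<^esub> v \<in> AA.tsp (carrier R) B" if "v \<in> AA.tsp A B" for v
      using that
    proof (induction rule: tspan.induct)
      case zero then show ?case using x by (simp add: tspan.zero)
    next
      case (step r s v)
      then have "v \<in> carrier AT" "r \<in> carrier R" "s \<in> carrier R" using AB AA.tsp_closed by auto
      then have "apt x \<one> \<otimes>\<^bsub>AT\<^esub> (apt r s \<oplus>\<^bsub>AT\<^esub> v) = apt (x \<otimes> r) s \<oplus>\<^bsub>AT\<^esub> apt x \<one> \<otimes>\<^bsub>AT\<^esub> v"
        using x by (simp add: AA.ts.T.r_distr AA.pt_mult)
      then show ?case using step \<open>r \<in> carrier R\<close> x by (simp add: tspan.step)
    qed
    define y where "y = apt x \<one> \<otimes>\<^bsub>AT\<^esub> u"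
    have yB: "y \<in> AA.tsp (carrier R) B" unfolding y_def by (rule right[OF AB(5)])
    have yA: "y \<in> AA.tsp A (carrier R)" unfolding y_def u(2)[OF x] by (rule left[OF AB(5)])
    \<comment> \<open>Left factors of \<open>y\<close> are chosen among its slices while the right
      factors stay in \<open>B\<close>; the slices lie in \<open>sp A\<close> by the other
      description of \<open>y\<close>.\<close>
    obtain W where W: "W \<subseteq> (\<lambda>\<xi>. AA.lslice \<xi> y) ` linear_forms k \<phi> R" "y \<in> AA.tsp W B"
      using yB by (rule AA.slice_support[OF AB(4)]) blast
    have "W \<subseteq> sp A" using W(1) AA.lslice_tsp[OF _ AB(3) subset_refl yA] by blast
    then have "y \<in> AA.tsp (sp A) B" using W(2) AA.tsp_mono by blast
    then have "mu y \<in> sp ?F"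
    proof (induction rule: tspan.induct)
      case zero
      have "mu \<zero>\<^bsub>AT\<^esub> = \<zero>"
        by (rule additive_zero[OF AA.ts.T.abelian_group_axioms R.abelian_group_axioms]) (auto simp: mu_closed mu_add)
      then show ?case by (simp add: lspan.zero)
    next
      case (step r s v)
      have r: "r \<in> carrier R" using step AB sp_closed by blast
      have s: "s \<in> carrier R" using step AB by blast
      have v: "v \<in> carrier AT" using step AA.tsp_closed[OF _ sp_subset] AB by blast
      have "r \<otimes> s \<in> sp ?F"
        using step.hyps(1)
      proof (induction rule: lspan.induct)
        case zero then show ?case using s by (simp add: lspan.zero)
      next
        case (step c a r)
        have *: "a \<in> carrier R" "r \<in> carrier R" using step AB sp_closed by blast+
        have "(\<phi> c \<otimes> a \<oplus> r) \<otimes> s = \<phi> c \<otimes> (a \<otimes> s) \<oplus> r \<otimes> s"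
          using * s step.hyps(1) by (simp add: R.l_distr R.m_assoc)
        moreover have "a \<otimes> s \<in> ?F" using step.hyps(2) \<open>s \<in> B\<close> by auto
        ultimately show ?case using step.hyps(1) step.IH by (simp add: lspan.step)
      qed
      then show ?case using step.IH r s v FR by (simp add: mu_add mu_pure sp_add)
    qed
    moreover have "mu y = x" unfolding y_def using x u by (simp add: mu_mult mu_pure)
    ultimately show ?thesis by simp
  qed
  then have "carrier R = sp ?F" using sp_subset[OF FR] by blast
  then show ?thesis using AB FR by (intro that[of ?F]) auto
qed

end

locale algebra_hom = A: field_algebra k \<phi> A + B: field_algebra k \<psi> B
  for k :: "('k, 'l) ring_scheme" and \<phi> :: "'k \<Rightarrow> 'a" and A :: "('a, 'm) ring_scheme"
    and \<psi> :: "'k \<Rightarrow> 'b" and B :: "('b, 'n) ring_scheme" +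
  fixes f
  assumes f_hom: "f \<in> ring_hom A B" and f_scalar: "\<And>a. a \<in> carrier k \<Longrightarrow> f (\<phi> a) = \<psi> a"
begin

lemmas f_simps = ring_hom_memE[OF f_hom]

text \<open>The idempotent is transported by f \<otimes> f. As \<open>f\<close> need not be
  surjective, it commutes with the image of \<open>f\<close> only.\<close>

lemma separable_image:
  assumes "separable_algebra k \<phi> A"
  obtains v where "v \<in> carrier B.AT" "B.mu v = \<one>\<^bsub>B\<^esub>"
    "\<And>x. x \<in> carrier A \<Longrightarrow> B.apt (f x) \<one>\<^bsub>B\<^esub> \<otimes>\<^bsub>B.AT\<^esub> v = B.apt \<one>\<^bsub>B\<^esub> (f x) \<otimes>\<^bsub>B.AT\<^esub> v"
proof -
  obtain u where u: "u \<in> carrier A.AT" "\<And>x. x \<in> carrier A \<Longrightarrow> A.apt x \<one>\<^bsub>A\<^esub> \<otimes>\<^bsub>A.AT\<^esub> u = A.apt \<one>\<^bsub>A\<^esub> x \<otimes>\<^bsub>A.AT\<^esub> u"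
    "A.mu u = \<one>\<^bsub>A\<^esub>"
    using assms unfolding separable_algebra_def by blast
  interpret AA: algebra_tensor k \<phi> A \<phi> A by (rule A.square)
  interpret BB: algebra_tensor k \<psi> B \<psi> B by (rule B.square)
  interpret F: tensor_functor k \<phi> A \<phi> A k \<psi> B \<psi> B id f f
    by (intro tensor_functor.intro tensor_functor_axioms.intro AA.ts.tensor_setup_axioms BB.ts.tensor_setup_axioms)
      (simp_all add: f_hom f_scalar)
  note TM = ring_hom_memE[OF F.map_hom]
  have mu: "B.mu (F.TM x) = f (A.mu x)" if "x \<in> carrier A.AT" for x
    using that
  proof (induction rule: AA.T_induct)
    case (pure r s) then show ?case by (simp add: F.map_pure B.mu_pure A.mu_pure f_simps)
  next
    case (add x y) then show ?case by (simp add: TM B.mu_add A.mu_add A.mu_closed f_simps)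
  qed
  show ?thesis
  proof (rule that[of "F.TM u"])
    fix x assume x: "x \<in> carrier A"
    have "F.TM (A.apt x \<one>\<^bsub>A\<^esub> \<otimes>\<^bsub>A.AT\<^esub> u) = F.TM (A.apt \<one>\<^bsub>A\<^esub> x \<otimes>\<^bsub>A.AT\<^esub> u)" using u(2)[OF x] by simp
    moreover have "F.TM (A.apt x \<one>\<^bsub>A\<^esub> \<otimes>\<^bsub>A.AT\<^esub> u) = B.apt (f x) \<one>\<^bsub>B\<^esub> \<otimes>\<^bsub>B.AT\<^esub> F.TM u"
      using x u(1) by (subst TM(2)) (simp_all add: F.map_pure f_simps)
    moreover have "F.TM (A.apt \<one>\<^bsub>A\<^esub> x \<otimes>\<^bsub>A.AT\<^esub> u) = B.apt \<one>\<^bsub>B\<^esub> (f x) \<otimes>\<^bsub>B.AT\<^esub> F.TM u"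
      using x u(1) by (subst TM(2)) (simp_all add: F.map_pure f_simps)
    ultimately show "B.apt (f x) \<one>\<^bsub>B\<^esub> \<otimes>\<^bsub>B.AT\<^esub> F.TM u = B.apt \<one>\<^bsub>B\<^esub> (f x) \<otimes>\<^bsub>B.AT\<^esub> F.TM u"
      by simp
  qed (use u mu TM f_simps in auto)
qed

end

text \<open>The product of the two transported idempotents commutes with both images and still
  multiplies out to \<open>1\<close>. By \<open>commuting_subring\<close> it then commutes with
  everything that the images generate.\<close>

lemma separable_generated:
  assumes f: "algebra_hom k \<phi> A \<theta> D f" and g: "algebra_hom k \<psi> B \<theta> D g"
    and A: "separable_algebra k \<phi> A" and B: "separable_algebra k \<psi> B"
    and gen: "\<And>Z. subring Z D \<Longrightarrow> f ` carrier A \<subseteq> Z \<Longrightarrow> g ` carrier B \<subseteq> Z \<Longrightarrow> carrier D \<subseteq> Z"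
  shows "separable_algebra k \<theta> D"
proof -
  interpret f: algebra_hom k \<phi> A \<theta> D f by fact
  interpret g: algebra_hom k \<psi> B \<theta> D g by fact
  interpret DD: algebra_tensor k \<theta> D \<theta> D by (rule f.B.square)
  obtain v where v: "v \<in> carrier f.B.AT" "f.B.mu v = \<one>\<^bsub>D\<^esub>"
    "\<And>x. x \<in> carrier A \<Longrightarrow> f.B.apt (f x) \<one>\<^bsub>D\<^esub> \<otimes>\<^bsub>f.B.AT\<^esub> v = f.B.apt \<one>\<^bsub>D\<^esub> (f x) \<otimes>\<^bsub>f.B.AT\<^esub> v"
    by (rule f.separable_image[OF A]) blast
  obtain w where w: "w \<in> carrier f.B.AT" "f.B.mu w = \<one>\<^bsub>D\<^esub>"
    "\<And>x. x \<in> carrier B \<Longrightarrow> f.B.apt (g x) \<one>\<^bsub>D\<^esub> \<otimes>\<^bsub>f.B.AT\<^esub> w = f.B.apt \<one>\<^bsub>D\<^esub> (g x) \<otimes>\<^bsub>f.B.AT\<^esub> w"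
    by (rule g.separable_image[OF B]) blast
  define u where "u = v \<otimes>\<^bsub>f.B.AT\<^esub> w"
  have u: "u \<in> carrier f.B.AT" using v w by (simp add: u_def)
  have fu: "f.B.apt (f x) \<one>\<^bsub>D\<^esub> \<otimes>\<^bsub>f.B.AT\<^esub> u = f.B.apt \<one>\<^bsub>D\<^esub> (f x) \<otimes>\<^bsub>f.B.AT\<^esub> u" if "x \<in> carrier A" for x
    using v w that f.f_simps(1)[OF that] unfolding u_def
    by (simp add: DD.ts.T.m_assoc[symmetric])
  have gu: "f.B.apt (g x) \<one>\<^bsub>D\<^esub> \<otimes>\<^bsub>f.B.AT\<^esub> u = f.B.apt \<one>\<^bsub>D\<^esub> (g x) \<otimes>\<^bsub>f.B.AT\<^esub> u" if "x \<in> carrier B" for x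
    using v(1) w(1) w(3)[OF that] g.f_simps(1)[OF that] unfolding u_def
    by (simp add: DD.ts.T.m_lcomm[of _ v w])
  let ?Z = "{x \<in> carrier D. f.B.apt x \<one>\<^bsub>D\<^esub> \<otimes>\<^bsub>f.B.AT\<^esub> u = f.B.apt \<one>\<^bsub>D\<^esub> x \<otimes>\<^bsub>f.B.AT\<^esub> u}"
  have "carrier D \<subseteq> ?Z"
    by (rule gen[OF f.B.commuting_subring[OF u]]) (use fu gu f.f_simps(1) g.f_simps(1) in auto)
  moreover have "f.B.mu u = \<one>\<^bsub>D\<^esub>" using v w by (simp add: u_def f.B.mu_mult)
  ultimately show ?thesis using u unfolding separable_algebra_def by blast
qed

section \<open>Algebras split by a field extension are separable\<close>

lemma RDirProd_list_Cons:
  assumes "x \<in> carrier C" "y \<in> carrier C" "xs \<in> carrier (RDirProd_list Cs)" "ys \<in> carrier (RDirProd_list Cs)"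
  shows "(x # xs) \<otimes>\<^bsub>RDirProd_list (C # Cs)\<^esub> (y # ys) = (x \<otimes>\<^bsub>C\<^esub> y) # (xs \<otimes>\<^bsub>RDirProd_list Cs\<^esub> ys)"
    and "(x # xs) \<oplus>\<^bsub>RDirProd_list (C # Cs)\<^esub> (y # ys) = (x \<oplus>\<^bsub>C\<^esub> y) # (xs \<oplus>\<^bsub>RDirProd_list Cs\<^esub> ys)"
proof -
  note h = ring_hom_memE[OF RDirProd_list_hom1[of C Cs]]
  have *: "(x, xs) \<in> carrier (RDirProd C (RDirProd_list Cs))" "(y, ys) \<in> carrier (RDirProd C (RDirProd_list Cs))"
    using assms by (auto simp: RDirProd_carrier)
  show "(x # xs) \<otimes>\<^bsub>RDirProd_list (C # Cs)\<^esub> (y # ys) = (x \<otimes>\<^bsub>C\<^esub> y) # (xs \<otimes>\<^bsub>RDirProd_list Cs\<^esub> ys)"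
    using h(2)[OF *] by (simp add: RDirProd_def DirProd_def monoid.defs)
  show "(x # xs) \<oplus>\<^bsub>RDirProd_list (C # Cs)\<^esub> (y # ys) = (x \<oplus>\<^bsub>C\<^esub> y) # (xs \<oplus>\<^bsub>RDirProd_list Cs\<^esub> ys)"
    using h(3)[OF *] by (simp add: RDirProd_def DirProd_def monoid.defs)
qed

lemma RDirProd_list_replicate:
  "carrier (RDirProd_list (replicate n C)) = {xs. length xs = n \<and> set xs \<subseteq> carrier C}"
  "\<one>\<^bsub>RDirProd_list (replicate n C)\<^esub> = replicate n \<one>\<^bsub>C\<^esub>"
proof -
  show "carrier (RDirProd_list (replicate n C)) = {xs. length xs = n \<and> set xs \<subseteq> carrier C}"
  proof (induction n)
    case (Suc n)
    then show ?case by (auto simp: RDirProd_list_carrier length_Suc_conv)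
  qed auto
  show "\<one>\<^bsub>RDirProd_list (replicate n C)\<^esub> = replicate n \<one>\<^bsub>C\<^esub>"
    unfolding RDirProd_list_one by (induction n) auto
qed

lemma RDirProd_list_replicate_ops:
  assumes "xs \<in> carrier (RDirProd_list (replicate n C))" "ys \<in> carrier (RDirProd_list (replicate n C))"
  shows "xs \<otimes>\<^bsub>RDirProd_list (replicate n C)\<^esub> ys = map2 (monoid.mult C) xs ys"
    and "xs \<oplus>\<^bsub>RDirProd_list (replicate n C)\<^esub> ys = map2 (ring.add C) xs ys"
proof -
  have "xs \<otimes>\<^bsub>RDirProd_list (replicate n C)\<^esub> ys = map2 (monoid.mult C) xs ys \<and>
      xs \<oplus>\<^bsub>RDirProd_list (replicate n C)\<^esub> ys = map2 (ring.add C) xs ys"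
    using assms
  proof (induction n arbitrary: xs ys)
    case (Suc n)
    then obtain x xs' y ys' where "xs = x # xs'" "ys = y # ys'" "x \<in> carrier C" "y \<in> carrier C"
      "xs' \<in> carrier (RDirProd_list (replicate n C))" "ys' \<in> carrier (RDirProd_list (replicate n C))"
      by (auto simp: RDirProd_list_carrier)
    then show ?case using Suc.IH by (simp add: RDirProd_list_Cons)
  qed (auto simp: monoid.defs)
  then show "xs \<otimes>\<^bsub>RDirProd_list (replicate n C)\<^esub> ys = map2 (monoid.mult C) xs ys"
    and "xs \<oplus>\<^bsub>RDirProd_list (replicate n C)\<^esub> ys = map2 (ring.add C) xs ys" by auto
qed

text \<open>With \<epsilon> i the primitive idempotents of R \<otimes> S, the sum of all \<epsilon>
  i \<otimes> \<epsilon> i is a separability idempotent over \<open>S\<close>. It lives in R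
  \<otimes> R \<otimes> S, and a \<open>k\<close>-linear projection from \<open>S\<close> to
  \<open>k\<close> brings it down to R \<otimes> R. The two defining conditions survive because the
  projection is linear over R \<otimes> R and preserves \<open>1\<close>.\<close>

lemma (in algebra_tensor) separable_of_split:
  assumes S: "field S"
    and h: "h \<in> ring_iso T (RDirProd_list (replicate n S))"
    and diag: "\<And>c. c \<in> carrier S \<Longrightarrow> h (pt \<one>\<^bsub>R\<^esub> c) = replicate n c"
  shows "separable_algebra k \<phi> R"
proof -
  interpret S: field S by fact
  interpret AA: algebra_tensor k \<phi> R \<phi> R by (rule R.square)
  let ?D = "RDirProd_list (replicate n S)"
  note D = RDirProd_list_replicate[of n S]
  have hh: "h \<in> ring_hom T ?D" and bij: "bij_betw h (carrier T) (carrier ?D)"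
    using h by (auto simp: ring_iso_def)
  note h_simps = ring_hom_memE[OF hh]
  have h_len: "length (h x) = n" "set (h x) \<subseteq> carrier S" if "x \<in> carrier T" for x
    using h_simps(1)[OF that] by (auto simp: D)
  have h_nth: "h x ! i \<in> carrier S" if "x \<in> carrier T" "i < n" for x i
    using h_len[OF that(1)] that(2) by (auto simp: subset_iff in_set_conv_nth)
  define e where "e i = map (\<lambda>j. if i = j then \<one>\<^bsub>S\<^esub> else \<zero>\<^bsub>S\<^esub>) [0..<n]" for i
  have e: "e i \<in> carrier ?D" for i by (auto simp: D e_def)
  define \<epsilon> where "\<epsilon> i = inv_into (carrier T) h (e i)" for i
  have eps: "\<epsilon> i \<in> carrier T" "h (\<epsilon> i) = e i" for i
    using e[of i] bij by (auto simp: \<epsilon>_def bij_betw_def inv_into_into f_inv_into_f)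
  have inj: "x = y" if "h x = h y" "x \<in> carrier T" "y \<in> carrier T" for x y
    using that bij by (auto simp: bij_betw_def inj_on_def)
  have h_mult: "h (x \<otimes>\<^bsub>T\<^esub> y) = map2 (monoid.mult S) (h x) (h y)" if "x \<in> carrier T" "y \<in> carrier T" for x y
    using that RDirProd_list_replicate_ops(1)[of "h x" n S "h y"] by (simp add: h_simps(1,2))
  have h_add: "h (x \<oplus>\<^bsub>T\<^esub> y) = map2 (ring.add S) (h x) (h y)" if "x \<in> carrier T" "y \<in> carrier T" for x y
    using that RDirProd_list_replicate_ops(2)[of "h x" n S "h y"] by (simp add: h_simps(1,3))
  have eps_idem: "\<epsilon> i \<otimes>\<^bsub>T\<^esub> \<epsilon> i = \<epsilon> i" for i
    by (rule inj) (auto simp: eps h_mult e_def intro!: nth_equalityI)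
  \<comment> \<open>The scalar by which x \<otimes> 1 acts on the \<open>i\<close>-th
    idempotent.\<close>
  define \<chi> where "\<chi> i x = h (pt x \<one>\<^bsub>S\<^esub>) ! i" for i x
  have chi: "\<chi> i x \<in> carrier S" if "x \<in> carrier R" "i < n" for i x
    unfolding \<chi>_def by (rule h_nth) (use that in auto)
  have chi_eps: "pt x \<one>\<^bsub>S\<^esub> \<otimes>\<^bsub>T\<^esub> \<epsilon> i = pt \<one>\<^bsub>R\<^esub> (\<chi> i x) \<otimes>\<^bsub>T\<^esub> \<epsilon> i" if x: "x \<in> carrier R" and i: "i < n" for x i
  proof (rule inj)
    have "h (pt x \<one>\<^bsub>S\<^esub>) ! j \<in> carrier S" if "j < n" for j using h_nth[of "pt x \<one>\<^bsub>S\<^esub>" j] that x by simp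
    then show "h (pt x \<one>\<^bsub>S\<^esub> \<otimes>\<^bsub>T\<^esub> \<epsilon> i) = h (pt \<one>\<^bsub>R\<^esub> (\<chi> i x) \<otimes>\<^bsub>T\<^esub> \<epsilon> i)"
      using x i chi[OF x i] h_len(1)[of "pt x \<one>\<^bsub>S\<^esub>"]
      by (auto simp: h_mult eps diag e_def \<chi>_def intro!: nth_equalityI)
  qed (use x chi[OF x i] eps in auto)
  have sum_eps: "(\<Oplus>\<^bsub>T\<^esub>i\<in>{..<n}. \<epsilon> i) = \<one>\<^bsub>T\<^esub>"
  proof (rule inj)
    have "m \<le> n \<Longrightarrow> (\<Oplus>\<^bsub>T\<^esub>i\<in>{..<m}. \<epsilon> i) \<in> carrier T \<and>
        h (\<Oplus>\<^bsub>T\<^esub>i\<in>{..<m}. \<epsilon> i) = map (\<lambda>j. if j < m then \<one>\<^bsub>S\<^esub> else \<zero>\<^bsub>S\<^esub>) [0..<n]" for m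
    proof (induction m)
      case 0
      have "h \<zero>\<^bsub>T\<^esub> = h (pt \<one>\<^bsub>R\<^esub> \<zero>\<^bsub>S\<^esub>)" by (simp add: pt_zero_right)
      also have "\<dots> = replicate n \<zero>\<^bsub>S\<^esub>" by (simp add: diag)
      finally show ?case by (auto intro!: nth_equalityI)
    next
      case (Suc m)
      have "(\<Oplus>\<^bsub>T\<^esub>i\<in>{..<Suc m}. \<epsilon> i) = \<epsilon> m \<oplus>\<^bsub>T\<^esub> (\<Oplus>\<^bsub>T\<^esub>i\<in>{..<m}. \<epsilon> i)"
        unfolding lessThan_Suc by (rule ts.T.finsum_insert) (auto simp: eps)
      then show ?case using Suc eps
        by (auto simp: h_add e_def intro!: nth_equalityI)
    qed
    from this[of n] show "h (\<Oplus>\<^bsub>T\<^esub>i\<in>{..<n}. \<epsilon> i) = h \<one>\<^bsub>T\<^esub>"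
      by (auto simp: h_simps(4) D intro!: nth_equalityI)
  qed (auto simp: eps)
  have "\<one>\<^bsub>S\<^esub> \<notin> S.sp {}"
  proof
    assume "\<one>\<^bsub>S\<^esub> \<in> S.sp {}"
    then have "\<one>\<^bsub>S\<^esub> = \<zero>\<^bsub>S\<^esub>" by cases auto
    then show False by simp
  qed
  \<comment> \<open>The projection from \<open>S\<close> to \<open>k\<close>. The normalization at
    \<open>1\<close> makes the product of \<open>u\<close> equal to \<open>1\<close> in the
    end.\<close>
  then obtain \<pi> where \<pi>: "\<pi> \<in> linear_forms k \<psi> S" "\<pi> \<one>\<^bsub>S\<^esub> = \<one>\<^bsub>k\<^esub>"
    using S.linear_form_exists[of "{}" "\<one>\<^bsub>S\<^esub>"] by auto
  note lc = lslice_closed[OF \<pi>(1)] and la = lslice_add[OF \<pi>(1)] and lm = lslice_mult_left[OF \<pi>(1)]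
  \<comment> \<open>In R \<otimes> R \<otimes> S, let the \<open>R\<close>-part of \<open>y\<close>
    occupy the first place and that of \<open>e\<close> the second, with \<open>S\<close> shared.
    The product of the two, projected by \<pi>, is \<open>\<Psi> e y\<close>.\<close>
  define \<Psi> where "\<Psi> e = lift AA.T (\<lambda>a c. AA.pt a (lslice \<pi> (pt \<one>\<^bsub>R\<^esub> c \<otimes>\<^bsub>T\<^esub> e)))" for e
  have bal: "balanced k \<phi> R \<psi> S AA.T (\<lambda>a c. AA.pt a (lslice \<pi> (pt \<one>\<^bsub>R\<^esub> c \<otimes>\<^bsub>T\<^esub> e)))" if e: "e \<in> carrier T" for e
  proof -
    have 1: "lslice \<pi> (pt \<one>\<^bsub>R\<^esub> c \<otimes>\<^bsub>T\<^esub> e) \<in> carrier R" if "c \<in> carrier S" for c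
      using that e by (intro lc) auto
    have 2: "lslice \<pi> (pt \<one>\<^bsub>R\<^esub> (c \<oplus>\<^bsub>S\<^esub> d) \<otimes>\<^bsub>T\<^esub> e) =
        lslice \<pi> (pt \<one>\<^bsub>R\<^esub> c \<otimes>\<^bsub>T\<^esub> e) \<oplus>\<^bsub>R\<^esub> lslice \<pi> (pt \<one>\<^bsub>R\<^esub> d \<otimes>\<^bsub>T\<^esub> e)" if "c \<in> carrier S" "d \<in> carrier S" for c d
      using that e by (simp add: pt_addr ts.T.l_distr la)
    have 3: "lslice \<pi> (pt \<one>\<^bsub>R\<^esub> (\<psi> a \<otimes>\<^bsub>S\<^esub> c) \<otimes>\<^bsub>T\<^esub> e) = \<phi> a \<otimes>\<^bsub>R\<^esub> lslice \<pi> (pt \<one>\<^bsub>R\<^esub> c \<otimes>\<^bsub>T\<^esub> e)"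
      if "a \<in> carrier k" "c \<in> carrier S" for a c
    proof -
      have "pt \<one>\<^bsub>R\<^esub> (\<psi> a \<otimes>\<^bsub>S\<^esub> c) = pt (\<phi> a) \<one>\<^bsub>S\<^esub> \<otimes>\<^bsub>T\<^esub> pt \<one>\<^bsub>R\<^esub> c"
        using that by (simp add: scalar_right pt_mult)
      then show ?thesis using that e by (simp add: ts.T.m_assoc lm)
    qed
    show ?thesis
      unfolding balanced_def
      by (intro conjI ballI) (simp_all add: 1 2 3 AA.pt_addl AA.pt_addr AA.pt_balance)
  qed
  note Pc = tlift_closed[OF AA.ts.T.abelian_group_axioms bal, folded \<Psi>_def]
    and Pa = tlift_add[OF AA.ts.T.abelian_group_axioms bal, folded \<Psi>_def]
    and Pp = tlift_pure[OF AA.ts.T.abelian_group_axioms bal, folded \<Psi>_def]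
  have left: "AA.pt x \<one>\<^bsub>R\<^esub> \<otimes>\<^bsub>AA.T\<^esub> \<Psi> e y = \<Psi> e (pt x \<one>\<^bsub>S\<^esub> \<otimes>\<^bsub>T\<^esub> y)"
    if x: "x \<in> carrier R" and e: "e \<in> carrier T" and y: "y \<in> carrier T" for x e y
    using y
  proof (induction rule: T_induct)
    case (pure r s)
    moreover have "lslice \<pi> (pt \<one>\<^bsub>R\<^esub> s \<otimes>\<^bsub>T\<^esub> e) \<in> carrier R" using pure e by (intro lc) auto
    ultimately show ?case using x e by (simp add: pt_mult Pp AA.pt_mult)
  next
    case (add y z) then show ?case using x e by (simp add: ts.T.r_distr Pa Pc AA.ts.T.r_distr)
  qed
  \<comment> \<open>On \<open>e\<close> the action of \<open>x\<close> in the second place equals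
    that of the scalar \<open>d\<close>, and since \<open>S\<close> is shared, \<open>d\<close> can
    equally well act on \<open>y\<close>.\<close>
  have right: "AA.pt \<one>\<^bsub>R\<^esub> x \<otimes>\<^bsub>AA.T\<^esub> \<Psi> e y = \<Psi> e (pt \<one>\<^bsub>R\<^esub> d \<otimes>\<^bsub>T\<^esub> y)"
    if x: "x \<in> carrier R" and e: "e \<in> carrier T" and y: "y \<in> carrier T" and d: "d \<in> carrier S"
      and eq: "pt x \<one>\<^bsub>S\<^esub> \<otimes>\<^bsub>T\<^esub> e = pt \<one>\<^bsub>R\<^esub> d \<otimes>\<^bsub>T\<^esub> e" for x e y d
    using y
  proof (induction rule: T_induct)
    case (pure r s)
    have l: "lslice \<pi> (pt \<one>\<^bsub>R\<^esub> s \<otimes>\<^bsub>T\<^esub> e) \<in> carrier R" using pure e by (intro lc) auto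
    have "x \<otimes>\<^bsub>R\<^esub> lslice \<pi> (pt \<one>\<^bsub>R\<^esub> s \<otimes>\<^bsub>T\<^esub> e) = lslice \<pi> (pt \<one>\<^bsub>R\<^esub> s \<otimes>\<^bsub>T\<^esub> (pt x \<one>\<^bsub>S\<^esub> \<otimes>\<^bsub>T\<^esub> e))"
      using pure x e by (subst lm[symmetric]) (auto simp: ts.T.m_lcomm)
    also have "\<dots> = lslice \<pi> (pt \<one>\<^bsub>R\<^esub> (d \<otimes>\<^bsub>S\<^esub> s) \<otimes>\<^bsub>T\<^esub> e)"
      unfolding eq using pure d e by (simp add: ts.T.m_assoc[symmetric] pt_mult S.R.m_comm)
    finally show ?case using pure x e d l by (simp add: pt_mult Pp AA.pt_mult)
  next
    case (add y z) then show ?case using x e d by (simp add: ts.T.r_distr Pa Pc AA.ts.T.r_distr)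
  qed
  have mu: "R.mu (\<Psi> e y) = lslice \<pi> (y \<otimes>\<^bsub>T\<^esub> e)" if e: "e \<in> carrier T" and y: "y \<in> carrier T" for e y
    using y
  proof (induction rule: T_induct)
    case (pure r s)
    have l: "lslice \<pi> (pt \<one>\<^bsub>R\<^esub> s \<otimes>\<^bsub>T\<^esub> e) \<in> carrier R" using pure e by (intro lc) auto
    have "r \<otimes>\<^bsub>R\<^esub> lslice \<pi> (pt \<one>\<^bsub>R\<^esub> s \<otimes>\<^bsub>T\<^esub> e) = lslice \<pi> (pt r s \<otimes>\<^bsub>T\<^esub> e)"
      using pure e by (subst lm[symmetric]) (auto simp: ts.T.m_assoc[symmetric] pt_mult)
    then show ?case using pure e l by (simp add: Pp R.mu_pure)
  next
    case (add y z) then show ?case using e by (simp add: ts.T.l_distr Pa Pc R.mu_add la)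
  qed
  \<comment> \<open>Its product is the slice of the sum of the squares of the idempotents, hence the
    slice of \<open>1\<close>.\<close>
  define u where "u = (\<Oplus>\<^bsub>AA.T\<^esub>i\<in>{..<n}. \<Psi> (\<epsilon> i) (\<epsilon> i))"
  have Pe: "\<Psi> (\<epsilon> i) (\<epsilon> i) \<in> carrier AA.T" for i using Pc eps by blast
  have u: "u \<in> carrier AA.T" unfolding u_def by (rule AA.ts.T.finsum_closed) (use Pe in auto)
  have "AA.pt x \<one>\<^bsub>R\<^esub> \<otimes>\<^bsub>AA.T\<^esub> u = AA.pt \<one>\<^bsub>R\<^esub> x \<otimes>\<^bsub>AA.T\<^esub> u" if x: "x \<in> carrier R" for x
  proof -
    have "AA.pt x \<one>\<^bsub>R\<^esub> \<otimes>\<^bsub>AA.T\<^esub> \<Psi> (\<epsilon> i) (\<epsilon> i) = AA.pt \<one>\<^bsub>R\<^esub> x \<otimes>\<^bsub>AA.T\<^esub> \<Psi> (\<epsilon> i) (\<epsilon> i)" if i: "i < n" for i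
      using left[OF x eps(1) eps(1), of i i] right[OF x eps(1) eps(1) chi[OF x i] chi_eps[OF x i]] chi_eps[OF x i] by simp
    then have "(\<Oplus>\<^bsub>AA.T\<^esub>i\<in>{..<n}. AA.pt x \<one>\<^bsub>R\<^esub> \<otimes>\<^bsub>AA.T\<^esub> \<Psi> (\<epsilon> i) (\<epsilon> i)) =
        (\<Oplus>\<^bsub>AA.T\<^esub>i\<in>{..<n}. AA.pt \<one>\<^bsub>R\<^esub> x \<otimes>\<^bsub>AA.T\<^esub> \<Psi> (\<epsilon> i) (\<epsilon> i))"
      using x Pe by (intro AA.ts.T.finsum_cong') auto
    then show ?thesis
      unfolding u_def using x Pe by (subst (1 2) AA.ts.T.finsum_rdistr) auto
  qed
  moreover have "R.mu u = \<one>\<^bsub>R\<^esub>"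
  proof -
    have "R.mu u = (\<Oplus>\<^bsub>R\<^esub>i\<in>{..<n}. R.mu (\<Psi> (\<epsilon> i) (\<epsilon> i)))"
      unfolding u_def
      by (rule additive_finsum[OF AA.ts.T.abelian_group_axioms R.R.abelian_group_axioms])
        (use Pe in \<open>auto simp: R.mu_closed R.mu_add\<close>)
    also have "\<dots> = (\<Oplus>\<^bsub>R\<^esub>i\<in>{..<n}. lslice \<pi> (\<epsilon> i))" by (simp add: mu eps eps_idem)
    also have "\<dots> = lslice \<pi> (\<Oplus>\<^bsub>T\<^esub>i\<in>{..<n}. \<epsilon> i)"
      by (rule additive_finsum[OF ts.T.abelian_group_axioms R.R.abelian_group_axioms, symmetric])
        (use eps in \<open>auto simp: lc la\<close>)
    also have "\<dots> = \<one>\<^bsub>R\<^esub>"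
      unfolding sum_eps using lslice_pure[OF \<pi>(1), of "\<one>\<^bsub>R\<^esub>" "\<one>\<^bsub>S\<^esub>"] by (simp add: pt_one \<pi>(2) R.hom_simps)
    finally show ?thesis .
  qed
  ultimately show ?thesis using u unfolding separable_algebra_def by blast
qed


section \<open>Etale algebras are the separable ones\<close>

text \<open>Coefficients are listed from the constant term upwards, in contrast to \<open>ring.eval\<close>.\<close>

fun peval :: "('a, 'm) ring_scheme \<Rightarrow> 'a list \<Rightarrow> 'a \<Rightarrow> 'a" where
  "peval A [] x = \<zero>\<^bsub>A\<^esub>"
| "peval A (c # cs) x = c \<oplus>\<^bsub>A\<^esub> x \<otimes>\<^bsub>A\<^esub> peval A cs x"

text \<open>Synthetic division by the linear polynomial with root \<open>z\<close>: the coefficients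
  of the quotient are the values at \<open>z\<close> of the proper tails of the coefficient list.
  The remainder, the value of the whole list at \<open>z\<close>, is left out.\<close>

fun pdivide :: "('a, 'm) ring_scheme \<Rightarrow> 'a list \<Rightarrow> 'a \<Rightarrow> 'a list" where
  "pdivide A [] z = []"
| "pdivide A (c # cs) z = (if cs = [] then [] else peval A cs z # pdivide A cs z)"

lemma peval_hom:
  assumes "cring A" "cring B" "h \<in> ring_hom A B" "set cs \<subseteq> carrier A" "x \<in> carrier A"
  shows "peval A cs x \<in> carrier A \<and> peval B (map h cs) (h x) = h (peval A cs x)"
proof -
  interpret A: cring A by fact
  interpret B: cring B by fact
  show ?thesis
    using assms(4)
    by (induction cs) (auto simp: ring_hom_zero[OF assms(3) A.ring_axioms B.ring_axioms]
        ring_hom_memE[OF assms(3)] assms(5))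
qed

context cring
begin

lemma peval_closed: "set cs \<subseteq> carrier R \<Longrightarrow> x \<in> carrier R \<Longrightarrow> peval R cs x \<in> carrier R"
  by (induction cs) auto

lemma pdivide_closed: "set cs \<subseteq> carrier R \<Longrightarrow> z \<in> carrier R \<Longrightarrow> set (pdivide R cs z) \<subseteq> carrier R"
  by (induction cs) (auto simp: peval_closed)

lemma peval_snoc:
  "set cs \<subseteq> carrier R \<Longrightarrow> a \<in> carrier R \<Longrightarrow> x \<in> carrier R \<Longrightarrow>
    peval R (cs @ [a]) x = peval R cs x \<oplus> a \<otimes> x [^] length cs"
  by (induction cs) (auto simp: peval_closed r_distr a_assoc m_ac)

lemma peval_diff:
  assumes "set cs \<subseteq> carrier R" "x \<in> carrier R" "z \<in> carrier R"
  shows "peval R cs x \<ominus> peval R cs z = (x \<ominus> z) \<otimes> peval R (pdivide R cs z) x"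
  using assms(1)
proof (induction cs)
  case Nil
  then show ?case using assms by (simp add: a_minus_def)
next
  case (Cons c cs)
  let ?p = "peval R cs x" and ?q = "peval R cs z" and ?d = "peval R (pdivide R cs z) x"
  have cl: "c \<in> carrier R" "?p \<in> carrier R" "?q \<in> carrier R" "?d \<in> carrier R"
    using Cons.prems assms pdivide_closed[of cs z] by (auto intro!: peval_closed)
  have "(c \<oplus> x \<otimes> ?p) \<ominus> (c \<oplus> z \<otimes> ?q) = x \<otimes> (?p \<ominus> ?q) \<oplus> (x \<ominus> z) \<otimes> ?q"
    using cl assms(2,3) by algebra
  also have "\<dots> = (x \<ominus> z) \<otimes> (?q \<oplus> x \<otimes> ?d)"
    using Cons cl assms(2,3) by (simp, algebra)
  finally show ?case using assms(2,3) cl by (cases cs) (auto simp: a_minus_def r_neg)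
qed

lemma pdivide_monic:
  assumes "cs \<noteq> []" "set cs \<subseteq> carrier R" "z \<in> carrier R"
  obtains ds where "length ds = length cs - 1" "set ds \<subseteq> carrier R" "pdivide R (cs @ [\<one>]) z = ds @ [\<one>]"
proof -
  have "\<exists>ds. length ds = length cs - 1 \<and> set ds \<subseteq> carrier R \<and> pdivide R (cs @ [\<one>]) z = ds @ [\<one>]"
    using assms
  proof (induction cs)
    case (Cons c cs)
    show ?case
    proof (cases "cs = []")
      case True
      then show ?thesis using assms(3) by auto
    next
      case False
      then obtain ds where ds: "length ds = length cs - 1" "set ds \<subseteq> carrier R" "pdivide R (cs @ [\<one>]) z = ds @ [\<one>]"
        using Cons by auto
      have "peval R (cs @ [\<one>]) z \<in> carrier R" using Cons.prems by (intro peval_closed) auto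
      then show ?thesis using ds False by (intro exI[of _ "peval R (cs @ [\<one>]) z # ds"]) auto
    qed
  qed simp
  then show ?thesis using that by blast
qed

lemma maximal_ideal_exists:
  assumes E: "ideal E R" "\<one> \<notin> E"
  obtains M where "maximalideal M R" "E \<subseteq> M"
proof -
  define \<A> where "\<A> = {J. ideal J R \<and> E \<subseteq> J \<and> \<one> \<notin> J}"
  have "\<A> \<noteq> {}" using E by (auto simp: \<A>_def)
  moreover have "\<Union>\<C> \<in> \<A>" if C: "\<C> \<noteq> {}" "subset.chain \<A> \<C>" for \<C>
  proof -
    have CA: "J \<in> \<A>" if "J \<in> \<C>" for J using C(2) that by (auto simp: subset_chain_def)
    have id: "ideal J R" if "J \<in> \<C>" for J using CA[OF that] by (simp add: \<A>_def)
    have "ideal (\<Union>\<C>) R"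
    proof (rule idealI[OF ring_axioms])
      show "subgroup (\<Union>\<C>) (add_monoid R)"
      proof (rule add.subgroupI)
        show "\<Union>\<C> \<subseteq> carrier R" using ideal.Icarr[OF id] by blast
        obtain J0 where "J0 \<in> \<C>" using C(1) by blast
        then have "\<zero> \<in> J0" using additive_subgroup.zero_closed[OF ideal.axioms(1)[OF id]] by simp
        then show "\<Union>\<C> \<noteq> {}" using \<open>J0 \<in> \<C>\<close> by blast
        fix a assume "a \<in> \<Union>\<C>"
        then obtain I where "a \<in> I" "I \<in> \<C>" by blast
        then have "\<ominus> a \<in> I" using additive_subgroup.a_inv_closed[OF ideal.axioms(1)[OF id]] by simp
        then show "\<ominus> a \<in> \<Union>\<C>" using \<open>I \<in> \<C>\<close> by blast
        fix b assume "b \<in> \<Union>\<C>"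
        then obtain I J where IJ: "a \<in> I" "I \<in> \<C>" "b \<in> J" "J \<in> \<C>" using \<open>a \<in> \<Union>\<C>\<close> by blast
        then have "I \<subseteq> J \<or> J \<subseteq> I" using C(2) by (auto simp: subset_chain_def)
        then obtain K where "a \<in> K" "b \<in> K" "K \<in> \<C>" using IJ by blast
        then have "a \<oplus> b \<in> K" using additive_subgroup.a_closed[OF ideal.axioms(1)[OF id]] by simp
        then show "a \<oplus> b \<in> \<Union>\<C>" using \<open>K \<in> \<C>\<close> by blast
      qed
    next
      fix a x assume a: "a \<in> \<Union>\<C>" and x: "x \<in> carrier R"
      obtain I where I: "a \<in> I" "I \<in> \<C>" using a by blast
      then have "x \<otimes> a \<in> I" "a \<otimes> x \<in> I"
        using x ideal.I_l_closed[OF id] ideal.I_r_closed[OF id] by auto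
      then show "x \<otimes> a \<in> \<Union>\<C>" "a \<otimes> x \<in> \<Union>\<C>" using I by blast+
    qed
    moreover have "E \<subseteq> \<Union>\<C>" using C(1) CA by (auto simp: \<A>_def)
    moreover have "\<one> \<notin> \<Union>\<C>" using CA by (auto simp: \<A>_def)
    ultimately show ?thesis by (simp add: \<A>_def)
  qed
  ultimately obtain M where M: "M \<in> \<A>" and max: "\<And>J. J \<in> \<A> \<Longrightarrow> M \<subseteq> J \<Longrightarrow> J = M"
    using subset_Zorn_nonempty[of \<A>] by blast
  have "maximalideal M R"
  proof (rule maximalidealI)
    show "ideal M R" using M by (simp add: \<A>_def)
    show "carrier R \<noteq> M" using M by (auto simp: \<A>_def)
    fix J assume J: "ideal J R" "M \<subseteq> J" "J \<subseteq> carrier R"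
    show "J = M \<or> J = carrier R"
    proof (cases "\<one> \<in> J")
      case True then show ?thesis using ideal.one_imp_carrier[OF J(1)] by simp
    next
      case False
      then have "J \<in> \<A>" using J M by (auto simp: \<A>_def)
      then show ?thesis using max J by blast
    qed
  qed
  then show ?thesis using M by (intro that[of M]) (simp_all add: \<A>_def)
qed

end

text \<open>The list is reversed because \<open>eval\<close> reads coefficients from the top
  downwards. A polynomial that splits has as many roots as its degree, which is positive here since
  \<open>cs\<close> is nonempty.\<close>

lemma (in algebraically_closed) monic_root:
  assumes "cs \<noteq> []" "set cs \<subseteq> carrier L"
  obtains z where "z \<in> carrier L" "peval L (cs @ [\<one>]) z = \<zero>"
proof -
  let ?p = "\<one> # rev cs"
  have ev: "eval (rev ds) x = peval L ds x" if "set ds \<subseteq> carrier L" "x \<in> carrier L" for ds x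
    using that
  proof (induction ds rule: rev_induct)
    case (snoc d ds)
    then show ?case
      using eval_in_carrier[of "rev ds" x] by (simp add: peval_snoc a_comm peval_closed)
  qed simp
  have p: "?p \<in> carrier (poly_ring L)"
    using assms by (auto simp: univ_poly_carrier[symmetric] polynomial_def)
  then have "size (roots ?p) = length cs"
    using roots_over_carrier[OF p] by (simp add: splitted_def)
  then have "roots ?p \<noteq> {#}" using assms(1) by auto
  then obtain z where "z \<in># roots ?p" by blast
  then have "is_root ?p z" using roots_mem_iff_is_root[OF p] by simp
  then have z: "z \<in> carrier L" "eval ?p z = \<zero>" by (auto simp: is_root_def)
  have "eval (rev (cs @ [\<one>])) z = peval L (cs @ [\<one>]) z"
    using assms z by (intro ev) auto
  then show ?thesis using z that by simp
qed

text \<open>Induction on the degree: a root \<open>z\<close> in \<open>L\<close> splits off the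
  factor \<open>y - h z\<close>, and the prime ideal contains this factor or the value of the
  quotient, which is again monic. So an element algebraic over \<open>L\<close> is congruent to a
  constant modulo a prime ideal.\<close>

lemma prime_ideal_contains_linear_factor:
  assumes L: "algebraically_closed L" and M: "primeideal M B" and h: "h \<in> ring_hom L B"
    and cs: "set cs \<subseteq> carrier L" and y: "y \<in> carrier B"
    and in_M: "peval B (map h (cs @ [\<one>\<^bsub>L\<^esub>])) y \<in> M"
  obtains z where "z \<in> carrier L" "y \<ominus>\<^bsub>B\<^esub> h z \<in> M"
proof -
  interpret L: algebraically_closed L by fact
  interpret M: primeideal M B by fact
  note hs = ring_hom_memE[OF h]
  have "\<exists>z\<in>carrier L. y \<ominus>\<^bsub>B\<^esub> h z \<in> M"
    using cs in_M
  proof (induction "length cs" arbitrary: cs)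
    case 0
    \<comment> \<open>Without lower coefficients the polynomial is the constant \<open>1\<close>,
      which no prime ideal contains.\<close>
    then have "\<one>\<^bsub>B\<^esub> \<in> M" using y by (simp add: hs)
    then show ?case using M.one_imp_carrier M.I_notcarr by blast
  next
    case (Suc n)
    then have ne: "cs \<noteq> []" by auto
    obtain z where z: "z \<in> carrier L" "peval L (cs @ [\<one>\<^bsub>L\<^esub>]) z = \<zero>\<^bsub>L\<^esub>"
      using L.monic_root[OF ne Suc.prems(1)] by blast
    obtain ds where ds: "length ds = length cs - 1" "set ds \<subseteq> carrier L"
      "pdivide L (cs @ [\<one>\<^bsub>L\<^esub>]) z = ds @ [\<one>\<^bsub>L\<^esub>]"
      using L.pdivide_monic[OF ne Suc.prems(1) z(1)] by blast
    have hz: "h z \<in> carrier B" using z hs by simp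
    have zero: "h \<zero>\<^bsub>L\<^esub> = \<zero>\<^bsub>B\<^esub>" by (rule ring_hom_zero[OF h L.ring_axioms M.ring_axioms])
    have pd: "pdivide B (map h es) (h z) = map h (pdivide L es z)" if "set es \<subseteq> carrier L" for es
      using that
    proof (induction es)
      case (Cons e es)
      then show ?case using peval_hom[OF L.is_cring M.is_cring h _ z(1), of es] by auto
    qed simp
    let ?q = "peval B (map h (ds @ [\<one>\<^bsub>L\<^esub>])) y"
    have csL: "set (cs @ [\<one>\<^bsub>L\<^esub>]) \<subseteq> carrier L" using Suc.prems by auto
    have csB: "set (map h (cs @ [\<one>\<^bsub>L\<^esub>])) \<subseteq> carrier B" using csL hs(1) by auto
    have "peval B (map h (cs @ [\<one>\<^bsub>L\<^esub>])) (h z) = \<zero>\<^bsub>B\<^esub>"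
      using peval_hom[OF L.is_cring M.is_cring h csL z(1)] z(2) zero by simp
    then have "peval B (map h (cs @ [\<one>\<^bsub>L\<^esub>])) y = (y \<ominus>\<^bsub>B\<^esub> h z) \<otimes>\<^bsub>B\<^esub> ?q"
      using M.peval_diff[OF csB y hz] pd[OF csL] ds(3) M.peval_closed[OF csB y]
      by (simp add: a_minus_def)
    moreover have "?q \<in> carrier B" using ds hs(1) y by (intro M.peval_closed) auto
    ultimately have "y \<ominus>\<^bsub>B\<^esub> h z \<in> M \<or> ?q \<in> M"
      using M.I_prime[of "y \<ominus>\<^bsub>B\<^esub> h z" ?q] Suc.prems(2) y hz by simp
    then show ?case using Suc.hyps(1)[of ds] Suc.hyps(2) ds z(1) by auto
  qed
  then show ?thesis using that by blast
qed

text \<open>If no power of \<open>x\<close> were a combination of the lower ones, the powers would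
  form arbitrarily large independent sets, against \<open>steinitz\<close>.\<close>

lemma (in field_algebra) algebraic_if_finite:
  assumes F: "finite F" "F \<subseteq> carrier R" "carrier R = sp F" and x: "x \<in> carrier R"
  obtains cs where "set cs \<subseteq> carrier k" "peval R (map \<phi> (cs @ [\<one>\<^bsub>k\<^esub>])) x = \<zero>"
proof -
  define U where "U n = (\<lambda>i. x [^] i) ` {..<n}" for n :: nat
  have UR: "U n \<subseteq> carrier R" for n using x by (auto simp: U_def)
  have USuc: "U (Suc n) = insert (x [^] n) (U n)" for n by (simp add: U_def lessThan_Suc)
  have "\<exists>n. x [^] n \<in> sp (U n)"
  proof (rule ccontr)
    assume "\<not> (\<exists>n. x [^] n \<in> sp (U n))"
    then have not: "x [^] n \<notin> sp (U n)" for n by blast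
    have "indep (U n) \<and> card (U n) = n" for n
    proof (induction n)
      case 0 then show ?case by (simp add: U_def indep_def)
    next
      case (Suc n)
      have "x [^] n \<notin> U n" using not sp_base[OF _ UR] by blast
      moreover have "finite (U n)" by (simp add: U_def)
      ultimately show ?case using Suc x not[of n] by (simp add: USuc indep_insert)
    qed
    then have "indep (U (Suc (card F)))" "card (U (Suc (card F))) = Suc (card F)" by auto
    moreover have "finite (U (Suc (card F)))" by (simp add: U_def)
    ultimately show False using steinitz[of "U (Suc (card F))" F] F UR[of "Suc (card F)"] by simp
  qed
  then obtain n where n: "x [^] n \<in> sp (U n)" by blast
  \<comment> \<open>The length is kept equal to \<open>m\<close>, padding included, so that a
    further coefficient appended to the list belongs to the power \<open>m\<close> of
    \<open>x\<close>. This is how the final polynomial becomes monic.\<close>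
  have repr: "\<exists>cs. length cs = m \<and> set cs \<subseteq> carrier k \<and> y = peval R (map \<phi> cs) x" if "y \<in> sp (U m)" for y m
    using that
  proof (induction m arbitrary: y)
    case 0
    then have "y = \<zero>" by (auto simp: U_def elim: lspan.cases)
    then show ?case by simp
  next
    case (Suc m)
    have "x [^] m \<in> carrier R" using x by simp
    then obtain a z where az: "a \<in> carrier k" "z \<in> sp (U m)" "y = \<phi> a \<otimes> x [^] m \<oplus> z"
      using sp_insert[of y "x [^] m" "U m"] Suc.prems UR unfolding USuc by blast
    then obtain cs where cs: "length cs = m" "set cs \<subseteq> carrier k" "z = peval R (map \<phi> cs) x" using Suc.IH by blast
    have "set (map \<phi> cs) \<subseteq> carrier R" using cs by auto
    then have "y = peval R (map \<phi> (cs @ [a])) x"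
      using az cs x R.peval_snoc[of "map \<phi> cs" "\<phi> a" x] by (simp add: R.a_comm R.peval_closed)
    then show ?case using cs az by (intro exI[of _ "cs @ [a]"]) auto
  qed
  obtain cs where cs: "length cs = n" "set cs \<subseteq> carrier k" "\<ominus> (x [^] n) = peval R (map \<phi> cs) x"
    using repr[OF sp_minus[OF n UR]] by blast
  have "set (map \<phi> cs) \<subseteq> carrier R" using cs by auto
  then have "peval R (map \<phi> (cs @ [\<one>\<^bsub>k\<^esub>])) x = \<zero>"
    using cs x R.peval_snoc[of "map \<phi> cs" \<one> x] by (simp add: hom_simps(4) cs(3)[symmetric] R.l_neg)
  then show ?thesis using cs that by blast
qed

section \<open>Separable algebras split over an algebraically closed field\<close>

context algebra_tensor
begin

text \<open>The tensor product is the coproduct of commutative algebras. Multiplicativity of the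
  additive lift is checked on pure tensors, where commutativity of \<open>D\<close> rearranges the
  four factors.\<close>

lemma
  assumes f: "algebra_hom k \<phi> R \<theta> D f" and g: "algebra_hom k \<psi> S \<theta> D g"
  shows copair_pure: "r \<in> carrier R \<Longrightarrow> s \<in> carrier S \<Longrightarrow> lift D (\<lambda>r s. f r \<otimes>\<^bsub>D\<^esub> g s) (pt r s) = f r \<otimes>\<^bsub>D\<^esub> g s"
    and copair_hom: "lift D (\<lambda>r s. f r \<otimes>\<^bsub>D\<^esub> g s) \<in> ring_hom T D"
proof -
  interpret f: algebra_hom k \<phi> R \<theta> D f by fact
  interpret g: algebra_hom k \<psi> S \<theta> D g by fact
  let ?F = "lift D (\<lambda>r s. f r \<otimes>\<^bsub>D\<^esub> g s)"
  have bal: "balanced k \<phi> R \<psi> S D (\<lambda>r s. f r \<otimes>\<^bsub>D\<^esub> g s)"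
    unfolding balanced_def
    by (intro conjI ballI)
      (simp_all add: f.f_simps g.f_simps f.f_scalar g.f_scalar f.B.R.l_distr f.B.R.r_distr f.B.R.m_assoc f.B.R.m_lcomm)
  note c = tlift_closed[OF f.B.R.abelian_group_axioms bal] and a = tlift_add[OF f.B.R.abelian_group_axioms bal]
    and p = tlift_pure[OF f.B.R.abelian_group_axioms bal]
  show "r \<in> carrier R \<Longrightarrow> s \<in> carrier S \<Longrightarrow> ?F (pt r s) = f r \<otimes>\<^bsub>D\<^esub> g s" by (rule p)
  show "?F \<in> ring_hom T D"
  proof (rule ring_hom_memI)
    fix x y assume x: "x \<in> carrier T" and y: "y \<in> carrier T"
    show "?F x \<in> carrier D" "?F (x \<oplus>\<^bsub>T\<^esub> y) = ?F x \<oplus>\<^bsub>D\<^esub> ?F y" using x y c a by auto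
    show "?F (x \<otimes>\<^bsub>T\<^esub> y) = ?F x \<otimes>\<^bsub>D\<^esub> ?F y"
      using x
    proof (induction rule: T_induct)
      case (pure r s)
      show ?case using y
      proof (induction rule: T_induct)
        case (pure r' s')
        then show ?case using \<open>r \<in> carrier R\<close> \<open>s \<in> carrier S\<close>
          by (simp add: pt_mult p f.f_simps g.f_simps f.B.R.m_assoc f.B.R.m_lcomm)
      next
        case (add x y)
        then show ?case using \<open>r \<in> carrier R\<close> \<open>s \<in> carrier S\<close>
          by (simp add: ts.T.r_distr a c f.B.R.r_distr)
      qed
    next
      case (add x z)
      then show ?case using y by (simp add: ts.T.l_distr a c f.B.R.l_distr)
    qed
  next
    show "?F \<one>\<^bsub>T\<^esub> = \<one>\<^bsub>D\<^esub>" by (simp add: pt_one[symmetric] p f.f_simps g.f_simps)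
  qed
qed

text \<open>The factors of the product are indexed by \<open>k\<close>-algebra homomorphisms \<chi>
  from \<open>R\<close> to \<open>S\<close>. Evaluating the second factor of the separability
  idempotent at \<chi> gives an idempotent of R \<otimes> S on which every element acts through its
  value at \<chi>. The point is that finitely many of these idempotents add up to
  \<open>1\<close>.\<close>

lemma split_of_separable:
  assumes S: "algebraically_closed S" and sep: "separable_algebra k \<phi> R"
  obtains n h where "h \<in> ring_iso T (RDirProd_list (replicate n S))"
    "\<And>c. c \<in> carrier S \<Longrightarrow> h (pt \<one>\<^bsub>R\<^esub> c) = replicate n c"
proof -
  interpret S: algebraically_closed S by fact
  interpret AA: algebra_tensor k \<phi> R \<phi> R by (rule R.square)
  obtain F where F: "finite F" "F \<subseteq> carrier R" "carrier R = R.sp F"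
    using R.separable_finite[OF sep] by blast
  obtain u where u: "u \<in> carrier AA.T"
    "\<And>x. x \<in> carrier R \<Longrightarrow> AA.pt x \<one>\<^bsub>R\<^esub> \<otimes>\<^bsub>AA.T\<^esub> u = AA.pt \<one>\<^bsub>R\<^esub> x \<otimes>\<^bsub>AA.T\<^esub> u" "R.mu u = \<one>\<^bsub>R\<^esub>"
    using sep unfolding separable_algebra_def by blast
  \<comment> \<open>Extensionality makes distinct members of \<open>H\<close> differ at some element
    of \<open>R\<close>, as orthogonality requires.\<close>
  define H where "H = {\<chi> \<in> extensional (carrier R). \<chi> \<in> ring_hom R S \<and> (\<forall>a\<in>carrier k. \<chi> (\<phi> a) = \<psi> a)}"
  have Hh: "\<chi> \<in> ring_hom R S" if "\<chi> \<in> H" for \<chi> using that by (simp add: H_def)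
  have chi: "algebra_hom k \<phi> R \<psi> S \<chi>" if "\<chi> \<in> H" for \<chi>
    using that by unfold_locales (auto simp: H_def)
  have id_hom: "algebra_hom k \<psi> S \<psi> S (\<lambda>s. s)"
    by unfold_locales (auto simp: ring_hom_def)
  have tfun: "tensor_functor k \<phi> R \<phi> R k \<phi> R \<psi> S id id \<chi>" if "\<chi> \<in> H" for \<chi>
    by (intro tensor_functor.intro tensor_functor_axioms.intro AA.ts.tensor_setup_axioms ts.tensor_setup_axioms)
      (use that in \<open>auto simp: H_def ring_hom_def\<close>)
  define F' where "F' \<chi> = tensor_map k \<phi> R \<psi> S (id :: 'a \<Rightarrow> 'a) \<chi>" for \<chi> :: "'a \<Rightarrow> 'b"
  define e where "e \<chi> = F' \<chi> u" for \<chi>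
  define ev where "ev \<chi> = lift S (\<lambda>r s. \<chi> r \<otimes>\<^bsub>S\<^esub> s)" for \<chi>
  have TM_hom: "F' \<chi> \<in> ring_hom AA.T T" if "\<chi> \<in> H" for \<chi>
    unfolding F'_def using tensor_functor.map_hom[OF tfun[OF that]] .
  have TM_pure: "F' \<chi> (AA.pt r s) = pt r (\<chi> s)"
    if "\<chi> \<in> H" "r \<in> carrier R" "s \<in> carrier R" for \<chi> r s
    unfolding F'_def using tensor_functor.map_pure[OF tfun[OF that(1)] that(2,3)] by simp
  have e: "e \<chi> \<in> carrier T" if "\<chi> \<in> H" for \<chi>
    using ring_hom_memE(1)[OF TM_hom[OF that] u(1)] by (simp add: e_def)
  have ev_hom: "ev \<chi> \<in> ring_hom T S" if "\<chi> \<in> H" for \<chi>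
    unfolding ev_def by (rule copair_hom[OF chi[OF that] id_hom])
  have ev_pure: "ev \<chi> (pt r s) = \<chi> r \<otimes>\<^bsub>S\<^esub> s" if "\<chi> \<in> H" "r \<in> carrier R" "s \<in> carrier S" for \<chi> r s
    unfolding ev_def by (rule copair_pure[OF chi[OF that(1)] id_hom that(2,3)])
  note evD = ring_hom_memE[OF ev_hom]
  have chi_closed: "\<chi> r \<in> carrier S" if "\<chi> \<in> H" "r \<in> carrier R" for \<chi> r
    using ring_hom_memE(1)[OF Hh[OF that(1)] that(2)] .
  have chi_one: "\<chi> \<one>\<^bsub>R\<^esub> = \<one>\<^bsub>S\<^esub>" if "\<chi> \<in> H" for \<chi> using ring_hom_memE(4)[OF Hh[OF that]] .
  have xe: "pt x \<one>\<^bsub>S\<^esub> \<otimes>\<^bsub>T\<^esub> e \<chi> = pt \<one>\<^bsub>R\<^esub> (\<chi> x) \<otimes>\<^bsub>T\<^esub> e \<chi>" if "\<chi> \<in> H" "x \<in> carrier R" for \<chi> x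
  proof -
    have "F' \<chi> (AA.pt x \<one>\<^bsub>R\<^esub> \<otimes>\<^bsub>AA.T\<^esub> u) = F' \<chi> (AA.pt \<one>\<^bsub>R\<^esub> x \<otimes>\<^bsub>AA.T\<^esub> u)" using u(2)[OF that(2)] by simp
    moreover have "F' \<chi> (AA.pt x \<one>\<^bsub>R\<^esub> \<otimes>\<^bsub>AA.T\<^esub> u) = pt x \<one>\<^bsub>S\<^esub> \<otimes>\<^bsub>T\<^esub> e \<chi>"
      using that u(1) by (subst ring_hom_memE(2)[OF TM_hom]) (auto simp: TM_pure e_def chi_one)
    moreover have "F' \<chi> (AA.pt \<one>\<^bsub>R\<^esub> x \<otimes>\<^bsub>AA.T\<^esub> u) = pt \<one>\<^bsub>R\<^esub> (\<chi> x) \<otimes>\<^bsub>T\<^esub> e \<chi>"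
      using that u(1) by (subst ring_hom_memE(2)[OF TM_hom]) (auto simp: TM_pure e_def)
    ultimately show ?thesis by simp
  qed
  have ev_e: "ev \<chi> (e \<chi>) = \<one>\<^bsub>S\<^esub>" if c: "\<chi> \<in> H" for \<chi>
  proof -
    have "ev \<chi> (F' \<chi> w) = \<chi> (R.mu w)" if "w \<in> carrier AA.T" for w
      using that
    proof (induction rule: AA.T_induct)
      case (pure r s)
      then show ?case using c chi_closed[OF c]
        by (simp add: TM_pure ev_pure R.mu_pure ring_hom_memE(2)[OF Hh])
    next
      case (add x y)
      then show ?case using c
        by (simp add: ring_hom_memE(1,3)[OF TM_hom] evD R.mu_add R.mu_closed ring_hom_memE(3)[OF Hh])
    qed
    then show ?thesis using u c by (simp add: e_def chi_one)
  qed
  have ye: "y \<otimes>\<^bsub>T\<^esub> e \<chi> = pt \<one>\<^bsub>R\<^esub> (ev \<chi> y) \<otimes>\<^bsub>T\<^esub> e \<chi>" if c: "\<chi> \<in> H" and y: "y \<in> carrier T" for \<chi> y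
    using y
  proof (induction rule: T_induct)
    case (pure r s)
    have "pt r s \<otimes>\<^bsub>T\<^esub> e \<chi> = pt \<one>\<^bsub>R\<^esub> s \<otimes>\<^bsub>T\<^esub> (pt r \<one>\<^bsub>S\<^esub> \<otimes>\<^bsub>T\<^esub> e \<chi>)"
      using pure e[OF c] by (simp add: ts.T.m_assoc[symmetric] pt_mult)
    also have "\<dots> = pt \<one>\<^bsub>R\<^esub> (ev \<chi> (pt r s)) \<otimes>\<^bsub>T\<^esub> e \<chi>"
      unfolding xe[OF c pure(1)] using pure e[OF c] chi_closed[OF c]
      by (simp add: ts.T.m_assoc[symmetric] pt_mult ev_pure[OF c] S.R.m_comm)
    finally show ?case .
  next
    case (add x y)
    then show ?case using e[OF c] by (simp add: ts.T.l_distr evD[OF c] pt_addr)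
  qed
  have idem: "e \<chi> \<otimes>\<^bsub>T\<^esub> e \<chi> = e \<chi>" if "\<chi> \<in> H" for \<chi>
    using ye[OF that e[OF that]] ev_e[OF that] e[OF that] by (simp add: pt_one)
  \<comment> \<open>On \<open>e \<chi>'\<close> an element \<open>x\<close> of \<open>R\<close> acts
    as \<chi>' x, while \<open>ev \<chi>\<close> turns it into \<chi> x. Where the two values
    differ, cancellation in the field \<open>S\<close> makes the factor
    \<open>ev \<chi> (e \<chi>')\<close> vanish.\<close>
  have orth: "ev \<chi> (e \<chi>') = \<zero>\<^bsub>S\<^esub>" if c: "\<chi> \<in> H" "\<chi>' \<in> H" "\<chi> \<noteq> \<chi>'" for \<chi> \<chi>'
  proof -
    obtain x where x: "x \<in> carrier R" "\<chi> x \<noteq> \<chi>' x"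
      using c by (metis (no_types, lifting) H_def extensionalityI mem_Collect_eq)
    have "ev \<chi> (pt x \<one>\<^bsub>S\<^esub> \<otimes>\<^bsub>T\<^esub> e \<chi>') = ev \<chi> (pt \<one>\<^bsub>R\<^esub> (\<chi>' x) \<otimes>\<^bsub>T\<^esub> e \<chi>')" using xe[OF c(2) x(1)] by simp
    then have "\<chi> x \<otimes>\<^bsub>S\<^esub> ev \<chi> (e \<chi>') = \<chi>' x \<otimes>\<^bsub>S\<^esub> ev \<chi> (e \<chi>')"
      using x(1) c e chi_closed by (simp add: evD(2)[OF c(1)] ev_pure[OF c(1)] chi_one[OF c(1)])
    then show ?thesis
      using S.m_rcancel[of "ev \<chi> (e \<chi>')" "\<chi> x" "\<chi>' x"] x c chi_closed evD(1)[OF c(1) e[OF c(2)]] by auto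
  qed
  have orth': "e \<chi>' \<otimes>\<^bsub>T\<^esub> e \<chi> = \<zero>\<^bsub>T\<^esub>" if c: "\<chi> \<in> H" "\<chi>' \<in> H" "\<chi> \<noteq> \<chi>'" for \<chi> \<chi>'
    using ye[OF c(1) e[OF c(2)]] orth[OF c] e[OF c(1)] by (simp add: pt_zero_right)
  define eN where "eN N = (\<Oplus>\<^bsub>T\<^esub>\<chi>\<in>N. e \<chi>)" for N
  have eN: "eN N \<in> carrier T" if "N \<subseteq> H" for N
    unfolding eN_def by (rule ts.T.finsum_closed) (use e that in auto)
  have e_eN: "e \<chi> \<otimes>\<^bsub>T\<^esub> eN N = e \<chi>" if N: "finite N" "N \<subseteq> H" "\<chi> \<in> N" for \<chi> N
  proof -
    have "e \<chi> \<otimes>\<^bsub>T\<^esub> eN N = (\<Oplus>\<^bsub>T\<^esub>\<chi>'\<in>N. e \<chi> \<otimes>\<^bsub>T\<^esub> e \<chi>')"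
      unfolding eN_def by (rule ts.T.finsum_rdistr) (use N e in auto)
    also have "\<dots> = (\<Oplus>\<^bsub>T\<^esub>\<chi>'\<in>N. if \<chi> = \<chi>' then e \<chi> else \<zero>\<^bsub>T\<^esub>)"
    proof (rule ts.T.finsum_cong')
      fix \<chi>' assume "\<chi>' \<in> N"
      then show "e \<chi> \<otimes>\<^bsub>T\<^esub> e \<chi>' = (if \<chi> = \<chi>' then e \<chi> else \<zero>\<^bsub>T\<^esub>)"
        using N idem[of \<chi>] orth'[of \<chi>' \<chi>] by auto
    qed (use N e in auto)
    also have "\<dots> = e \<chi>"
      using ts.T.finsum_singleton[of \<chi> N "\<lambda>_. e \<chi>"] N e by auto
    finally show ?thesis .
  qed
  have eN_mono: "eN N \<otimes>\<^bsub>T\<^esub> eN N' = eN N" if N: "finite N'" "N' \<subseteq> H" "N \<subseteq> N'" for N N'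
  proof -
    have fN: "finite N" using N finite_subset by blast
    have "eN N \<otimes>\<^bsub>T\<^esub> eN N' = (\<Oplus>\<^bsub>T\<^esub>\<chi>\<in>N. e \<chi> \<otimes>\<^bsub>T\<^esub> eN N')"
      unfolding eN_def[of N] by (rule ts.T.finsum_ldistr) (use N fN e eN[OF N(2)] in auto)
    also have "\<dots> = eN N"
      unfolding eN_def[of N] by (rule ts.T.finsum_cong') (use N e e_eN[OF N(1,2)] in auto)
    finally show ?thesis .
  qed
  have absorb: "a \<otimes>\<^bsub>T\<^esub> eN N' = a"
    if a: "a \<in> carrier T" "a \<otimes>\<^bsub>T\<^esub> eN N = a" and N: "finite N'" "N' \<subseteq> H" "N \<subseteq> N'" for a N N'
  proof -
    have "a \<otimes>\<^bsub>T\<^esub> (eN N \<otimes>\<^bsub>T\<^esub> eN N') = (a \<otimes>\<^bsub>T\<^esub> eN N) \<otimes>\<^bsub>T\<^esub> eN N'"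
      by (rule ts.T.m_assoc[symmetric]) (use a N eN in auto)
    then show ?thesis using eN_mono[OF N] a by simp
  qed
  \<comment> \<open>The ideal generated by all \<open>e \<chi>\<close>, described as the elements
    that some finite partial sum absorbs. Finiteness of \<open>H\<close> has not been established; a
    finite index set is extracted from membership of \<open>1\<close>.\<close>
  define E where "E = {y \<in> carrier T. \<exists>N. finite N \<and> N \<subseteq> H \<and> y \<otimes>\<^bsub>T\<^esub> eN N = y}"
  have EI: "ideal E T"
  proof (rule idealI[OF ts.T.ring_axioms])
    show "subgroup E (add_monoid T)"
    proof (rule ts.T.add.subgroupI)
      have "\<zero>\<^bsub>T\<^esub> \<in> E" unfolding E_def
        by (intro CollectI conjI exI[of _ "{}"]) (auto simp: eN_def)
      then show "E \<noteq> {}" by blast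
      fix a b assume a: "a \<in> E" and b: "b \<in> E"
      obtain N where N: "finite N" "N \<subseteq> H" "a \<otimes>\<^bsub>T\<^esub> eN N = a" "a \<in> carrier T" using a by (auto simp: E_def)
      show "\<ominus>\<^bsub>T\<^esub> a \<in> E"
        unfolding E_def using N eN[OF N(2)] by (intro CollectI conjI exI[of _ N]) (auto simp: ts.T.l_minus)
      obtain N' where N': "finite N'" "N' \<subseteq> H" "b \<otimes>\<^bsub>T\<^esub> eN N' = b" "b \<in> carrier T" using b by (auto simp: E_def)
      let ?N = "N \<union> N'"
      have n: "finite ?N" "?N \<subseteq> H" using N N' by auto
      have 1: "a \<otimes>\<^bsub>T\<^esub> eN ?N = a" using absorb[of a N ?N] N n by simp
      have 2: "b \<otimes>\<^bsub>T\<^esub> eN ?N = b" using absorb[of b N' ?N] N' n by simp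
      show "a \<oplus>\<^bsub>T\<^esub> b \<in> E"
        unfolding E_def using N(4) N'(4) eN[OF n(2)] n 1 2
        by (intro CollectI conjI exI[of _ ?N]) (auto simp: ts.T.l_distr)
    qed (auto simp: E_def)
    fix a x assume a: "a \<in> E" and x: "x \<in> carrier T"
    obtain N where N: "finite N" "N \<subseteq> H" "a \<otimes>\<^bsub>T\<^esub> eN N = a" "a \<in> carrier T" using a by (auto simp: E_def)
    show "x \<otimes>\<^bsub>T\<^esub> a \<in> E"
      unfolding E_def using N x eN[OF N(2)]
      by (intro CollectI conjI exI[of _ N]) (auto simp: ts.T.m_assoc)
    then show "a \<otimes>\<^bsub>T\<^esub> x \<in> E" using N x ts.T.m_comm[of a x] by simp
  qed
  have eE: "e \<chi> \<in> E" if "\<chi> \<in> H" for \<chi>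
    unfolding E_def using that e e_eN[of "{\<chi>}" \<chi>] by (intro CollectI conjI exI[of _ "{\<chi>}"]) auto
  \<comment> \<open>Otherwise some maximal ideal \<open>M\<close> contains every
    \<open>e \<chi>\<close>. Each element of \<open>R\<close> is algebraic over \<open>k\<close>,
    hence congruent modulo \<open>M\<close> to a constant of \<open>S\<close>, and these constants
    form a member \<chi> of \<open>H\<close>. Then \<open>e \<chi>\<close> is congruent to
    \<open>ev \<chi> (e \<chi>)\<close>, that is to \<open>1\<close>, although it lies in
    \<open>M\<close>.\<close>
  have "\<one>\<^bsub>T\<^esub> \<in> E"
  proof (rule ccontr)
    assume "\<one>\<^bsub>T\<^esub> \<notin> E"
    then obtain M where M: "maximalideal M T" "E \<subseteq> M" using ts.T.maximal_ideal_exists[OF EI] by blast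
    interpret M: primeideal M T by (rule ts.T.maximalideal_prime[OF M(1)])
    have ex: "\<exists>z\<in>carrier S. pt x \<one>\<^bsub>S\<^esub> \<ominus>\<^bsub>T\<^esub> pt \<one>\<^bsub>R\<^esub> z \<in> M" if x: "x \<in> carrier R" for x
    proof -
      obtain cs where cs: "set cs \<subseteq> carrier k" "peval R (map \<phi> (cs @ [\<one>\<^bsub>k\<^esub>])) x = \<zero>\<^bsub>R\<^esub>"
        using R.algebraic_if_finite[OF F x] by blast
      have "set (map \<phi> (cs @ [\<one>\<^bsub>k\<^esub>])) \<subseteq> carrier R" using cs by auto
      from peval_hom[OF R.R.is_cring ts.T.is_cring left_hom this x]
      have "peval T (map (\<lambda>r. pt r \<one>\<^bsub>S\<^esub>) (map \<phi> (cs @ [\<one>\<^bsub>k\<^esub>]))) (pt x \<one>\<^bsub>S\<^esub>) = \<zero>\<^bsub>T\<^esub>"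
        using cs(2) by (simp add: pt_zero_left)
      moreover have "map (\<lambda>r. pt r \<one>\<^bsub>S\<^esub>) (map \<phi> (cs @ [\<one>\<^bsub>k\<^esub>])) = map (pt \<one>\<^bsub>R\<^esub>) (map \<psi> cs @ [\<one>\<^bsub>S\<^esub>])"
        using cs(1) by (auto simp: scalar_right subset_iff S.hom_simps R.hom_simps)
      ultimately have "peval T (map (pt \<one>\<^bsub>R\<^esub>) (map \<psi> cs @ [\<one>\<^bsub>S\<^esub>])) (pt x \<one>\<^bsub>S\<^esub>) \<in> M"
        using M.zero_closed by (simp del: map_append)
      moreover have "set (map \<psi> cs) \<subseteq> carrier S" using cs(1) by auto
      ultimately show ?thesis
        using prime_ideal_contains_linear_factor[OF S M.primeideal_axioms right_hom, of "map \<psi> cs" "pt x \<one>\<^bsub>S\<^esub>"] x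
        by (metis pt_closed S.R.one_closed)
    qed
    \<comment> \<open>Nonzero constants are units, so a proper ideal cannot contain the difference
      of two distinct ones. Uniqueness makes the map \<chi> below compatible with sums and
      products.\<close>
    have uniq: "z = z'" if z: "z \<in> carrier S" "z' \<in> carrier S" and x: "x \<in> carrier T"
      and m: "x \<ominus>\<^bsub>T\<^esub> pt \<one>\<^bsub>R\<^esub> z \<in> M" "x \<ominus>\<^bsub>T\<^esub> pt \<one>\<^bsub>R\<^esub> z' \<in> M" for x z z'
    proof (rule ccontr)
      assume ne: "z \<noteq> z'"
      define d where "d = z' \<ominus>\<^bsub>S\<^esub> z"
      have d: "d \<in> carrier S" "d \<noteq> \<zero>\<^bsub>S\<^esub>" using z ne by (auto simp: d_def)
      have "(x \<ominus>\<^bsub>T\<^esub> pt \<one>\<^bsub>R\<^esub> z) \<ominus>\<^bsub>T\<^esub> (x \<ominus>\<^bsub>T\<^esub> pt \<one>\<^bsub>R\<^esub> z') \<in> M"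
        using m unfolding a_minus_def[of T "x \<ominus>\<^bsub>T\<^esub> pt \<one>\<^bsub>R\<^esub> z"] by (intro M.a_closed M.a_inv_closed)
      moreover have "pt \<one>\<^bsub>R\<^esub> z \<in> carrier T" "pt \<one>\<^bsub>R\<^esub> z' \<in> carrier T" using z by auto
      then have "(x \<ominus>\<^bsub>T\<^esub> pt \<one>\<^bsub>R\<^esub> z) \<ominus>\<^bsub>T\<^esub> (x \<ominus>\<^bsub>T\<^esub> pt \<one>\<^bsub>R\<^esub> z') = pt \<one>\<^bsub>R\<^esub> z' \<ominus>\<^bsub>T\<^esub> pt \<one>\<^bsub>R\<^esub> z"
        using x by algebra
      moreover have "\<dots> = pt \<one>\<^bsub>R\<^esub> d"
        using z by (simp add: d_def a_minus_def pt_addr pt_minus_right)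
      ultimately have "pt \<one>\<^bsub>R\<^esub> d \<in> M" by simp
      then have "pt \<one>\<^bsub>R\<^esub> (inv\<^bsub>S\<^esub> d) \<otimes>\<^bsub>T\<^esub> pt \<one>\<^bsub>R\<^esub> d \<in> M"
        using d S.field_Units by (intro M.I_l_closed) auto
      then have "\<one>\<^bsub>T\<^esub> \<in> M"
        using d S.field_Units by (simp add: pt_mult pt_one)
      then show False using M.one_imp_carrier M.I_notcarr by blast
    qed
    define \<chi> where "\<chi> = restrict (\<lambda>x. SOME z. z \<in> carrier S \<and> pt x \<one>\<^bsub>S\<^esub> \<ominus>\<^bsub>T\<^esub> pt \<one>\<^bsub>R\<^esub> z \<in> M) (carrier R)"
    have c: "\<chi> x \<in> carrier S \<and> pt x \<one>\<^bsub>S\<^esub> \<ominus>\<^bsub>T\<^esub> pt \<one>\<^bsub>R\<^esub> (\<chi> x) \<in> M" if "x \<in> carrier R" for x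
      unfolding \<chi>_def using someI_ex[OF ex[OF that, unfolded Bex_def]] that by simp
    have cI: "\<chi> x = z" if "x \<in> carrier R" "z \<in> carrier S" "pt x \<one>\<^bsub>S\<^esub> \<ominus>\<^bsub>T\<^esub> pt \<one>\<^bsub>R\<^esub> z \<in> M" for x z
      using uniq[of "\<chi> x" z "pt x \<one>\<^bsub>S\<^esub>"] c[OF that(1)] that by simp
    have scal: "\<chi> (\<phi> a) = \<psi> a" if "a \<in> carrier k" for a
      by (rule cI) (use that M.zero_closed in \<open>auto simp: scalar_right a_minus_def ts.T.r_neg\<close>)
    have "\<chi> \<in> ring_hom R S"
    proof (rule ring_hom_memI)
      fix x y assume x: "x \<in> carrier R" and y: "y \<in> carrier R"
      show "\<chi> x \<in> carrier S" using c x by blast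
      let ?x = "pt x \<one>\<^bsub>S\<^esub>" and ?y = "pt y \<one>\<^bsub>S\<^esub>" and ?a = "pt \<one>\<^bsub>R\<^esub> (\<chi> x)" and ?b = "pt \<one>\<^bsub>R\<^esub> (\<chi> y)"
      have cl: "?x \<in> carrier T" "?y \<in> carrier T" "?a \<in> carrier T" "?b \<in> carrier T" using x y c by auto
      have m: "?x \<ominus>\<^bsub>T\<^esub> ?a \<in> M" "?y \<ominus>\<^bsub>T\<^esub> ?b \<in> M" using c x y by auto
      show "\<chi> (x \<oplus>\<^bsub>R\<^esub> y) = \<chi> x \<oplus>\<^bsub>S\<^esub> \<chi> y"
      proof (rule cI)
        have "pt (x \<oplus>\<^bsub>R\<^esub> y) \<one>\<^bsub>S\<^esub> \<ominus>\<^bsub>T\<^esub> pt \<one>\<^bsub>R\<^esub> (\<chi> x \<oplus>\<^bsub>S\<^esub> \<chi> y) = (?x \<oplus>\<^bsub>T\<^esub> ?y) \<ominus>\<^bsub>T\<^esub> (?a \<oplus>\<^bsub>T\<^esub> ?b)"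
          using x y c by (simp add: pt_addl pt_addr)
        also have "\<dots> = (?x \<ominus>\<^bsub>T\<^esub> ?a) \<oplus>\<^bsub>T\<^esub> (?y \<ominus>\<^bsub>T\<^esub> ?b)" using cl by algebra
        finally show "pt (x \<oplus>\<^bsub>R\<^esub> y) \<one>\<^bsub>S\<^esub> \<ominus>\<^bsub>T\<^esub> pt \<one>\<^bsub>R\<^esub> (\<chi> x \<oplus>\<^bsub>S\<^esub> \<chi> y) \<in> M" using m by simp
      qed (use x y c in auto)
      show "\<chi> (x \<otimes>\<^bsub>R\<^esub> y) = \<chi> x \<otimes>\<^bsub>S\<^esub> \<chi> y"
      proof (rule cI)
        have "pt (x \<otimes>\<^bsub>R\<^esub> y) \<one>\<^bsub>S\<^esub> \<ominus>\<^bsub>T\<^esub> pt \<one>\<^bsub>R\<^esub> (\<chi> x \<otimes>\<^bsub>S\<^esub> \<chi> y) = (?x \<otimes>\<^bsub>T\<^esub> ?y) \<ominus>\<^bsub>T\<^esub> (?a \<otimes>\<^bsub>T\<^esub> ?b)"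
          using x y c by (simp add: pt_mult)
        also have "\<dots> = ?x \<otimes>\<^bsub>T\<^esub> (?y \<ominus>\<^bsub>T\<^esub> ?b) \<oplus>\<^bsub>T\<^esub> ?b \<otimes>\<^bsub>T\<^esub> (?x \<ominus>\<^bsub>T\<^esub> ?a)" using cl by algebra
        finally show "pt (x \<otimes>\<^bsub>R\<^esub> y) \<one>\<^bsub>S\<^esub> \<ominus>\<^bsub>T\<^esub> pt \<one>\<^bsub>R\<^esub> (\<chi> x \<otimes>\<^bsub>S\<^esub> \<chi> y) \<in> M"
          using m cl by (simp add: M.I_l_closed)
      qed (use x y c in auto)
    next
      show "\<chi> \<one>\<^bsub>R\<^esub> = \<one>\<^bsub>S\<^esub>" using scal[of "\<one>\<^bsub>k\<^esub>"] by (simp add: R.hom_simps S.hom_simps)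
    qed
    then have chiH: "\<chi> \<in> H" using scal by (auto simp: H_def \<chi>_def)
    \<comment> \<open>The congruence that defines \<chi> on \<open>R\<close> extends to R \<otimes>
      S, where \<open>ev \<chi>\<close> gives the constant.\<close>
    have mod_M: "y \<ominus>\<^bsub>T\<^esub> pt \<one>\<^bsub>R\<^esub> (ev \<chi> y) \<in> M" if "y \<in> carrier T" for y
      using that
    proof (induction rule: T_induct)
      case (pure r s)
      have cl: "\<chi> r \<in> carrier S" using c pure by blast
      have "pt r s \<ominus>\<^bsub>T\<^esub> pt \<one>\<^bsub>R\<^esub> (ev \<chi> (pt r s)) = (pt r \<one>\<^bsub>S\<^esub> \<ominus>\<^bsub>T\<^esub> pt \<one>\<^bsub>R\<^esub> (\<chi> r)) \<otimes>\<^bsub>T\<^esub> pt \<one>\<^bsub>R\<^esub> s"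
        using pure cl by (simp add: ev_pure[OF chiH] a_minus_def ts.T.l_distr ts.T.l_minus pt_mult)
      then show ?case using c[OF pure(1)] pure by (simp add: M.I_r_closed)
    next
      case (add x y)
      have cl: "pt \<one>\<^bsub>R\<^esub> (ev \<chi> x) \<in> carrier T" "pt \<one>\<^bsub>R\<^esub> (ev \<chi> y) \<in> carrier T" using add evD(1)[OF chiH] by auto
      have "(x \<oplus>\<^bsub>T\<^esub> y) \<ominus>\<^bsub>T\<^esub> pt \<one>\<^bsub>R\<^esub> (ev \<chi> (x \<oplus>\<^bsub>T\<^esub> y)) = (x \<oplus>\<^bsub>T\<^esub> y) \<ominus>\<^bsub>T\<^esub> (pt \<one>\<^bsub>R\<^esub> (ev \<chi> x) \<oplus>\<^bsub>T\<^esub> pt \<one>\<^bsub>R\<^esub> (ev \<chi> y))"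
        using add by (simp add: evD[OF chiH] pt_addr)
      also have "\<dots> = (x \<ominus>\<^bsub>T\<^esub> pt \<one>\<^bsub>R\<^esub> (ev \<chi> x)) \<oplus>\<^bsub>T\<^esub> (y \<ominus>\<^bsub>T\<^esub> pt \<one>\<^bsub>R\<^esub> (ev \<chi> y))"
        using add(1,2) cl by algebra
      finally show ?case using add by simp
    qed
    have "e \<chi> \<ominus>\<^bsub>T\<^esub> \<one>\<^bsub>T\<^esub> \<in> M" using mod_M[OF e[OF chiH]] ev_e[OF chiH] by (simp add: pt_one)
    moreover have "e \<chi> \<in> M" using eE[OF chiH] M(2) by blast
    ultimately have "e \<chi> \<ominus>\<^bsub>T\<^esub> (e \<chi> \<ominus>\<^bsub>T\<^esub> \<one>\<^bsub>T\<^esub>) \<in> M"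
      unfolding a_minus_def[of T "e \<chi>" "e \<chi> \<ominus>\<^bsub>T\<^esub> \<one>\<^bsub>T\<^esub>"] by (intro M.a_closed M.a_inv_closed)
    moreover have "e \<chi> \<ominus>\<^bsub>T\<^esub> (e \<chi> \<ominus>\<^bsub>T\<^esub> \<one>\<^bsub>T\<^esub>) = \<one>\<^bsub>T\<^esub>"
      using e[OF chiH] by algebra
    ultimately show False using M.one_imp_carrier M.I_notcarr by simp
  qed
  then obtain N where "finite N" "N \<subseteq> H" "\<one>\<^bsub>T\<^esub> \<otimes>\<^bsub>T\<^esub> eN N = \<one>\<^bsub>T\<^esub>"
    by (auto simp: E_def)
  then have N: "finite N" "N \<subseteq> H" "\<one>\<^bsub>T\<^esub> = eN N" using eN by auto
  obtain xs where xs: "set xs = N" "distinct xs" using finite_distinct_list[OF N(1)] by blast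
  define h where "h y = map (\<lambda>\<chi>. ev \<chi> y) xs" for y
  let ?D = "RDirProd_list (replicate (length xs) S)"
  note D = RDirProd_list_replicate[of "length xs" S]
  have inH: "\<chi> \<in> H" if "\<chi> \<in> set xs" for \<chi> using that xs N by blast
  have h_carr: "h y \<in> carrier ?D" if "y \<in> carrier T" for y
    using that by (auto simp: h_def D evD(1)[OF inH])
  have NH: "\<chi> \<in> H" if "\<chi> \<in> N" for \<chi> using that N(2) by blast
  have cl_exp: "pt \<one>\<^bsub>R\<^esub> (ev \<chi> y) \<otimes>\<^bsub>T\<^esub> e \<chi> \<in> carrier T" if "\<chi> \<in> N" "y \<in> carrier T" for \<chi> y
    using e[OF NH[OF that(1)]] evD(1)[OF NH[OF that(1)] that(2)] by simp
  \<comment> \<open>Multiplication by the decomposition of \<open>1\<close> recovers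
    \<open>y\<close> from its values \<open>ev \<chi> y\<close>, which gives injectivity of
    \<open>h\<close>. Orthogonality gives surjectivity below.\<close>
  have expand: "y = (\<Oplus>\<^bsub>T\<^esub>\<chi>\<in>N. pt \<one>\<^bsub>R\<^esub> (ev \<chi> y) \<otimes>\<^bsub>T\<^esub> e \<chi>)" if y: "y \<in> carrier T" for y
  proof -
    have "y = y \<otimes>\<^bsub>T\<^esub> eN N" using y N(3) by (metis ts.T.r_one)
    also have "\<dots> = (\<Oplus>\<^bsub>T\<^esub>\<chi>\<in>N. y \<otimes>\<^bsub>T\<^esub> e \<chi>)"
      unfolding eN_def by (rule ts.T.finsum_rdistr) (use N e y in auto)
    also have "\<dots> = (\<Oplus>\<^bsub>T\<^esub>\<chi>\<in>N. pt \<one>\<^bsub>R\<^esub> (ev \<chi> y) \<otimes>\<^bsub>T\<^esub> e \<chi>)"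
      by (rule ts.T.finsum_cong') (use y ye[OF NH] cl_exp in auto)
    finally show ?thesis .
  qed
  have h_hom: "h \<in> ring_hom T ?D"
  proof (rule ring_hom_memI)
    fix x y assume x: "x \<in> carrier T" and y: "y \<in> carrier T"
    show "h x \<in> carrier ?D" by (rule h_carr[OF x])
    show "h (x \<otimes>\<^bsub>T\<^esub> y) = h x \<otimes>\<^bsub>?D\<^esub> h y"
      using x y by (simp add: RDirProd_list_replicate_ops h_carr) (simp add: h_def evD(2)[OF inH] zip_map_map zip_same_conv_map)
    show "h (x \<oplus>\<^bsub>T\<^esub> y) = h x \<oplus>\<^bsub>?D\<^esub> h y"
      using x y by (simp add: RDirProd_list_replicate_ops h_carr) (simp add: h_def evD(3)[OF inH] zip_map_map zip_same_conv_map)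
  next
    show "h \<one>\<^bsub>T\<^esub> = \<one>\<^bsub>?D\<^esub>"
      by (auto simp: h_def D evD(4)[OF inH] intro!: nth_equalityI)
  qed
  have "inj_on h (carrier T)"
  proof (rule inj_onI)
    fix x y assume x: "x \<in> carrier T" and y: "y \<in> carrier T" and eq: "h x = h y"
    have "ev \<chi> x = ev \<chi> y" if "\<chi> \<in> N" for \<chi> using eq that xs(1) by (auto simp: h_def)
    then have "(\<Oplus>\<^bsub>T\<^esub>\<chi>\<in>N. pt \<one>\<^bsub>R\<^esub> (ev \<chi> x) \<otimes>\<^bsub>T\<^esub> e \<chi>) = (\<Oplus>\<^bsub>T\<^esub>\<chi>\<in>N. pt \<one>\<^bsub>R\<^esub> (ev \<chi> y) \<otimes>\<^bsub>T\<^esub> e \<chi>)"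
      by (intro ts.T.finsum_cong') (use y cl_exp in auto)
    then show "x = y" by (rule trans[OF expand[OF x] trans[OF _ expand[OF y, symmetric]]])
  qed
  moreover have "h ` carrier T = carrier ?D"
  proof
    show "carrier ?D \<subseteq> h ` carrier T"
    proof
      fix cs assume "cs \<in> carrier ?D"
      then have cs: "length cs = length xs" "set cs \<subseteq> carrier S" by (auto simp: D)
      define c where "c \<chi> = the (map_of (zip xs cs) \<chi>)" for \<chi>
      have c_nth: "c (xs ! i) = cs ! i" if "i < length xs" for i
        using that cs xs(2) by (simp add: c_def map_of_zip_nth)
      have c: "c \<chi> \<in> carrier S" if "\<chi> \<in> N" for \<chi>
        using that xs(1) c_nth cs by (metis in_set_conv_nth subsetD)
      define y where "y = (\<Oplus>\<^bsub>T\<^esub>\<chi>\<in>N. pt \<one>\<^bsub>R\<^esub> (c \<chi>) \<otimes>\<^bsub>T\<^esub> e \<chi>)"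
      have cl: "pt \<one>\<^bsub>R\<^esub> (c \<chi>) \<otimes>\<^bsub>T\<^esub> e \<chi> \<in> carrier T" if "\<chi> \<in> N" for \<chi> using c e N that by auto
      have y: "y \<in> carrier T" unfolding y_def by (rule ts.T.finsum_closed) (use cl in auto)
      have "ev \<chi> y = c \<chi>" if x: "\<chi> \<in> N" for \<chi>
      proof -
        have xH: "\<chi> \<in> H" using x N by blast
        have "ev \<chi> y = (\<Oplus>\<^bsub>S\<^esub>\<chi>'\<in>N. ev \<chi> (pt \<one>\<^bsub>R\<^esub> (c \<chi>') \<otimes>\<^bsub>T\<^esub> e \<chi>'))"
          unfolding y_def
          by (rule additive_finsum[OF ts.T.abelian_group_axioms S.R.abelian_group_axioms])
            (use N cl evD[OF xH] in auto)
        also have "\<dots> = (\<Oplus>\<^bsub>S\<^esub>\<chi>'\<in>N. if \<chi> = \<chi>' then c \<chi> else \<zero>\<^bsub>S\<^esub>)"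
        proof (rule S.R.finsum_cong')
          fix \<chi>' assume x': "\<chi>' \<in> N"
          then have "\<chi>' \<in> H" using N by blast
          then show "ev \<chi> (pt \<one>\<^bsub>R\<^esub> (c \<chi>') \<otimes>\<^bsub>T\<^esub> e \<chi>') = (if \<chi> = \<chi>' then c \<chi> else \<zero>\<^bsub>S\<^esub>)"
            using xH x x' c e ev_e orth[OF xH, of \<chi>'] by (simp add: evD(2)[OF xH] ev_pure[OF xH] chi_one[OF xH])
        qed (use x c in auto)
        also have "\<dots> = c \<chi>" using S.R.finsum_singleton[of \<chi> N "\<lambda>_. c \<chi>"] x N c by auto
        finally show ?thesis .
      qed
      then have "h y = cs"
        using cs xs c_nth by (auto simp: h_def intro!: nth_equalityI)
      then show "cs \<in> h ` carrier T" using y by blast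
    qed
  qed (use h_carr in auto)
  ultimately have "h \<in> ring_iso T ?D" using h_hom by (auto simp: ring_iso_def bij_betw_def)
  moreover have "h (pt \<one>\<^bsub>R\<^esub> c) = replicate (length xs) c" if "c \<in> carrier S" for c
    using that by (auto simp: h_def ev_pure[OF inH] chi_one[OF inH] intro!: nth_equalityI)
  ultimately show ?thesis using that by blast
qed

end

text \<open>Takes the algebraic closure of \<open>k\<close> as splitting field in the two preceding
  constructions. Afterwards etaleness is handled over \<open>k\<close> itself, through the
  separability idempotent.\<close>

lemma etale_iff_separable:
  assumes "field_algebra k \<phi> R"
  shows "etale k \<phi> R \<longleftrightarrow> separable_algebra k \<phi> R"
proof -
  interpret R: field_algebra k \<phi> R by fact
  let ?C = "field.alg_closure k" and ?i = "ring.indexed_const k"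
  interpret C: algebraic_closure ?C "?i ` carrier k" by (rule R.k.alg_closureE(1))
  interpret AC: algebra_tensor k \<phi> R ?i ?C
    by unfold_locales (rule R.k.alg_closureE(2))
  show ?thesis
  proof
    assume "etale k \<phi> R"
    then obtain n h where "h \<in> ring_iso AC.T (RDirProd_list (replicate n ?C))"
      "\<forall>c\<in>carrier ?C. h (AC.pt \<one>\<^bsub>R\<^esub> c) = replicate n c"
      by (auto simp: etale_def Let_def)
    then show "separable_algebra k \<phi> R"
      using AC.separable_of_split[OF C.field_axioms] by blast
  next
    assume "separable_algebra k \<phi> R"
    from AC.split_of_separable[OF C.algebraically_closed_axioms this]
    show "etale k \<phi> R" unfolding etale_def Let_def by metis
  qed
qed


section \<open>Separability passes to the slices of a separable subalgebra\<close>

text \<open>For an ideal \<open>I\<close> this is the product of \<open>I\<close> with the ideal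
  generated by \<open>F\<close>; for \<open>I\<close> the whole ring it is that ideal itself.
  Listing coefficients against a fixed \<open>F\<close> is the form in which Nakayama's lemma
  eliminates generators.\<close>

inductive_set icomb :: "('a, 'm) ring_scheme \<Rightarrow> 'a set \<Rightarrow> 'a set \<Rightarrow> 'a set" for R I F where
  zero: "\<zero>\<^bsub>R\<^esub> \<in> icomb R I F"
| step: "a \<in> I \<Longrightarrow> x \<in> F \<Longrightarrow> y \<in> icomb R I F \<Longrightarrow> a \<otimes>\<^bsub>R\<^esub> x \<oplus>\<^bsub>R\<^esub> y \<in> icomb R I F"

context cring
begin

lemma add_minus_add:
  "a \<in> carrier R \<Longrightarrow> b \<in> carrier R \<Longrightarrow> c \<in> carrier R \<Longrightarrow> d \<in> carrier R \<Longrightarrow>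
    (a \<oplus> b) \<ominus> (c \<oplus> d) = (a \<ominus> c) \<oplus> (b \<ominus> d)"
  by algebra

lemma mult_minus_mult:
  "a \<in> carrier R \<Longrightarrow> b \<in> carrier R \<Longrightarrow> c \<in> carrier R \<Longrightarrow> a \<otimes> b \<ominus> a \<otimes> c = a \<otimes> (b \<ominus> c)"
  by algebra

lemma decompose_by_complement:
  "a \<in> carrier R \<Longrightarrow> b \<in> carrier R \<Longrightarrow> a = a \<otimes> (\<one> \<ominus> b) \<oplus> a \<otimes> b"
  by algebra

lemma icomb_closed: "y \<in> icomb R I F \<Longrightarrow> I \<subseteq> carrier R \<Longrightarrow> F \<subseteq> carrier R \<Longrightarrow> y \<in> carrier R"
  by (induction rule: icomb.induct) (auto simp: subset_iff)

lemma icomb_add: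
  "y \<in> icomb R I F \<Longrightarrow> z \<in> icomb R I F \<Longrightarrow> I \<subseteq> carrier R \<Longrightarrow> F \<subseteq> carrier R \<Longrightarrow> y \<oplus> z \<in> icomb R I F"
proof (induction rule: icomb.induct)
  case (step a x y)
  then have "a \<otimes> x \<oplus> y \<oplus> z = a \<otimes> x \<oplus> (y \<oplus> z)"
    using icomb_closed by (intro a_assoc) (auto simp: subset_iff)
  with step show ?case by (simp add: icomb.step)
qed (auto simp: icomb_closed)

lemma icomb_mult:
  assumes I: "ideal I R" and F: "F \<subseteq> carrier R" and q: "q \<in> carrier R" and "y \<in> icomb R I F"
  shows "q \<otimes> y \<in> icomb R I F"
  using assms(4)
proof (induction rule: icomb.induct)
  case (step a x y)
  have IR: "I \<subseteq> carrier R" using ideal.Icarr[OF I] by blast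
  have "a \<in> carrier R" "x \<in> carrier R" "y \<in> carrier R" using step IR F icomb_closed by auto
  then have "q \<otimes> (a \<otimes> x \<oplus> y) = (q \<otimes> a) \<otimes> x \<oplus> q \<otimes> y" using q by (simp add: r_distr m_assoc)
  then show ?case using step ideal.I_l_closed[OF I step.hyps(1) q] by (simp add: icomb.step)
qed (use q in \<open>simp add: icomb.zero\<close>)

lemma icomb_ideal:
  assumes I: "ideal I R" and F: "F \<subseteq> carrier R"
  shows "ideal (icomb R I F) R"
proof (rule idealI[OF ring_axioms])
  have IR: "I \<subseteq> carrier R" using ideal.Icarr[OF I] by blast
  show "subgroup (icomb R I F) (add_monoid R)"
  proof (rule add.subgroupI)
    show "icomb R I F \<subseteq> carrier R" using icomb_closed IR F by blast
    show "icomb R I F \<noteq> {}" using icomb.zero by blast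
    fix a b assume a: "a \<in> icomb R I F" and b: "b \<in> icomb R I F"
    show "a \<oplus> b \<in> icomb R I F" using icomb_add[OF a b IR F] .
    have "\<ominus> a = (\<ominus> \<one>) \<otimes> a" using icomb_closed[OF a IR F] by (simp add: l_minus)
    then show "\<ominus> a \<in> icomb R I F" using icomb_mult[OF I F _ a, of "\<ominus> \<one>"] by simp
  qed
  fix a x assume a: "a \<in> icomb R I F" and x: "x \<in> carrier R"
  show "x \<otimes> a \<in> icomb R I F" by (rule icomb_mult[OF I F x a])
  then show "a \<otimes> x \<in> icomb R I F" using m_comm icomb_closed[OF a IR F] x by simp
qed

lemma icomb_base: "x \<in> F \<Longrightarrow> F \<subseteq> carrier R \<Longrightarrow> x \<in> icomb R (carrier R) F"
proof -
  assume x: "x \<in> F" "F \<subseteq> carrier R"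
  then have "\<one> \<otimes> x \<oplus> \<zero> \<in> icomb R (carrier R) F" by (intro icomb.step icomb.zero) auto
  then show ?thesis using x by (auto simp: subset_iff)
qed

lemma icomb_prod:
  assumes I: "ideal I R" and F: "F \<subseteq> carrier R" and a: "a \<in> I" and "b \<in> icomb R (carrier R) F"
  shows "a \<otimes> b \<in> icomb R I F"
  using assms(4)
proof (induction rule: icomb.induct)
  case zero
  then show ?case using ideal.Icarr[OF I a] by (simp add: icomb.zero)
next
  case (step q x y)
  have "a \<in> carrier R" "x \<in> carrier R" "y \<in> carrier R"
    using step F ideal.Icarr[OF I a] icomb_closed[OF _ subset_refl F] by auto
  then have "a \<otimes> (q \<otimes> x \<oplus> y) = (a \<otimes> q) \<otimes> x \<oplus> a \<otimes> y" using step.hyps(1) by (simp add: r_distr m_assoc)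
  then show ?case using step ideal.I_r_closed[OF I a step.hyps(1)] by (simp add: icomb.step)
qed

lemma icomb_insert:
  assumes "y \<in> icomb R I (insert x F)" and I: "ideal I R" and x: "x \<in> carrier R" and F: "F \<subseteq> carrier R"
  obtains a z where "a \<in> I" "z \<in> icomb R I F" "y = a \<otimes> x \<oplus> z"
proof -
  interpret I: ideal I R by fact
  have IR: "I \<subseteq> carrier R" using I.Icarr by blast
  have "\<exists>a\<in>I. \<exists>z\<in>icomb R I F. y = a \<otimes> x \<oplus> z"
    using assms(1)
  proof (induction rule: icomb.induct)
    case zero
    show ?case using x by (intro bexI[of _ \<zero>]) (auto intro: icomb.zero)
  next
    case (step b w y)
    then obtain a z where az: "a \<in> I" "z \<in> icomb R I F" "y = a \<otimes> x \<oplus> z" by blast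
    have z: "z \<in> carrier R" using az icomb_closed IR F by blast
    have ab: "a \<in> carrier R" "b \<in> carrier R" using az step I.Icarr by auto
    show ?case
    proof (cases "w = x")
      case True
      have "b \<otimes> w \<oplus> y = (b \<oplus> a) \<otimes> x \<oplus> z"
        using True az(3) z ab x by (simp add: l_distr a_assoc)
      with az step show ?thesis by (meson I.a_closed)
    next
      case False
      then have w: "w \<in> F" using step by simp
      then have "b \<otimes> w \<oplus> y = a \<otimes> x \<oplus> (b \<otimes> w \<oplus> z)"
        using az(3) z ab x F by (simp add: subset_iff a_lcomm)
      with az step w show ?thesis by (meson icomb.step)
    qed
  qed
  then show ?thesis using that by blast
qed

text \<open>Nakayama's lemma is the case \<open>v = 1\<close>; a general \<open>v\<close> makes the induction on \<open>F\<close> go through.\<close>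

lemma nakayama:
  assumes I: "ideal I R" and "finite F" and F: "F \<subseteq> carrier R"
    and v: "v \<in> carrier R" "\<one> \<ominus> v \<in> I" "\<And>x. x \<in> F \<Longrightarrow> v \<otimes> x \<in> icomb R I F"
  shows "\<exists>u\<in>carrier R. \<one> \<ominus> u \<in> I \<and> (\<forall>x\<in>F. u \<otimes> x = \<zero>)"
  using assms(2-)
proof (induction F arbitrary: v)
  case empty
  then show ?case by blast
next
  case (insert x F)
  interpret I: ideal I R by fact
  have IR: "I \<subseteq> carrier R" using I.Icarr by blast
  have x: "x \<in> carrier R" and FR: "F \<subseteq> carrier R" using insert.prems by auto
  obtain j z where j: "j \<in> I" "z \<in> icomb R I F" "v \<otimes> x = j \<otimes> x \<oplus> z"
    using icomb_insert[OF insert.prems(4)[of x] I x FR] by blast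
  have jR: "j \<in> carrier R" and zR: "z \<in> carrier R" using j IR icomb_closed[OF _ IR FR] by auto
  \<comment> \<open>Moving \<open>j \<otimes> x\<close> to the other side expresses
    \<open>v' \<otimes> x\<close> through \<open>F\<close> alone, and \<open>v'\<close> is still
    congruent to \<open>1\<close> modulo \<open>I\<close>.\<close>
  define v' where "v' = v \<ominus> j"
  have v'R: "v' \<in> carrier R" using insert.prems jR by (simp add: v'_def)
  have "v' \<otimes> x = v \<otimes> x \<ominus> j \<otimes> x"
    using insert.prems(2) jR x unfolding v'_def by algebra
  also have "\<dots> = z" unfolding j(3) using jR zR x by algebra
  finally have v'x: "v' \<otimes> x = z" .
  have "\<one> \<ominus> v' = (\<one> \<ominus> v) \<oplus> j"
    using insert.prems(2) jR unfolding v'_def by algebra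
  then have v'I: "\<one> \<ominus> v' \<in> I" using insert.prems(3) j(1) by simp
  have "\<one> \<ominus> v \<otimes> v' = (\<one> \<ominus> v) \<oplus> v \<otimes> (\<one> \<ominus> v')"
    using insert.prems(2) v'R by algebra
  then have w: "\<one> \<ominus> v \<otimes> v' \<in> I"
    using insert.prems(2,3) v'I by (simp add: I.I_l_closed)
  \<comment> \<open>The extra factor \<open>v'\<close> turns the remaining occurrence of
    \<open>x\<close> into \<open>z\<close>, so \<open>v \<otimes> v'\<close> meets the induction
    hypothesis for \<open>F\<close>.\<close>
  have "(v \<otimes> v') \<otimes> f \<in> icomb R I F" if f: "f \<in> F" for f
  proof -
    have fR: "f \<in> carrier R" using f FR by blast
    obtain a y where a: "a \<in> I" "y \<in> icomb R I F" "v \<otimes> f = a \<otimes> x \<oplus> y"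
      using icomb_insert[OF insert.prems(4)[of f] I x FR] f by blast
    have cl: "a \<in> carrier R" "y \<in> carrier R" using a IR icomb_closed[OF _ IR FR] by auto
    have "(v \<otimes> v') \<otimes> f = v' \<otimes> (v \<otimes> f)" using insert.prems(2) v'R fR by algebra
    also have "\<dots> = a \<otimes> (v' \<otimes> x) \<oplus> v' \<otimes> y" unfolding a(3) using cl v'R x by algebra
    also have "\<dots> \<in> icomb R I F"
      unfolding v'x by (intro icomb_add icomb_mult[OF I FR] a j IR FR cl v'R)
    finally show ?thesis .
  qed
  then obtain u where u: "u \<in> carrier R" "\<one> \<ominus> u \<in> I" "\<forall>f\<in>F. u \<otimes> f = \<zero>"
    using insert.IH[OF FR _ w] insert.prems(2) v'R by auto
  \<comment> \<open>In particular \<open>u\<close> kills \<open>z\<close>, which is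
    \<open>v' \<otimes> x\<close>; so \<open>u \<otimes> v'\<close> kills \<open>x\<close> in
    addition to \<open>F\<close>.\<close>
  have kill: "u \<otimes> y = \<zero>" if "y \<in> icomb R I F" for y
    using that
  proof (induction rule: icomb.induct)
    case (step a f y)
    have cl: "a \<in> carrier R" "f \<in> carrier R" "y \<in> carrier R" using step IR FR icomb_closed[OF _ IR FR] by auto
    have "u \<otimes> (a \<otimes> f \<oplus> y) = a \<otimes> (u \<otimes> f) \<oplus> u \<otimes> y" using cl u(1) by algebra
    then show ?case using step u(3) cl by simp
  qed (use u(1) in simp)
  have "\<one> \<ominus> u \<otimes> v' = (\<one> \<ominus> u) \<oplus> u \<otimes> (\<one> \<ominus> v')" using u(1) v'R by algebra
  then have "\<one> \<ominus> u \<otimes> v' \<in> I" using u v'I by (simp add: I.I_l_closed)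
  moreover have "(u \<otimes> v') \<otimes> f = \<zero>" if "f \<in> insert x F" for f
  proof (cases "f = x")
    case True
    have "(u \<otimes> v') \<otimes> x = u \<otimes> z" using u(1) v'R x v'x by (simp add: m_assoc)
    then show ?thesis using True kill[OF j(2)] by simp
  next
    case False
    then have f: "f \<in> F" "f \<in> carrier R" using that FR by auto
    then have "(u \<otimes> v') \<otimes> f = v' \<otimes> (u \<otimes> f)" using u(1) v'R by algebra
    then show ?thesis using u(3) f v'R by simp
  qed
  ultimately show ?case using u(1) v'R by (intro bexI[of _ "u \<otimes> v'"]) auto
qed

end

context algebra_tensor
begin

text \<open>With \<open>J\<close> the ideal of \<open>R \<otimes> R\<close> generated by the elements \<open>w \<otimes> 1 - 1 \<otimes> w\<close> for \<open>w\<close> in \<open>W\<close>, the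
  separability idempotent of \<open>C\<close> shows that \<open>J\<close> is its own square, so that \<open>J\<close> is generated by an
  idempotent, whose complement is a separability idempotent of \<open>R\<close>.\<close>

lemma separable_of_slices:
  assumes \<gamma>: "algebra_hom k \<theta> C (\<lambda>a. pt (\<phi> a) \<one>\<^bsub>S\<^esub>) T \<gamma>" and sep: "separable_algebra k \<theta> C"
    and W: "finite W" "W \<subseteq> carrier R"
    and gen: "\<And>Z. subring Z R \<Longrightarrow> \<phi> ` carrier k \<subseteq> Z \<Longrightarrow> W \<subseteq> Z \<Longrightarrow> carrier R \<subseteq> Z"
    and slices: "\<And>w. w \<in> W \<Longrightarrow> \<exists>c\<in>carrier C. \<exists>\<xi>\<in>linear_forms k \<psi> S. w = lslice \<xi> (\<gamma> c)"
    and supp: "\<And>c. c \<in> carrier C \<Longrightarrow> \<gamma> c \<in> tsp (R.sp W) (carrier S)"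
  shows "separable_algebra k \<phi> R"
proof -
  interpret \<gamma>: algebra_hom k \<theta> C "\<lambda>a. pt (\<phi> a) \<one>\<^bsub>S\<^esub>" T \<gamma> by fact
  interpret CC: algebra_tensor k \<theta> C \<theta> C by (rule \<gamma>.A.square)
  interpret AA: algebra_tensor k \<phi> R \<phi> R by (rule R.square)
  let ?\<phi> = "\<lambda>a. AA.pt (\<phi> a) \<one>\<^bsub>R\<^esub>"
  \<comment> \<open>The ring R \<otimes> R \<otimes> S, which receives two copies of R \<otimes> S
    with common factor \<open>S\<close>.\<close>
  interpret QS: algebra_tensor k ?\<phi> AA.T \<psi> S by (rule algebra_tensor.intro) unfold_locales
  define i1 where "i1 r = AA.pt r \<one>\<^bsub>R\<^esub>" for r
  define i2 where "i2 r = AA.pt \<one>\<^bsub>R\<^esub> r" for r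
  have i1: "i1 \<in> ring_hom R AA.T" and i2: "i2 \<in> ring_hom R AA.T"
    using AA.left_hom AA.right_hom by (simp_all add: i1_def[abs_def] i2_def[abs_def])
  have i_scal: "i1 (\<phi> a) = ?\<phi> a" "i2 (\<phi> a) = ?\<phi> a" if "a \<in> carrier k" for a
    using AA.scalar_right[OF that] by (simp_all add: i1_def i2_def)
  note i1s = ring_hom_memE[OF i1] and i2s = ring_hom_memE[OF i2]
  have functor1: "tensor_functor k \<phi> R \<psi> S k ?\<phi> AA.T \<psi> S id i (\<lambda>s. s)"
    if "i \<in> ring_hom R AA.T" "\<And>a. a \<in> carrier k \<Longrightarrow> i (\<phi> a) = ?\<phi> a" for i
    by (intro tensor_functor.intro tensor_functor_axioms.intro QS.ts.tensor_setup_axioms ts.tensor_setup_axioms)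
      (use that in \<open>auto simp: ring_hom_def\<close>)
  \<comment> \<open>The two embeddings: \<open>th i1\<close> uses the first factor \<open>R\<close>
    and \<open>th i2\<close> the second, both leaving \<open>S\<close> in place.\<close>
  define th where "th i = tensor_map k ?\<phi> AA.T \<psi> S i (\<lambda>s. s)"
    for i :: "'a \<Rightarrow> ('a \<times> 'a \<Rightarrow>\<^sub>0 int) set"
  have th_hom: "th i \<in> ring_hom T QS.T"
    and th_pure: "\<And>r s. r \<in> carrier R \<Longrightarrow> s \<in> carrier S \<Longrightarrow> th i (pt r s) = QS.pt (i r) s"
    if "i \<in> ring_hom R AA.T" "\<And>a. a \<in> carrier k \<Longrightarrow> i (\<phi> a) = ?\<phi> a" for i
    using tensor_functor.map_hom[OF functor1[OF that]] tensor_functor.map_pure[OF functor1[OF that]]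
    by (simp_all add: th_def)
  note t1 = ring_hom_memE[OF th_hom[OF i1 i_scal(1)]] and t2 = ring_hom_memE[OF th_hom[OF i2 i_scal(2)]]
  note p1 = th_pure[OF i1 i_scal(1)] and p2 = th_pure[OF i2 i_scal(2)]
  define x where "x r = i1 r \<ominus>\<^bsub>AA.T\<^esub> i2 r" for r
  have xQ: "x r \<in> carrier AA.T" if "r \<in> carrier R" for r using that i1s(1) i2s(1) by (simp add: x_def)
  define F where "F = x ` W"
  have F: "finite F" "F \<subseteq> carrier AA.T" using W xQ by (auto simp: F_def)
  define J where "J = icomb AA.T (carrier AA.T) F"
  \<comment> \<open>The square of \<open>J\<close>, since \<open>F\<close> generates
    \<open>J\<close>. In this form \<open>F \<subseteq> J2\<close> is precisely the hypothesis of
    Nakayama's lemma.\<close>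
  define J2 where "J2 = icomb AA.T J F"
  have J: "ideal J AA.T" unfolding J_def by (rule AA.ts.T.icomb_ideal[OF AA.ts.T.oneideal F(2)])
  have J2: "ideal J2 AA.T" unfolding J2_def by (rule AA.ts.T.icomb_ideal[OF J F(2)])
  interpret J: ideal J AA.T by (rule J)
  interpret J2: ideal J2 AA.T by (rule J2)
  have JQ: "J \<subseteq> carrier AA.T" and J2Q: "J2 \<subseteq> carrier AA.T" using J.Icarr J2.Icarr by auto
  have x_J: "x r \<in> J" if "r \<in> R.sp W" for r
    using that
  proof (induction rule: lspan.induct)
    case zero
    have "x \<zero>\<^bsub>R\<^esub> = \<zero>\<^bsub>AA.T\<^esub>" by (simp add: x_def i1_def i2_def AA.pt_zero_left AA.pt_zero_right a_minus_def)
    then show ?case by simp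
  next
    case (step a w y)
    have cl: "w \<in> carrier R" "y \<in> carrier R" using step W R.sp_closed by auto
    have "x (\<phi> a \<otimes>\<^bsub>R\<^esub> w \<oplus>\<^bsub>R\<^esub> y) = (?\<phi> a \<otimes>\<^bsub>AA.T\<^esub> i1 w \<oplus>\<^bsub>AA.T\<^esub> i1 y) \<ominus>\<^bsub>AA.T\<^esub> (?\<phi> a \<otimes>\<^bsub>AA.T\<^esub> i2 w \<oplus>\<^bsub>AA.T\<^esub> i2 y)"
      using cl step.hyps(1) by (simp add: x_def i1s i2s i_scal)
    also have "\<dots> = ?\<phi> a \<otimes>\<^bsub>AA.T\<^esub> x w \<oplus>\<^bsub>AA.T\<^esub> x y"
    proof -
      have "?\<phi> a \<in> carrier AA.T" "i1 w \<in> carrier AA.T" "i1 y \<in> carrier AA.T" "i2 w \<in> carrier AA.T" "i2 y \<in> carrier AA.T"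
        using cl step.hyps(1) i1s i2s by auto
      then show ?thesis unfolding x_def by algebra
    qed
    also have "\<dots> \<in> J"
    proof -
      have "x w \<in> F" using step.hyps(2) by (simp add: F_def)
      then have "x w \<in> J" unfolding J_def by (rule AA.ts.T.icomb_base[OF _ F(2)])
      then show ?thesis using step.IH step.hyps(1) by (simp add: J.I_l_closed)
    qed
    finally show ?case .
  qed
  \<comment> \<open>The counterpart of \<open>x\<close> for R \<otimes> S: the difference of the two
    copies of \<open>t\<close>. It lies in \<open>J\<close> \<otimes> \<open>S\<close> as soon as
    the left factors of \<open>t\<close> lie in the span of \<open>W\<close>, in particular for
    \<open>t\<close> coming from \<open>C\<close>.\<close>
  define g where "g t = th i1 t \<ominus>\<^bsub>QS.T\<^esub> th i2 t" for t
  have gT: "g t \<in> carrier QS.T" if "t \<in> carrier T" for t using that t1 t2 by (simp add: g_def)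
  have JS_add: "a \<oplus>\<^bsub>QS.T\<^esub> b \<in> QS.tsp J (carrier S)" if "a \<in> QS.tsp J (carrier S)" "b \<in> QS.tsp J (carrier S)" for a b
    using QS.tsp_add[OF that JQ subset_refl] .
  have g_J: "g t \<in> QS.tsp J (carrier S)" if "t \<in> tsp (R.sp W) (carrier S)" for t
    using that
  proof (induction rule: tspan.induct)
    case zero
    have "g (pt \<zero>\<^bsub>R\<^esub> \<zero>\<^bsub>S\<^esub>) = \<zero>\<^bsub>QS.T\<^esub>"
      by (simp add: g_def p1 p2 i1_def i2_def AA.pt_zero_left AA.pt_zero_right QS.pt_zero_left a_minus_def)
    then show ?case by (simp add: pt_zero_left tspan.zero)
  next
    case (step r s t)
    have cl: "r \<in> carrier R" "s \<in> carrier S" "t \<in> carrier T"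
      using step W(2) R.sp_closed tsp_closed[OF _ R.sp_subset] by auto
    have c: "th i1 t \<in> carrier QS.T" "th i2 t \<in> carrier QS.T" "QS.pt (i1 r) s \<in> carrier QS.T" "QS.pt (i2 r) s \<in> carrier QS.T"
      using cl t1 t2 i1s(1) i2s(1) by auto
    have "g (pt r s \<oplus>\<^bsub>T\<^esub> t) = (QS.pt (i1 r) s \<oplus>\<^bsub>QS.T\<^esub> th i1 t) \<ominus>\<^bsub>QS.T\<^esub> (QS.pt (i2 r) s \<oplus>\<^bsub>QS.T\<^esub> th i2 t)"
      using cl by (simp add: g_def t1 t2 p1 p2)
    also have "\<dots> = (QS.pt (i1 r) s \<ominus>\<^bsub>QS.T\<^esub> QS.pt (i2 r) s) \<oplus>\<^bsub>QS.T\<^esub> g t"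
      unfolding g_def using c by (simp add: QS.ts.T.add_minus_add)
    also have "QS.pt (i1 r) s \<ominus>\<^bsub>QS.T\<^esub> QS.pt (i2 r) s = QS.pt (x r) s"
      using cl i1s(1) i2s(1) by (simp add: x_def a_minus_def QS.pt_addl QS.pt_minus)
    finally show ?case using step x_J by (simp add: tspan.step)
  qed
  have mult_J: "t \<otimes>\<^bsub>QS.T\<^esub> b \<in> QS.tsp J (carrier S)" if t: "t \<in> carrier QS.T" and "b \<in> QS.tsp J (carrier S)" for t b
    using that(2)
  proof (induction rule: tspan.induct)
    case zero then show ?case using t by (simp add: tspan.zero)
  next
    case (step q s b)
    have cl: "q \<in> carrier AA.T" "b \<in> carrier QS.T" using step JQ QS.tsp_closed[OF _ JQ subset_refl] by auto
    have "t \<otimes>\<^bsub>QS.T\<^esub> QS.pt q s \<in> QS.tsp J (carrier S)"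
      using t
    proof (induction rule: QS.T_induct)
      case (pure q' s')
      then show ?case using cl step by (simp add: QS.pt_mult J.I_l_closed QS.tsp_base JQ)
    next
      case (add y z)
      then show ?case using cl step by (simp add: QS.ts.T.l_distr JS_add)
    qed
    then show ?case using step t cl by (simp add: QS.ts.T.r_distr JS_add)
  qed
  have J2S_add: "a \<oplus>\<^bsub>QS.T\<^esub> b \<in> QS.tsp J2 (carrier S)" if "a \<in> QS.tsp J2 (carrier S)" "b \<in> QS.tsp J2 (carrier S)" for a b
    using QS.tsp_add[OF that J2Q subset_refl] .
  have mult_J2: "a \<otimes>\<^bsub>QS.T\<^esub> b \<in> QS.tsp J2 (carrier S)" if a: "a \<in> QS.tsp J (carrier S)" and b: "b \<in> QS.tsp J (carrier S)" for a b
    using a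
  proof (induction rule: tspan.induct)
    case zero then show ?case using QS.tsp_closed[OF b JQ subset_refl] by (simp add: tspan.zero)
  next
    case (step q s a)
    have cl: "q \<in> carrier AA.T" "a \<in> carrier QS.T" using step JQ QS.tsp_closed[OF _ JQ subset_refl] by auto
    have "QS.pt q s \<otimes>\<^bsub>QS.T\<^esub> b \<in> QS.tsp J2 (carrier S)"
      using b
    proof (induction rule: tspan.induct)
      case zero then show ?case using cl step by (simp add: tspan.zero)
    next
      case (step q' s' b)
      have cl': "q' \<in> carrier AA.T" "b \<in> carrier QS.T" using step JQ QS.tsp_closed[OF _ JQ subset_refl] by auto
      have "q \<otimes>\<^bsub>AA.T\<^esub> q' \<in> J2"
        unfolding J2_def using \<open>q \<in> J\<close> \<open>q' \<in> J\<close> by (intro AA.ts.T.icomb_prod[OF J F(2)]) (simp_all add: J_def)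
      then show ?case using cl cl' step \<open>s \<in> carrier S\<close>
        by (simp add: QS.ts.T.r_distr QS.pt_mult J2S_add QS.tsp_base J2Q)
    qed
    then show ?case using step cl QS.tsp_closed[OF b JQ subset_refl] by (simp add: QS.ts.T.l_distr J2S_add)
  qed
  have \<gamma>T: "\<gamma> c \<in> carrier T" if "c \<in> carrier C" for c using \<gamma>.f_simps(1) that .
  have hom1: "algebra_hom k \<theta> C (\<lambda>a. QS.pt (?\<phi> a) \<one>\<^bsub>S\<^esub>) QS.T (\<lambda>c. th i1 (\<gamma> c))"
    by unfold_locales
      (use ring_hom_trans[OF \<gamma>.f_hom th_hom[OF i1 i_scal(1)]] in \<open>auto simp: comp_def \<gamma>.f_scalar p1 i_scal\<close>)
  have hom2: "algebra_hom k \<theta> C (\<lambda>a. QS.pt (?\<phi> a) \<one>\<^bsub>S\<^esub>) QS.T (\<lambda>c. th i2 (\<gamma> c))"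
    by unfold_locales
      (use ring_hom_trans[OF \<gamma>.f_hom th_hom[OF i2 i_scal(2)]] in \<open>auto simp: comp_def \<gamma>.f_scalar p2 i_scal\<close>)
  \<comment> \<open>Maps C \<otimes> C to R \<otimes> R \<otimes> S, the left factor through the
    first copy and the right factor through the second. The commutation property of \<open>u\<close>
    says that its image is killed by all differences of the two copies of \<open>C\<close>.\<close>
  define \<Theta> where "\<Theta> = CC.lift QS.T (\<lambda>c d. th i1 (\<gamma> c) \<otimes>\<^bsub>QS.T\<^esub> th i2 (\<gamma> d))"
  note \<Theta>s = ring_hom_memE[OF CC.copair_hom[OF hom1 hom2], folded \<Theta>_def]
  note \<Theta>_pure = CC.copair_pure[OF hom1 hom2, folded \<Theta>_def]
  obtain u where u: "u \<in> carrier CC.T"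
    "\<And>c. c \<in> carrier C \<Longrightarrow> CC.pt c \<one>\<^bsub>C\<^esub> \<otimes>\<^bsub>CC.T\<^esub> u = CC.pt \<one>\<^bsub>C\<^esub> c \<otimes>\<^bsub>CC.T\<^esub> u" "\<gamma>.A.mu u = \<one>\<^bsub>C\<^esub>"
    using sep unfolding separable_algebra_def by blast
  have g_kill: "g (\<gamma> c) \<otimes>\<^bsub>QS.T\<^esub> \<Theta> u = \<zero>\<^bsub>QS.T\<^esub>" if c: "c \<in> carrier C" for c
  proof -
    have "\<Theta> (CC.pt c \<one>\<^bsub>C\<^esub> \<otimes>\<^bsub>CC.T\<^esub> u) = \<Theta> (CC.pt \<one>\<^bsub>C\<^esub> c \<otimes>\<^bsub>CC.T\<^esub> u)" using u(2)[OF c] by simp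
    then have "th i1 (\<gamma> c) \<otimes>\<^bsub>QS.T\<^esub> \<Theta> u = th i2 (\<gamma> c) \<otimes>\<^bsub>QS.T\<^esub> \<Theta> u"
      using c u(1) \<gamma>T t1 t2 by (simp add: \<Theta>s \<Theta>_pure \<gamma>.f_simps(4))
    then show ?thesis
      using c \<gamma>T t1(1) t2(1) \<Theta>s(1)[OF u(1)] by (simp add: g_def a_minus_def QS.ts.T.l_distr QS.ts.T.l_minus QS.ts.T.r_neg)
  qed
  \<comment> \<open>Modulo \<open>J\<close> \<otimes> \<open>S\<close> both copies of
    \<open>C\<close> agree, so there \<Theta> becomes multiplication in \<open>C\<close>. At
    \<open>u\<close> this makes \<Theta> u congruent to \<open>1\<close>.\<close>
  have diff_J: "th i1 (\<gamma> (\<gamma>.A.mu w)) \<ominus>\<^bsub>QS.T\<^esub> \<Theta> w \<in> QS.tsp J (carrier S)" if "w \<in> carrier CC.T" for w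
    using that
  proof (induction rule: CC.T_induct)
    case (pure c d)
    have c: "th i1 (\<gamma> c) \<in> carrier QS.T" "th i1 (\<gamma> d) \<in> carrier QS.T" "th i2 (\<gamma> d) \<in> carrier QS.T"
      using pure \<gamma>T t1 t2 by auto
    have "th i1 (\<gamma> (\<gamma>.A.mu (CC.pt c d))) \<ominus>\<^bsub>QS.T\<^esub> \<Theta> (CC.pt c d) =
        th i1 (\<gamma> c) \<otimes>\<^bsub>QS.T\<^esub> th i1 (\<gamma> d) \<ominus>\<^bsub>QS.T\<^esub> th i1 (\<gamma> c) \<otimes>\<^bsub>QS.T\<^esub> th i2 (\<gamma> d)"
      using pure \<gamma>T by (simp add: \<gamma>.A.mu_pure \<Theta>_pure \<gamma>.f_simps(2) t1(2))
    also have "\<dots> = th i1 (\<gamma> c) \<otimes>\<^bsub>QS.T\<^esub> g (\<gamma> d)" unfolding g_def using c by (simp add: QS.ts.T.mult_minus_mult)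
    finally show ?case using mult_J[OF c(1) g_J[OF supp[OF pure(2)]]] by simp
  next
    case (add v w)
    let ?f = "\<lambda>w. th i1 (\<gamma> (\<gamma>.A.mu w))"
    have c: "?f v \<in> carrier QS.T" "?f w \<in> carrier QS.T" "\<Theta> v \<in> carrier QS.T" "\<Theta> w \<in> carrier QS.T"
      using add \<Theta>s(1) t1(1) \<gamma>T \<gamma>.A.mu_closed by auto
    have "?f (v \<oplus>\<^bsub>CC.T\<^esub> w) \<ominus>\<^bsub>QS.T\<^esub> \<Theta> (v \<oplus>\<^bsub>CC.T\<^esub> w) = (?f v \<oplus>\<^bsub>QS.T\<^esub> ?f w) \<ominus>\<^bsub>QS.T\<^esub> (\<Theta> v \<oplus>\<^bsub>QS.T\<^esub> \<Theta> w)"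
      using add \<gamma>T by (simp add: \<gamma>.A.mu_add \<gamma>.A.mu_closed \<gamma>.f_simps(3) t1(3) \<Theta>s(3))
    also have "\<dots> = (?f v \<ominus>\<^bsub>QS.T\<^esub> \<Theta> v) \<oplus>\<^bsub>QS.T\<^esub> (?f w \<ominus>\<^bsub>QS.T\<^esub> \<Theta> w)"
      using c by (intro QS.ts.T.add_minus_add)
    finally show ?case using add JS_add by simp
  qed
  have one_J: "\<one>\<^bsub>QS.T\<^esub> \<ominus>\<^bsub>QS.T\<^esub> \<Theta> u \<in> QS.tsp J (carrier S)"
    using diff_J[OF u(1)] u(3) by (simp add: \<gamma>.f_simps(4) t1(4))
  \<comment> \<open>As \<Theta> u kills the difference, only its product with 1 - \<Theta> u
    remains, and both factors lie in \<open>J\<close> \<otimes> \<open>S\<close>.\<close>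
  have g_J2: "g (\<gamma> c) \<in> QS.tsp J2 (carrier S)" if c: "c \<in> carrier C" for c
  proof -
    have cl: "g (\<gamma> c) \<in> carrier QS.T" "\<Theta> u \<in> carrier QS.T" using gT \<gamma>T c \<Theta>s(1) u(1) by auto
    have "g (\<gamma> c) = g (\<gamma> c) \<otimes>\<^bsub>QS.T\<^esub> (\<one>\<^bsub>QS.T\<^esub> \<ominus>\<^bsub>QS.T\<^esub> \<Theta> u) \<oplus>\<^bsub>QS.T\<^esub> g (\<gamma> c) \<otimes>\<^bsub>QS.T\<^esub> \<Theta> u"
      using cl by (rule QS.ts.T.decompose_by_complement)
    also have "\<dots> = g (\<gamma> c) \<otimes>\<^bsub>QS.T\<^esub> (\<one>\<^bsub>QS.T\<^esub> \<ominus>\<^bsub>QS.T\<^esub> \<Theta> u)" using g_kill[OF c] cl by simp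
    finally show ?thesis using mult_J2[OF g_J[OF supp[OF c]] one_J] by simp
  qed
  have slice_g: "QS.lslice \<xi> (g t) = x (lslice \<xi> t)" if \<xi>: "\<xi> \<in> linear_forms k \<psi> S" and t: "t \<in> carrier T" for \<xi> t
  proof -
    have 1: "QS.lslice \<xi> (th i1 t) = i1 (lslice \<xi> t)"
      using t
    proof (induction rule: T_induct)
      case (pure r s)
      then show ?case using linear_formsD(1)[OF \<xi>] i1s(1)
        by (simp add: p1 QS.lslice_pure[OF \<xi>] lslice_pure[OF \<xi>] i1s(2) i_scal)
    next
      case (add y z) then show ?case using t1(1)
        by (simp add: t1(3) QS.lslice_add[OF \<xi>] lslice_add[OF \<xi>] lslice_closed[OF \<xi>] i1s(3))
    qed
    have 2: "QS.lslice \<xi> (th i2 t) = i2 (lslice \<xi> t)"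
      using t
    proof (induction rule: T_induct)
      case (pure r s)
      then show ?case using linear_formsD(1)[OF \<xi>] i2s(1)
        by (simp add: p2 QS.lslice_pure[OF \<xi>] lslice_pure[OF \<xi>] i2s(2) i_scal)
    next
      case (add y z) then show ?case using t2(1)
        by (simp add: t2(3) QS.lslice_add[OF \<xi>] lslice_add[OF \<xi>] lslice_closed[OF \<xi>] i2s(3))
    qed
    have "QS.lslice \<xi> (\<ominus>\<^bsub>QS.T\<^esub> th i2 t) = \<ominus>\<^bsub>AA.T\<^esub> QS.lslice \<xi> (th i2 t)"
      by (rule additive_minus[OF QS.ts.T.abelian_group_axioms AA.ts.T.abelian_group_axioms])
        (use QS.lslice_closed[OF \<xi>] QS.lslice_add[OF \<xi>] t2(1) t in auto)
    then show ?thesis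
      using t t1(1) t2(1) by (simp add: g_def a_minus_def QS.lslice_add[OF \<xi>] 1 2 x_def)
  qed
  \<comment> \<open>Each generator of \<open>J\<close> is a slice of the difference of the two
    copies of an element of \<open>C\<close>, and slicing along \<open>S\<close> maps
    \<open>J2\<close> \<otimes> \<open>S\<close> into \<open>J2\<close>.\<close>
  have F_J2: "f \<in> J2" if f: "f \<in> F" for f
  proof -
    obtain w where w: "w \<in> W" "f = x w" using f by (auto simp: F_def)
    obtain c \<xi> where c: "c \<in> carrier C" "\<xi> \<in> linear_forms k \<psi> S" "w = lslice \<xi> (\<gamma> c)"
      using slices[OF w(1)] by blast
    have "QS.lslice \<xi> (g (\<gamma> c)) \<in> AA.T.sp J2"
      by (rule QS.lslice_tsp[OF c(2) J2Q subset_refl g_J2[OF c(1)]])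
    moreover have "AA.T.sp J2 \<subseteq> J2"
      by (rule AA.T.sp_least) (use J2Q in \<open>auto simp: J2.I_l_closed\<close>)
    ultimately show ?thesis using slice_g[OF c(2) \<gamma>T[OF c(1)]] c(3) w(2) by auto
  qed
  have "\<exists>v\<in>carrier AA.T. \<one>\<^bsub>AA.T\<^esub> \<ominus>\<^bsub>AA.T\<^esub> v \<in> J \<and> (\<forall>f\<in>F. v \<otimes>\<^bsub>AA.T\<^esub> f = \<zero>\<^bsub>AA.T\<^esub>)"
    by (rule AA.ts.T.nakayama[OF J F, of "\<one>\<^bsub>AA.T\<^esub>"])
      (use F_J2 F(2) in \<open>auto simp: J2_def[symmetric] a_minus_def AA.ts.T.r_neg subset_iff\<close>)
  then obtain v where v: "v \<in> carrier AA.T" "\<one>\<^bsub>AA.T\<^esub> \<ominus>\<^bsub>AA.T\<^esub> v \<in> J" "\<And>f. f \<in> F \<Longrightarrow> v \<otimes>\<^bsub>AA.T\<^esub> f = \<zero>\<^bsub>AA.T\<^esub>"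
    by blast
  interpret mu: ring_hom_ring AA.T R R.mu
    by (rule ring_hom_ringI2[OF AA.ts.T.ring_axioms R.R.ring_axioms R.mu_hom])
  have mu_J: "R.mu y = \<zero>\<^bsub>R\<^esub>" if "y \<in> J" for y
    using that unfolding J_def
  proof (induction rule: icomb.induct)
    case (step q f y)
    obtain w where w: "w \<in> W" "f = x w" using step by (auto simp: F_def)
    then have wR: "w \<in> carrier R" using W by blast
    have "R.mu f = \<zero>\<^bsub>R\<^esub>"
      using wR by (simp add: w(2) x_def a_minus_def i1_def i2_def R.mu_pure R.R.r_neg)
    moreover have "y \<in> carrier AA.T" using step AA.ts.T.icomb_closed[OF _ subset_refl F(2)] by blast
    ultimately show ?case using step xQ[OF wR] w by simp
  qed simp
  have "R.mu (\<one>\<^bsub>AA.T\<^esub> \<ominus>\<^bsub>AA.T\<^esub> v) = \<one>\<^bsub>R\<^esub> \<ominus>\<^bsub>R\<^esub> R.mu v" using v(1) by (simp add: a_minus_def)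
  then have "\<one>\<^bsub>R\<^esub> \<ominus>\<^bsub>R\<^esub> R.mu v = \<zero>\<^bsub>R\<^esub>" using mu_J[OF v(2)] by simp
  then have "R.mu v = \<one>\<^bsub>R\<^esub>" using R.R.r_right_minus_eq[of "\<one>\<^bsub>R\<^esub>" "R.mu v"] v(1) R.mu_closed by simp
  \<comment> \<open>Killing \<open>F\<close> means commuting with \<open>W\<close>; since
    \<open>W\<close> and the scalars generate \<open>R\<close>, \<open>v\<close> commutes with all
    of \<open>R\<close>.\<close>
  moreover have "carrier R \<subseteq> {r \<in> carrier R. AA.pt r \<one>\<^bsub>R\<^esub> \<otimes>\<^bsub>AA.T\<^esub> v = AA.pt \<one>\<^bsub>R\<^esub> r \<otimes>\<^bsub>AA.T\<^esub> v}"
  proof (rule gen[OF R.commuting_subring[OF v(1)]])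
    show "W \<subseteq> {r \<in> carrier R. AA.pt r \<one>\<^bsub>R\<^esub> \<otimes>\<^bsub>AA.T\<^esub> v = AA.pt \<one>\<^bsub>R\<^esub> r \<otimes>\<^bsub>AA.T\<^esub> v}"
    proof
      fix w assume w: "w \<in> W"
      then have wR: "w \<in> carrier R" using W by blast
      have cl: "i1 w \<in> carrier AA.T" "i2 w \<in> carrier AA.T" using i1s(1) i2s(1) wR by auto
      have "v \<otimes>\<^bsub>AA.T\<^esub> x w = \<zero>\<^bsub>AA.T\<^esub>" using v(3) w by (simp add: F_def)
      moreover have "i1 w \<otimes>\<^bsub>AA.T\<^esub> v = i2 w \<otimes>\<^bsub>AA.T\<^esub> v \<oplus>\<^bsub>AA.T\<^esub> v \<otimes>\<^bsub>AA.T\<^esub> x w"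
        unfolding x_def using cl v(1) by algebra
      ultimately have "i1 w \<otimes>\<^bsub>AA.T\<^esub> v = i2 w \<otimes>\<^bsub>AA.T\<^esub> v" using cl v(1) by simp
      then show "w \<in> {r \<in> carrier R. AA.pt r \<one>\<^bsub>R\<^esub> \<otimes>\<^bsub>AA.T\<^esub> v = AA.pt \<one>\<^bsub>R\<^esub> r \<otimes>\<^bsub>AA.T\<^esub> v}"
        using wR by (simp add: i1_def i2_def)
    qed
  qed (auto simp: AA.scalar_right)
  ultimately show ?thesis using v(1) unfolding separable_algebra_def by blast
qed

end


section \<open>The shift on algebras of finite dimension\<close>

context algebra_tensor
begin

lemma left_algebra_hom: "algebra_hom k \<phi> R (\<lambda>a. pt (\<phi> a) \<one>\<^bsub>S\<^esub>) T (\<lambda>r. pt r \<one>\<^bsub>S\<^esub>)"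
  by unfold_locales (auto simp: left_hom)

lemma right_algebra_hom: "algebra_hom k \<psi> S (\<lambda>a. pt (\<phi> a) \<one>\<^bsub>S\<^esub>) T (\<lambda>s. pt \<one>\<^bsub>R\<^esub> s)"
  by unfold_locales (auto simp: right_hom scalar_right)

section \<open>Exchange of the tensor factors and slices on the other side\<close>

lemma swapped: "algebra_tensor k \<psi> S \<phi> R"
  by (rule algebra_tensor.intro) unfold_locales

text \<open>Written as a copairing of the two embeddings, so that it is a ring homomorphism by
  \<open>copair_hom\<close>.\<close>

definition swap :: "('a \<times> 'b \<Rightarrow>\<^sub>0 int) set \<Rightarrow> ('b \<times> 'a \<Rightarrow>\<^sub>0 int) set"
  where "swap = lift (tensor_ring k \<psi> S \<phi> R) (\<lambda>r s. pure_tensor k \<psi> S \<phi> R \<one>\<^bsub>S\<^esub> r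
    \<otimes>\<^bsub>tensor_ring k \<psi> S \<phi> R\<^esub> pure_tensor k \<psi> S \<phi> R s \<one>\<^bsub>R\<^esub>)"

lemma swap_hom: "swap \<in> ring_hom T (tensor_ring k \<psi> S \<phi> R)"
proof -
  interpret SR: algebra_tensor k \<psi> S \<phi> R by (rule swapped)
  show ?thesis unfolding swap_def by (rule copair_hom[OF SR.right_algebra_hom SR.left_algebra_hom])
qed

lemma swap_pure: "r \<in> carrier R \<Longrightarrow> s \<in> carrier S \<Longrightarrow> swap (pt r s) = pure_tensor k \<psi> S \<phi> R s r"
proof -
  interpret SR: algebra_tensor k \<psi> S \<phi> R by (rule swapped)
  assume "r \<in> carrier R" "s \<in> carrier S"
  then show ?thesis
    unfolding swap_def by (subst copair_pure[OF SR.right_algebra_hom SR.left_algebra_hom]) (simp_all add: SR.pt_mult)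
qed

lemma swap_tsp:
  assumes "x \<in> tsp A B" "A \<subseteq> carrier R" "B \<subseteq> carrier S"
  shows "swap x \<in> tspan k \<psi> S \<phi> R B A"
  using assms(1)
proof -
  interpret SR: algebra_tensor k \<psi> S \<phi> R by (rule swapped)
  show ?thesis using assms(1)
  proof (induction rule: tspan.induct)
    case zero
    show ?case
      using ring_hom_zero[OF swap_hom ts.T.ring_axioms SR.ts.T.ring_axioms] by (simp add: tspan.zero)
  next
    case (step r s x)
    have "r \<in> carrier R" "s \<in> carrier S" "x \<in> carrier T" using step assms tsp_closed by auto
    then have "swap (pt r s \<oplus>\<^bsub>T\<^esub> x) = SR.pt s r \<oplus>\<^bsub>SR.T\<^esub> swap x"
      by (simp add: ring_hom_memE(3)[OF swap_hom] swap_pure)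
    then show ?case using step by (simp add: tspan.step)
  qed
qed

lemma swap_swap: "x \<in> carrier T \<Longrightarrow> algebra_tensor.swap k \<psi> S \<phi> R (swap x) = x"
proof (induction rule: T_induct)
  interpret SR: algebra_tensor k \<psi> S \<phi> R by (rule swapped)
  case (pure r s)
  then show ?case by (simp add: swap_pure SR.swap_pure)
next
  interpret SR: algebra_tensor k \<psi> S \<phi> R by (rule swapped)
  case (add x y)
  then show ?case
    by (simp add: ring_hom_memE(1,3)[OF swap_hom] ring_hom_memE(3)[OF SR.swap_hom])
qed

text \<open>The map \<xi> \<otimes> id from R \<otimes> S to k \<otimes> S = S.\<close>

definition rslice :: "('a \<Rightarrow> 'k) \<Rightarrow> ('a \<times> 'b \<Rightarrow>\<^sub>0 int) set \<Rightarrow> 'b"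
  where "rslice \<xi> x = algebra_tensor.lslice k \<psi> S \<phi> R \<xi> (swap x)"

lemma
  assumes \<xi>: "\<xi> \<in> linear_forms k \<phi> R"
  shows rslice_closed: "x \<in> carrier T \<Longrightarrow> rslice \<xi> x \<in> carrier S"
    and rslice_add: "x \<in> carrier T \<Longrightarrow> y \<in> carrier T \<Longrightarrow> rslice \<xi> (x \<oplus>\<^bsub>T\<^esub> y) = rslice \<xi> x \<oplus>\<^bsub>S\<^esub> rslice \<xi> y"
    and rslice_pure: "r \<in> carrier R \<Longrightarrow> s \<in> carrier S \<Longrightarrow> rslice \<xi> (pt r s) = \<psi> (\<xi> r) \<otimes>\<^bsub>S\<^esub> s"
proof -
  interpret SR: algebra_tensor k \<psi> S \<phi> R by (rule swapped)
  note h = ring_hom_memE[OF swap_hom]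
  show "x \<in> carrier T \<Longrightarrow> rslice \<xi> x \<in> carrier S"
    by (simp add: rslice_def SR.lslice_closed[OF \<xi>] h)
  show "x \<in> carrier T \<Longrightarrow> y \<in> carrier T \<Longrightarrow> rslice \<xi> (x \<oplus>\<^bsub>T\<^esub> y) = rslice \<xi> x \<oplus>\<^bsub>S\<^esub> rslice \<xi> y"
    by (simp add: rslice_def SR.lslice_add[OF \<xi>] h)
  show "r \<in> carrier R \<Longrightarrow> s \<in> carrier S \<Longrightarrow> rslice \<xi> (pt r s) = \<psi> (\<xi> r) \<otimes>\<^bsub>S\<^esub> s"
    by (simp add: rslice_def SR.lslice_pure[OF \<xi>] swap_pure)
qed

text \<open>In finite dimension the coordinate forms of a single basis detect zero. This reduces
  injectivity on R \<otimes> K to statements about coordinates in \<open>K\<close>.\<close>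

lemma rslices_zero:
  assumes G: "finite G" "R.indep G" and RG: "carrier R = R.sp G"
    and \<xi>: "\<And>g. g \<in> G \<Longrightarrow> \<xi> g \<in> linear_forms k \<phi> R"
      "\<And>r. r \<in> R.sp G \<Longrightarrow> r = (\<Oplus>\<^bsub>R\<^esub>g\<in>G. \<phi> (\<xi> g r) \<otimes>\<^bsub>R\<^esub> g)"
    and x: "x \<in> carrier T" and 0: "\<And>g. g \<in> G \<Longrightarrow> rslice (\<xi> g) x = \<zero>\<^bsub>S\<^esub>"
  shows "x = \<zero>\<^bsub>T\<^esub>"
proof -
  interpret SR: algebra_tensor k \<psi> S \<phi> R by (rule swapped)
  have GR: "G \<subseteq> carrier R" using G(2) by (simp add: R.indep_def)
  have "swap x \<in> carrier SR.T" using ring_hom_memE(1)[OF swap_hom x] .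
  then have "swap x \<in> SR.tsp (carrier S) (R.sp G)" using SR.tsp_carrier RG by simp
  from SR.slice_expansion[OF G(1) GR \<xi> this]
  have "swap x = (\<Oplus>\<^bsub>SR.T\<^esub>g\<in>G. SR.pt (rslice (\<xi> g) x) g)" by (simp add: rslice_def)
  also have "\<dots> = (\<Oplus>\<^bsub>SR.T\<^esub>g\<in>G. \<zero>\<^bsub>SR.T\<^esub>)"
    by (rule SR.ts.T.finsum_cong') (use GR in \<open>auto simp: 0 SR.pt_zero_left\<close>)
  finally have "swap x = \<zero>\<^bsub>SR.T\<^esub>" by simp
  then have "x = SR.swap \<zero>\<^bsub>SR.T\<^esub>" using swap_swap[OF x] by simp
  then show ?thesis
    using ring_hom_zero[OF SR.swap_hom SR.ts.T.ring_axioms ts.T.ring_axioms] by simp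
qed

end

locale field_difference_algebra = base: difference_field k + difference_algebra k R
  for k :: "('k, 'l) diff_ring_scheme" and R :: "('k, 'a, 'm) diff_alg_scheme" (structure)
begin

sublocale field_algebra k "struct_map R" R
  by unfold_locales (rule struct_map_hom)

lemmas sh = ring_hom_memE[OF shift_hom]
lemmas shk = ring_hom_memE[OF base.shift_hom]

text \<open>The shift is only semilinear, it also moves the scalars. The image of a span is
  therefore in general smaller than the span of the image, which is why spans of shifted sets appear
  throughout.\<close>

lemma shift_sp:
  assumes B: "B \<subseteq> carrier R" and "y \<in> sp B" shows "shift R y \<in> sp (shift R ` B)"
  using assms(2)
proof (induction rule: lspan.induct)
  case zero
  then show ?case using ring_hom_zero[OF shift_hom ring_axioms ring_axioms] by (simp add: lspan.zero)
next
  case (step a x y)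
  have cl: "x \<in> carrier R" "y \<in> carrier R" using step B sp_closed by auto
  have "shift R (struct_map R a \<otimes> x \<oplus> y) = struct_map R (shift k a) \<otimes> shift R x \<oplus> shift R y"
    using cl step.hyps(1) by (simp add: sh struct_map_shift)
  then show ?case using step shk(1) by (simp add: lspan.step)
qed

lemma shift_image_subset: "B \<subseteq> carrier R \<Longrightarrow> shift R ` B \<subseteq> carrier R"
  using sh(1) by blast

text \<open>Let \<open>G\<close> be a basis of \<open>sp F\<close>. The shifts of \<open>G\<close>
  span a space that contains \<open>G\<close> and has dimension at most \<open>card G\<close>. A
  shift of a member of \<open>G\<close> outside \<open>sp G\<close> would enlarge \<open>G\<close>
  to an independent set inside that space, which has no room for it.\<close>

lemma shift_stable_span:
  assumes F: "finite F" "F \<subseteq> carrier R" and sub: "F \<subseteq> sp (shift R ` F)"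
  shows "shift R ` sp F \<subseteq> sp F"
proof -
  obtain G where G: "G \<subseteq> F" "indep G" "sp G = sp F" using basis_exists[OF F] by blast
  have fG: "finite G" using G F finite_subset by blast
  have GR: "G \<subseteq> carrier R" using G F by blast
  have "F \<subseteq> sp G" using G(3) sp_base F by blast
  then have "shift R ` F \<subseteq> sp (shift R ` G)" using shift_sp[OF GR] by blast
  then have "sp (shift R ` F) \<subseteq> sp (shift R ` G)" by (rule sp_idem[OF _ shift_image_subset[OF GR]])
  then have Gsub: "G \<subseteq> sp (shift R ` G)" using G(1) sub by blast
  have "shift R g \<in> sp G" if g: "g \<in> G" for g
  proof (rule ccontr)
    assume n: "shift R g \<notin> sp G"
    have gR: "shift R g \<in> carrier R" using g GR sh(1) by blast
    have "indep (insert (shift R g) G)" by (rule indep_insert[OF G(2) gR n])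
    moreover have "insert (shift R g) G \<subseteq> sp (shift R ` G)"
      using Gsub g sp_base[OF _ shift_image_subset[OF GR]] by blast
    ultimately have "card (insert (shift R g) G) \<le> card (shift R ` G)"
      using steinitz[of "insert (shift R g) G" "shift R ` G"] fG shift_image_subset[OF GR] by blast
    moreover have "shift R g \<notin> G" using n sp_base[OF _ GR] by blast
    ultimately show False using fG card_image_le[OF fG, of "shift R"] by simp
  qed
  then have "sp (shift R ` G) \<subseteq> sp G" using sp_idem[OF _ GR] by blast
  then show ?thesis using shift_sp[OF GR] G(3) by blast
qed

text \<open>Separability is tested on the extension of \<open>k\<close> given by \<open>shift k\<close> itself: there every scalar
  of \<open>k\<close> acquires a preimage under the shift.\<close>

lemma span_shift_of_sigma_separable:
  assumes sep: "sigma_separable k R" and F: "finite F" "F \<subseteq> carrier R" "carrier R = sp F"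
  shows "carrier R \<subseteq> sp (shift R ` carrier R)"
proof
  define K :: "('k, 'k) diff_alg" where "K =
    \<lparr>carrier = carrier k, monoid.mult = monoid.mult k, monoid.one = \<one>\<^bsub>k\<^esub>, ring.zero = \<zero>\<^bsub>k\<^esub>,
     ring.add = ring.add k, shift = shift k, struct_map = shift k\<rparr>"
  have K_simps: "carrier K = carrier k" "monoid.mult K = monoid.mult k" "\<one>\<^bsub>K\<^esub> = \<one>\<^bsub>k\<^esub>"
    "\<zero>\<^bsub>K\<^esub> = \<zero>\<^bsub>k\<^esub>" "ring.add K = ring.add k" "shift K = shift k" "struct_map K = shift k"
    by (simp_all add: K_def)
  have "id \<in> ring_iso k K" by (auto simp: ring_iso_def ring_hom_def K_simps)
  moreover have "K\<lparr>ring.zero := id \<zero>\<^bsub>k\<^esub>\<rparr> = K" by (simp add: K_def)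
  ultimately interpret K: field K using base.ring_iso_imp_img_field[of id K] by simp
  have K: "difference_field K"
    by unfold_locales (use base.shift_hom in \<open>auto simp: ring_hom_def K_simps\<close>)
  have kK: "difference_algebra k K"
    by unfold_locales (use base.shift_hom in \<open>auto simp: ring_hom_def K_simps\<close>)
  interpret kK: field_difference_algebra k K
    by (intro field_difference_algebra.intro kK) unfold_locales
  have RA: "difference_algebra k R" by unfold_locales
  interpret RK: algebra_tensor k "struct_map R" R "struct_map K" K
    by (rule algebra_tensor.intro) unfold_locales
  interpret st: tensor_functor k "struct_map R" R "struct_map K" K k "struct_map R" R "struct_map K" K
    "shift k" "shift R" "shift K"
    by (rule tensor_shift_functor[OF RA kK])
  \<comment> \<open>\<open>K\<close> lives in the type of \<open>k\<close>, not in the one that the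
    definition of \<open>sigma_separable\<close> ranges over.\<close>
  have inj: "inj_on st.TM (carrier RK.T)"
    using sigma_separable_all_extensions[OF RA sep K kK] by simp
  note TM = ring_hom_memE[OF st.map_hom]
  \<comment> \<open>A combination of the \<sigma>(b) with coefficients a is, tensored with 1, the
    shift of the sum of the b \<otimes> a: in \<open>K\<close> the scalar a acts as \<sigma>(a) and
    can be moved across the tensor sign. The condition on forms expresses that the left factors of
    \<open>z\<close> come from the span of \<open>B\<close>.\<close>
  have lifted: "\<exists>z\<in>carrier RK.T. st.TM z = RK.pt y \<one>\<^bsub>K\<^esub> \<and>
      (\<forall>\<xi>\<in>linear_forms k (struct_map R) R. (\<forall>b\<in>B. \<xi> b = \<zero>\<^bsub>k\<^esub>) \<longrightarrow> RK.rslice \<xi> z = \<zero>\<^bsub>K\<^esub>)"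
    if B: "B \<subseteq> carrier R" and "y \<in> sp (shift R ` B)" for B y
    using that(2)
  proof (induction rule: lspan.induct)
    case zero
    have "st.TM (RK.pt \<zero> \<zero>\<^bsub>K\<^esub>) = RK.pt \<zero> \<one>\<^bsub>K\<^esub>"
      using ring_hom_zero[OF st.map_hom RK.ts.T.ring_axioms RK.ts.T.ring_axioms]
      by (simp add: RK.pt_zero_left)
    moreover have "RK.rslice \<xi> (RK.pt \<zero> \<zero>\<^bsub>K\<^esub>) = \<zero>\<^bsub>K\<^esub>" if "\<xi> \<in> linear_forms k (struct_map R) R" for \<xi>
      using that by (simp add: RK.rslice_pure lform_zero)
    ultimately show ?case by (intro bexI[of _ "RK.pt \<zero> \<zero>\<^bsub>K\<^esub>"]) auto
  next
    case (step a x y)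
    obtain b where b: "b \<in> B" "x = shift R b" using step.hyps(2) by blast
    then have bR: "b \<in> carrier R" using B by blast
    obtain z where z: "z \<in> carrier RK.T" "st.TM z = RK.pt y \<one>\<^bsub>K\<^esub>"
      "\<forall>\<xi>\<in>linear_forms k (struct_map R) R. (\<forall>b\<in>B. \<xi> b = \<zero>\<^bsub>k\<^esub>) \<longrightarrow> RK.rslice \<xi> z = \<zero>\<^bsub>K\<^esub>"
      using step.IH by blast
    have a: "a \<in> carrier K" using step.hyps(1) by (simp add: K_simps)
    have y: "y \<in> carrier R" using step.hyps(3) sp_closed shift_image_subset[OF B] by blast
    have "st.TM (RK.pt b a \<oplus>\<^bsub>RK.T\<^esub> z) = RK.pt (shift R b) (shift K a) \<oplus>\<^bsub>RK.T\<^esub> RK.pt y \<one>\<^bsub>K\<^esub>"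
      using bR a z by (simp add: TM st.map_pure)
    also have "RK.pt (shift R b) (shift K a) = RK.pt (struct_map R a \<otimes> x) \<one>\<^bsub>K\<^esub>"
      using RK.pt_balance[of a x "\<one>\<^bsub>K\<^esub>"] step.hyps(1) b(2) bR sh(1) kK.sh(1)[OF a] by (simp add: K_simps(6,7))
    also have "\<dots> \<oplus>\<^bsub>RK.T\<^esub> RK.pt y \<one>\<^bsub>K\<^esub> = RK.pt (struct_map R a \<otimes> x \<oplus> y) \<one>\<^bsub>K\<^esub>"
      using y b(2) bR sh(1) step.hyps(1) by (simp add: RK.pt_addl)
    finally have "st.TM (RK.pt b a \<oplus>\<^bsub>RK.T\<^esub> z) = RK.pt (struct_map R a \<otimes> x \<oplus> y) \<one>\<^bsub>K\<^esub>" .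
    moreover have "RK.rslice \<xi> (RK.pt b a \<oplus>\<^bsub>RK.T\<^esub> z) = \<zero>\<^bsub>K\<^esub>"
      if \<xi>: "\<xi> \<in> linear_forms k (struct_map R) R" "\<forall>b\<in>B. \<xi> b = \<zero>\<^bsub>k\<^esub>" for \<xi>
      using z \<xi> b(1) bR a by (simp add: RK.rslice_add RK.rslice_pure)
    ultimately show ?case using bR a z(1) by (intro bexI[of _ "RK.pt b a \<oplus>\<^bsub>RK.T\<^esub> z"]) auto
  qed
  obtain G where G: "G \<subseteq> F" "indep G" "sp G = sp F" using basis_exists[OF F(1,2)] by blast
  have fG: "finite G" using G F finite_subset by blast
  have GR: "G \<subseteq> carrier R" using G F by blast
  have sG: "shift R ` G \<subseteq> carrier R" using shift_image_subset[OF GR] .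
  \<comment> \<open>A dependence would give g \<otimes> 1 and an element with left factors from the
    other basis vectors the same shift. Injectivity identifies the two, and a form that is 1 at
    \<open>g\<close> and 0 at the others tells them apart.\<close>
  have not_in: "shift R g \<notin> sp (shift R ` (G - {g}))" if g: "g \<in> G" for g
  proof
    assume *: "shift R g \<in> sp (shift R ` (G - {g}))"
    have gR: "g \<in> carrier R" "G - {g} \<subseteq> carrier R" using g GR by auto
    obtain z where z: "z \<in> carrier RK.T" "st.TM z = RK.pt (shift R g) \<one>\<^bsub>K\<^esub>"
      "\<And>\<xi>. \<xi> \<in> linear_forms k (struct_map R) R \<Longrightarrow> (\<forall>b\<in>G - {g}. \<xi> b = \<zero>\<^bsub>k\<^esub>) \<Longrightarrow> RK.rslice \<xi> z = \<zero>\<^bsub>K\<^esub>"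
      using lifted[OF gR(2) *] by blast
    have "st.TM (RK.pt g \<one>\<^bsub>K\<^esub>) = RK.pt (shift R g) \<one>\<^bsub>K\<^esub>" using gR by (simp add: st.map_pure kK.sh)
    then have zg: "z = RK.pt g \<one>\<^bsub>K\<^esub>" using inj z gR by (auto simp: inj_on_def)
    have "g \<notin> sp (G - {g})" using G(2) g by (simp add: indep_def)
    then obtain \<xi> where \<xi>: "\<xi> \<in> linear_forms k (struct_map R) R" "\<xi> g = \<one>\<^bsub>k\<^esub>" "\<And>b. b \<in> G - {g} \<Longrightarrow> \<xi> b = \<zero>\<^bsub>k\<^esub>"
      using linear_form_exists[OF gR(2,1)] by blast
    have "RK.rslice \<xi> z = \<one>\<^bsub>K\<^esub>" unfolding zg using \<xi> gR by (simp add: RK.rslice_pure kK.hom_simps)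
    then show False using z(3)[OF \<xi>(1)] \<xi>(3) by auto
  qed
  have injG: "inj_on (shift R) G"
  proof (rule inj_onI, rule ccontr)
    fix g h assume *: "g \<in> G" "h \<in> G" "shift R g = shift R h" "g \<noteq> h"
    then have "shift R g \<in> shift R ` (G - {g})" by auto
    then show False using not_in[OF *(1)] sp_base sG by (meson Diff_subset image_mono order_trans)
  qed
  have ind: "indep (shift R ` G)"
    unfolding indep_def
  proof (intro conjI ballI sG)
    fix y assume "y \<in> shift R ` G"
    then obtain g where g: "g \<in> G" "y = shift R g" by blast
    have "shift R ` G - {y} = shift R ` (G - {g})" using g injG by (auto simp: inj_on_def)
    then show "y \<notin> sp (shift R ` G - {y})" using not_in[OF g(1)] g(2) by simp
  qed
  \<comment> \<open>The shifts of the basis \<open>G\<close> are independent and as many as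
    \<open>G\<close>, so by \<open>steinitz\<close> no element of \<open>R\<close> lies outside
    their span.\<close>
  fix a assume a: "a \<in> carrier R"
  show "a \<in> sp (shift R ` carrier R)"
  proof (rule ccontr)
    assume n: "a \<notin> sp (shift R ` carrier R)"
    have "sp (shift R ` G) \<subseteq> sp (shift R ` carrier R)"
      by (rule sp_mono) (use GR sh(1) in auto)
    then have n': "a \<notin> sp (shift R ` G)" using n by blast
    have "indep (insert a (shift R ` G))" by (rule indep_insert[OF ind a n'])
    moreover have "insert a (shift R ` G) \<subseteq> sp G" using a sG F(3) G(3) by auto
    ultimately have "card (insert a (shift R ` G)) \<le> card G"
      using steinitz[of "insert a (shift R ` G)" G] fG GR by simp
    moreover have "a \<notin> shift R ` G" using n' sp_base[OF _ sG] by blast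
    ultimately show False using fG card_image[OF injG] by simp
  qed
qed

text \<open>The hypothesis makes the shifts of a basis a basis again. In these two bases the shift
  of R \<otimes> K acts on each coordinate by the shift of \<open>K\<close>, which is injective as
  an endomorphism of a field.\<close>

lemma sigma_separable_of_span_shift:
  assumes F: "finite F" "F \<subseteq> carrier R" "carrier R = sp F" and sub: "carrier R \<subseteq> sp (shift R ` carrier R)"
  shows "sigma_separable k R"
  unfolding sigma_separable_def
proof (intro allI impI)
  fix K :: "('k, ('k \<times> nat) set) diff_alg" assume "difference_field K \<and> difference_algebra k K"
  then have K: "difference_field K" and kK: "difference_algebra k K" by auto
  interpret K: difference_field K by (rule K)
  interpret kK: field_difference_algebra k K
    by (intro field_difference_algebra.intro kK) unfold_locales
  have RA: "difference_algebra k R" by unfold_locales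
  interpret RK: algebra_tensor k "struct_map R" R "struct_map K" K
    by (rule algebra_tensor.intro) unfold_locales
  interpret st: tensor_functor k "struct_map R" R "struct_map K" K k "struct_map R" R "struct_map K" K
    "shift k" "shift R" "shift K"
    by (rule tensor_shift_functor[OF RA kK])
  note TM = ring_hom_memE[OF st.map_hom]
  obtain G where G: "G \<subseteq> F" "indep G" "sp G = sp F" using basis_exists[OF F(1,2)] by blast
  have fG: "finite G" using G F finite_subset by blast
  have GR: "G \<subseteq> carrier R" using G F by blast
  have sG: "shift R ` G \<subseteq> carrier R" using shift_image_subset[OF GR] .
  have RG: "carrier R = sp G" using F(3) G(3) by simp
  have "shift R ` carrier R \<subseteq> sp (shift R ` G)" using shift_sp[OF GR] RG by blast
  then have "carrier R \<subseteq> sp (shift R ` G)" using sub sp_idem[OF _ sG] by blast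
  obtain H where H: "H \<subseteq> shift R ` G" "indep H" "sp H = sp (shift R ` G)"
    using basis_exists[OF finite_imageI[OF fG] sG] by blast
  have fH: "finite H" using H fG finite_subset by blast
  have "G \<subseteq> sp H" using GR H(3) \<open>carrier R \<subseteq> sp (shift R ` G)\<close> by simp
  then have "card G \<le> card H" using steinitz[OF fG fH G(2)] H(1) sG by blast
  moreover have "card H \<le> card (shift R ` G)" using H(1) fG by (simp add: card_mono)
  moreover have "card (shift R ` G) \<le> card G" using fG by (rule card_image_le)
  ultimately have eq: "card (shift R ` G) = card G" "card H = card (shift R ` G)" by auto
  then have HG: "H = shift R ` G" using H(1) fG by (simp add: card_subset_eq)
  have injG: "inj_on (shift R) G" using eq(1) fG by (simp add: eq_card_imp_inj_on)
  obtain \<xi> where \<xi>: "\<And>g. g \<in> G \<Longrightarrow> \<xi> g \<in> linear_forms k (struct_map R) R"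
    "\<And>r. r \<in> sp G \<Longrightarrow> r = (\<Oplus>g\<in>G. struct_map R (\<xi> g r) \<otimes> g)"
    "\<And>g h. g \<in> G \<Longrightarrow> h \<in> G \<Longrightarrow> \<xi> g h = (if g = h then \<one>\<^bsub>k\<^esub> else \<zero>\<^bsub>k\<^esub>)"
    using dual_basis[OF fG G(2)] by blast
  obtain \<zeta> where \<zeta>: "\<And>g. g \<in> H \<Longrightarrow> \<zeta> g \<in> linear_forms k (struct_map R) R"
    "\<And>g h. g \<in> H \<Longrightarrow> h \<in> H \<Longrightarrow> \<zeta> g h = (if g = h then \<one>\<^bsub>k\<^esub> else \<zero>\<^bsub>k\<^esub>)"
    by (rule dual_basis[OF fH H(2)]) blast
  \<comment> \<open>The coordinate at \<sigma>(g) of a shifted element is the shift of its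
    coordinate at \<open>g\<close>; both sides are semilinear in \<open>r\<close> and agree on the
    basis.\<close>
  have zx: "\<zeta> (shift R g) (shift R r) = shift k (\<xi> g r)" if g: "g \<in> G" and "r \<in> carrier R" for g r
  proof -
    have gH: "shift R g \<in> H" using g HG by simp
    note z = linear_formsD[OF \<zeta>(1)[OF gH]] and x = linear_formsD[OF \<xi>(1)[OF g]]
    have s0: "shift k \<zero>\<^bsub>k\<^esub> = \<zero>\<^bsub>k\<^esub>" using ring_hom_zero[OF base.shift_hom base.ring_axioms base.ring_axioms] .
    have "r \<in> sp G" using that RG by simp
    then show ?thesis
    proof (induction rule: lspan.induct)
      case zero
      then show ?case
        using ring_hom_zero[OF shift_hom ring_axioms ring_axioms] s0
        by (simp add: lform_zero[OF \<zeta>(1)[OF gH]] lform_zero[OF \<xi>(1)[OF g]])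
    next
      case (step a h y)
      have cl: "h \<in> carrier R" "y \<in> carrier R" using step GR sp_closed by auto
      have "\<zeta> (shift R g) (shift R h) = shift k (\<xi> g h)"
        using \<zeta>(2)[OF gH, of "shift R h"] \<xi>(3)[OF g step.hyps(2)] HG step.hyps(2) inj_on_eq_iff[OF injG g step.hyps(2)] s0
        by (simp add: shk(4))
      then show ?case using cl step.hyps(1) step.IH
        by (simp add: sh struct_map_shift z x shk)
    qed
  qed
  have rs: "RK.rslice (\<zeta> (shift R g)) (st.TM y) = shift K (RK.rslice (\<xi> g) y)"
    if g: "g \<in> G" and y: "y \<in> carrier RK.T" for g y
    using y
  proof (induction rule: RK.T_induct)
    have gH: "shift R g \<in> H" using g HG by simp
    case (pure r s)
    then show ?case using zx[OF g pure(1)] linear_formsD(1)[OF \<xi>(1)[OF g]] sh(1) kK.sh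
      by (simp add: st.map_pure RK.rslice_pure[OF \<zeta>(1)[OF gH]] RK.rslice_pure[OF \<xi>(1)[OF g]] kK.struct_map_shift)
  next
    have gH: "shift R g \<in> H" using g HG by simp
    case (add x y)
    then show ?case using TM(1) RK.rslice_closed[OF \<xi>(1)[OF g]]
      by (simp add: TM(3) RK.rslice_add[OF \<zeta>(1)[OF gH]] RK.rslice_add[OF \<xi>(1)[OF g]] kK.sh)
  qed
  interpret shK: ring_hom_ring K K "shift K"
    by (rule ring_hom_ringI2[OF K.ring_axioms K.ring_axioms K.shift_hom])
  interpret TMh: ring_hom_ring RK.T RK.T st.TM
    by (rule ring_hom_ringI2[OF RK.ts.T.ring_axioms RK.ts.T.ring_axioms st.map_hom])
  have shK_inj: "c = \<zero>\<^bsub>K\<^esub>" if "c \<in> carrier K" "shift K c = \<zero>\<^bsub>K\<^esub>" for c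
  proof (rule ccontr)
    assume "c \<noteq> \<zero>\<^bsub>K\<^esub>"
    then have "inv\<^bsub>K\<^esub> c \<in> carrier K" "inv\<^bsub>K\<^esub> c \<otimes>\<^bsub>K\<^esub> c = \<one>\<^bsub>K\<^esub>" using that K.field_Units by auto
    then have "shift K (inv\<^bsub>K\<^esub> c) \<otimes>\<^bsub>K\<^esub> shift K c = \<one>\<^bsub>K\<^esub>" using that kK.sh(2,4) by metis
    then show False using that \<open>inv\<^bsub>K\<^esub> c \<in> carrier K\<close> by simp
  qed
  have ker: "z = \<zero>\<^bsub>RK.T\<^esub>" if z: "z \<in> carrier RK.T" "st.TM z = \<zero>\<^bsub>RK.T\<^esub>" for z
  proof (rule RK.rslices_zero[OF fG G(2) RG \<xi>(1,2) z(1)])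
    fix g assume g: "g \<in> G"
    have gH: "shift R g \<in> H" using g HG by simp
    have "RK.rslice (\<zeta> (shift R g)) \<zero>\<^bsub>RK.T\<^esub> = \<zero>\<^bsub>K\<^esub>"
      by (rule additive_zero[OF RK.ts.T.abelian_group_axioms K.abelian_group_axioms])
        (use RK.rslice_closed[OF \<zeta>(1)[OF gH]] RK.rslice_add[OF \<zeta>(1)[OF gH]] in auto)
    then have "shift K (RK.rslice (\<xi> g) z) = \<zero>\<^bsub>K\<^esub>" using rs[OF g z(1)] z(2) by simp
    then show "RK.rslice (\<xi> g) z = \<zero>\<^bsub>K\<^esub>" by (rule shK_inj[OF RK.rslice_closed[OF \<xi>(1)[OF g] z(1)]])
  qed auto
  have "inj_on st.TM (carrier RK.T)"
  proof (rule inj_onI)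
    fix x y assume xy: "x \<in> carrier RK.T" "y \<in> carrier RK.T" "st.TM x = st.TM y"
    then have "st.TM (x \<ominus>\<^bsub>RK.T\<^esub> y) = \<zero>\<^bsub>RK.T\<^esub>" by (simp add: a_minus_def RK.ts.T.r_neg)
    then show "x = y" using ker[of "x \<ominus>\<^bsub>RK.T\<^esub> y"] xy(1,2) by simp
  qed
  then show "inj_on (shift (tensor k R K)) (carrier (tensor k R K))" by simp
qed

end


section \<open>The strong core of a tensor product\<close>

lemma lspan_cong:
  assumes "\<And>x y. x \<otimes>\<^bsub>R\<^esub> y = x \<otimes>\<^bsub>R'\<^esub> y" "\<And>x y. x \<oplus>\<^bsub>R\<^esub> y = x \<oplus>\<^bsub>R'\<^esub> y" "\<zero>\<^bsub>R\<^esub> = \<zero>\<^bsub>R'\<^esub>"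
    "\<And>a. a \<in> carrier k \<Longrightarrow> \<phi> a = \<phi>' a"
  shows "lspan k \<phi> R B = lspan k \<phi>' R' B"
proof (intro equalityI subsetI)
  fix x assume "x \<in> lspan k \<phi> R B"
  then show "x \<in> lspan k \<phi>' R' B"
    by (induction rule: lspan.induct) (auto simp: assms intro: lspan.intros)
next
  fix x assume "x \<in> lspan k \<phi>' R' B"
  then show "x \<in> lspan k \<phi> R B"
    by (induction rule: lspan.induct) (auto simp: assms[symmetric] intro: lspan.intros)
qed

lemma lspan_carrier_update: "lspan k \<phi> (R\<lparr>carrier := A\<rparr>) B = lspan k \<phi> R B"
  by (rule lspan_cong) simp_all

lemma (in algebra_hom) image_sp:
  assumes "x \<in> A.sp Y" "Y \<subseteq> carrier A"
  shows "f x \<in> B.sp (f ` Y)"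
  using assms(1)
proof (induction rule: lspan.induct)
  case zero
  then show ?case using ring_hom_zero[OF f_hom A.R.ring_axioms B.R.ring_axioms] by (simp add: lspan.zero)
next
  case (step a x y)
  have "x \<in> carrier A" "y \<in> carrier A" using step assms(2) A.sp_closed by auto
  then have "f (\<phi> a \<otimes>\<^bsub>A\<^esub> x \<oplus>\<^bsub>A\<^esub> y) = \<psi> a \<otimes>\<^bsub>B\<^esub> f x \<oplus>\<^bsub>B\<^esub> f y"
    using step.hyps(1) by (simp add: f_simps f_scalar)
  then show ?case using step by (simp add: lspan.step)
qed

lemma (in ring) subring_of_subring:
  assumes E: "subring E R" and Z: "subring Z (R\<lparr>carrier := E\<rparr>)"
  shows "subring Z R"
proof -
  interpret E: ring "R\<lparr>carrier := E\<rparr>" by (rule subring_is_ring[OF E])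
  have ZE: "Z \<subseteq> E" using subringE(1)[OF Z] by simp
  then have "ring (R\<lparr>carrier := Z\<rparr>)" using E.subring_iff[of Z] Z by simp
  then show ?thesis using subring_iff[of Z] ZE subringE(1)[OF E] by blast
qed

section \<open>Core subalgebras\<close>

context field_difference_algebra
begin

lemma restrict_algebra:
  assumes A: "difference_subalgebra k A R"
  shows "field_difference_algebra k (R\<lparr>carrier := A\<rparr>)"
proof -
  have sub: "subring A R" and st: "struct_map R ` carrier k \<subseteq> A" and sA: "shift R ` A \<subseteq> A"
    using A by (auto simp: difference_subalgebra_def)
  have AR: "A \<subseteq> carrier R" by (rule subringE(1)[OF sub])
  interpret A: cring "R\<lparr>carrier := A\<rparr>"
    using sub subcring_iff[OF AR] subcringI'[OF sub] by blast
  show ?thesis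
  proof unfold_locales
    show "shift (R\<lparr>carrier := A\<rparr>) \<in> ring_hom (R\<lparr>carrier := A\<rparr>) (R\<lparr>carrier := A\<rparr>)"
      by (rule ring_hom_memI) (use sh sA AR in \<open>auto simp: subset_iff\<close>)
    show "struct_map (R\<lparr>carrier := A\<rparr>) \<in> ring_hom k (R\<lparr>carrier := A\<rparr>)"
      by (rule ring_hom_memI) (use hom_simps st in auto)
  qed (simp add: struct_map_shift)
qed

lemma sp_mult_closed:
  assumes Y: "Y \<subseteq> carrier R" "\<And>x y. x \<in> Y \<Longrightarrow> y \<in> Y \<Longrightarrow> x \<otimes> y \<in> Y"
    and x: "x \<in> sp Y" and y: "y \<in> sp Y"
  shows "x \<otimes> y \<in> sp Y"
  using x
proof (induction rule: lspan.induct)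
  case zero
  then show ?case using sp_closed[OF y Y(1)] by (simp add: lspan.zero)
next
  case (step a u v)
  have u: "u \<in> carrier R" "v \<in> carrier R" "y \<in> carrier R" using step Y(1) y sp_closed by auto
  have "u \<otimes> y \<in> sp Y"
    using y
  proof (induction rule: lspan.induct)
    case zero
    then show ?case using u by (simp add: lspan.zero)
  next
    case (step b w z)
    have "w \<in> carrier R" "z \<in> carrier R" using step Y(1) sp_closed by auto
    then have "u \<otimes> (struct_map R b \<otimes> w \<oplus> z) = struct_map R b \<otimes> (u \<otimes> w) \<oplus> u \<otimes> z"
      using u step.hyps(1) by (simp add: r_distr m_lcomm)
    then show ?case using step \<open>u \<in> Y\<close> Y(2) by (simp add: lspan.step)
  qed
  then have "struct_map R a \<otimes> (u \<otimes> y) \<oplus> v \<otimes> y \<in> sp Y"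
    using step Y(1) by (intro sp_add sp_smult)
  then show ?case using u step.hyps(1) by (simp add: l_distr m_assoc)
qed

text \<open>Both conclusions need checking on generators only, because the elements of
  \<open>E\<close> whose shift stays in \<open>E\<close> form a subring, and so does the span of the
  shifted \<open>E\<close>.\<close>

lemma generated_subalgebra:
  assumes Y: "Y \<subseteq> carrier R" and E: "E = generate_ring R (struct_map R ` carrier k \<union> Y)"
    and sY: "shift R ` Y \<subseteq> E" and Ysp: "Y \<subseteq> sp (shift R ` E)"
  shows "difference_subalgebra k E R" "E \<subseteq> sp (shift R ` E)"
proof -
  let ?gen = "struct_map R ` carrier k \<union> Y"
  have gen: "?gen \<subseteq> carrier R" using Y by auto
  have sub: "subring E R" unfolding E by (rule generate_ring_is_subring[OF gen])
  have ER: "E \<subseteq> carrier R" by (rule subringE(1)[OF sub])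
  have genE: "?gen \<subseteq> E" using generate_ring.incl[of _ ?gen R] unfolding E by blast
  note cl = subringE[OF sub]
  have sm: "shift R (\<ominus> x) = \<ominus> shift R x" if "x \<in> carrier R" for x
    by (rule additive_minus[OF abelian_group_axioms abelian_group_axioms]) (use sh that in auto)
  have "subring {x \<in> E. shift R x \<in> E} R"
    by (rule subringI) (use cl ER sh sm in \<open>auto simp: subset_iff\<close>)
  moreover have "?gen \<subseteq> {x \<in> E. shift R x \<in> E}"
    using genE sY struct_map_shift shk(1) by auto
  ultimately have "E \<subseteq> {x \<in> E. shift R x \<in> E}" unfolding E by (rule generate_ring_min_subring1[OF gen])
  then show "difference_subalgebra k E R" using sub genE by (auto simp: difference_subalgebra_def)
  have sE: "shift R ` E \<subseteq> carrier R" by (rule shift_image_subset[OF ER])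
  have one: "\<one> \<in> shift R ` E" using cl(3) sh(4) by (metis imageI)
  have "subring (sp (shift R ` E)) R"
  proof (rule subringI)
    show "sp (shift R ` E) \<subseteq> carrier R" by (rule sp_subset[OF sE])
    show "\<one> \<in> sp (shift R ` E)" by (rule sp_base[OF one sE])
    fix x y assume xy: "x \<in> sp (shift R ` E)" "y \<in> sp (shift R ` E)"
    show "\<ominus> x \<in> sp (shift R ` E)" by (rule sp_minus[OF xy(1) sE])
    show "x \<oplus> y \<in> sp (shift R ` E)" by (rule sp_add[OF xy sE])
    have "u \<otimes> v \<in> shift R ` E" if uv: "u \<in> shift R ` E" "v \<in> shift R ` E" for u v
    proof -
      obtain a b where ab: "a \<in> E" "u = shift R a" "b \<in> E" "v = shift R b" using uv by blast
      then have "a \<in> carrier R" "b \<in> carrier R" using ER by auto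
      then have "u \<otimes> v = shift R (a \<otimes> b)" using ab by (simp add: sh(2))
      then show ?thesis using ab cl(6) by blast
    qed
    then show "x \<otimes> y \<in> sp (shift R ` E)" by (rule sp_mult_closed[OF sE _ xy])
  qed
  moreover have "struct_map R a \<in> sp (shift R ` E)" if "a \<in> carrier k" for a
    using sp_smult[OF sp_base[OF one sE] that sE] that by simp
  then have "?gen \<subseteq> sp (shift R ` E)" using Ysp by blast
  ultimately show "E \<subseteq> sp (shift R ` E)" by (subst E) (rule generate_ring_min_subring1[OF gen])
qed

text \<open>The strongly \<sigma>-etale subalgebras in a form that mentions neither extension fields
  nor the algebraic closure.\<close>

definition core_subalgebra :: "'a set \<Rightarrow> bool"
  where "core_subalgebra A \<longleftrightarrow> difference_subalgebra k A R \<and>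
    separable_algebra k (struct_map R) (R\<lparr>carrier := A\<rparr>) \<and> A \<subseteq> sp (shift R ` A)"

text \<open>The two conditions are translated jointly: separability supplies the finite spanning set
  on which both directions of the criterion for \<sigma>-separability rely.\<close>

lemma strong_core_eq: "strong_core k R = \<Union>{A. core_subalgebra A}"
proof -
  have "strongly_sigma_etale k (R\<lparr>carrier := A\<rparr>) \<longleftrightarrow>
      separable_algebra k (struct_map R) (R\<lparr>carrier := A\<rparr>) \<and> A \<subseteq> sp (shift R ` A)"
    if A: "difference_subalgebra k A R" for A
  proof -
    interpret A: field_difference_algebra k "R\<lparr>carrier := A\<rparr>" by (rule restrict_algebra[OF A])
    have fa: "field_algebra k (struct_map R) (R\<lparr>carrier := A\<rparr>)"
      using A.field_algebra_axioms by simp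
    show ?thesis
      unfolding strongly_sigma_etale_def
      using etale_iff_separable[OF fa] A.separable_finite A.span_shift_of_sigma_separable
        A.sigma_separable_of_span_shift
      by (simp add: lspan_carrier_update) metis
  qed
  then show ?thesis unfolding strong_core_def core_subalgebra_def by blast
qed

lemma core_subalgebraE:
  assumes "core_subalgebra A"
  shows "subring A R" "A \<subseteq> carrier R" "struct_map R ` carrier k \<subseteq> A" "shift R ` A \<subseteq> A"
    "field_difference_algebra k (R\<lparr>carrier := A\<rparr>)"
    "separable_algebra k (struct_map R) (R\<lparr>carrier := A\<rparr>)" "A \<subseteq> sp (shift R ` A)"
  using assms restrict_algebra subringE(1)[of A R] by (auto simp: core_subalgebra_def difference_subalgebra_def)

text \<open>Puts the unit and the scalars into the strong core. The separability idempotent is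
  \<open>1\<close>, since scalars pass from one tensor factor to the other.\<close>

lemma core_subalgebra_scalars: "core_subalgebra (struct_map R ` carrier k)"
proof -
  let ?A = "struct_map R ` carrier k"
  interpret h: ring_hom_ring k R "struct_map R"
    by (rule ring_hom_ringI2[OF base.ring_axioms ring_axioms struct_map_hom])
  have "subring ?A R" by (rule h.img_is_subring[OF base.carrier_is_subring])
  moreover have "shift R ` ?A \<subseteq> ?A" using struct_map_shift shk(1) by auto
  ultimately have sub: "difference_subalgebra k ?A R" by (simp add: difference_subalgebra_def)
  interpret A: field_difference_algebra k "R\<lparr>carrier := ?A\<rparr>" by (rule restrict_algebra[OF sub])
  let ?RA = "R\<lparr>carrier := ?A\<rparr>"
  have fa: "field_algebra k (struct_map R) ?RA" using A.field_algebra_axioms by simp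
  interpret AA: algebra_tensor k "struct_map R" ?RA "struct_map R" ?RA
    by (rule algebra_tensor.intro[OF fa fa])
  have "separable_algebra k (struct_map R) ?RA"
    unfolding separable_algebra_def
  proof (intro bexI conjI ballI)
    show "tlift k (struct_map R) ?RA (struct_map R) ?RA ?RA (monoid.mult ?RA) \<one>\<^bsub>AA.T\<^esub> = \<one>\<^bsub>?RA\<^esub>"
      using field_algebra.mu_one[OF fa] .
    fix x assume "x \<in> carrier ?RA"
    then obtain a where a: "a \<in> carrier k" "x = struct_map R a" by auto
    have "AA.pt x \<one>\<^bsub>?RA\<^esub> = AA.pt \<one>\<^bsub>?RA\<^esub> x" unfolding a(2) by (rule AA.scalar_right[OF a(1)])
    then show "AA.pt x \<one>\<^bsub>?RA\<^esub> \<otimes>\<^bsub>AA.T\<^esub> \<one>\<^bsub>AA.T\<^esub> = AA.pt \<one>\<^bsub>?RA\<^esub> x \<otimes>\<^bsub>AA.T\<^esub> \<one>\<^bsub>AA.T\<^esub>" by simp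
  qed simp
  moreover have "?A \<subseteq> sp (shift R ` ?A)"
  proof
    fix x assume "x \<in> ?A"
    then obtain a where a: "a \<in> carrier k" "x = struct_map R a" by blast
    have sA: "shift R ` ?A \<subseteq> carrier R" by (rule shift_image_subset) auto
    have "\<one> = shift R (struct_map R \<one>\<^bsub>k\<^esub>)" by (simp add: hom_simps sh)
    then have "\<one> \<in> sp (shift R ` ?A)" using sp_base[OF _ sA] by blast
    then show "x \<in> sp (shift R ` ?A)" using sp_smult[OF _ a(1) sA, of \<one>] a by simp
  qed
  ultimately show ?thesis using sub by (simp add: core_subalgebra_def)
qed

text \<open>Stated for homomorphisms instead of subalgebras, as it serves for three pairs of maps:
  two inclusions, the embeddings of the two factors into a tensor product, and the exchange of
  factors taken twice.\<close>

lemma generated_core_subalgebra: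
  assumes A: "field_difference_algebra k A" and B: "field_difference_algebra k B"
    and f: "algebra_hom k (struct_map A) A (struct_map R) R f"
    and g: "algebra_hom k (struct_map B) B (struct_map R) R g"
    and fs: "\<And>x. x \<in> carrier A \<Longrightarrow> f (shift A x) = shift R (f x)"
    and gs: "\<And>x. x \<in> carrier B \<Longrightarrow> g (shift B x) = shift R (g x)"
    and sepA: "separable_algebra k (struct_map A) A" and sepB: "separable_algebra k (struct_map B) B"
    and spA: "carrier A \<subseteq> lspan k (struct_map A) A (shift A ` carrier A)"
    and spB: "carrier B \<subseteq> lspan k (struct_map B) B (shift B ` carrier B)"
  obtains E where "core_subalgebra E" "f ` carrier A \<subseteq> E" "g ` carrier B \<subseteq> E"
proof -
  interpret A: field_difference_algebra k A by fact
  interpret B: field_difference_algebra k B by fact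
  interpret f: algebra_hom k "struct_map A" A "struct_map R" R f by fact
  interpret g: algebra_hom k "struct_map B" B "struct_map R" R g by fact
  define Y where "Y = f ` carrier A \<union> g ` carrier B"
  define E where "E = generate_ring R (struct_map R ` carrier k \<union> Y)"
  have Y: "Y \<subseteq> carrier R" using f.f_simps(1) g.f_simps(1) by (auto simp: Y_def)
  have gen: "struct_map R ` carrier k \<union> Y \<subseteq> carrier R" using Y by auto
  have sub: "subring E R" unfolding E_def by (rule generate_ring_is_subring[OF gen])
  have ER: "E \<subseteq> carrier R" by (rule subringE(1)[OF sub])
  have YE: "Y \<subseteq> E" using generate_ring.incl[of _ "struct_map R ` carrier k \<union> Y" R] unfolding E_def by blast
  have sY: "shift R ` Y \<subseteq> E"
  proof -
    have "shift R ` Y \<subseteq> Y" unfolding Y_def using fs[symmetric] gs[symmetric] A.sh(1) B.sh(1) by auto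
    then show ?thesis using YE by blast
  qed
  have sE: "shift R ` E \<subseteq> carrier R" by (rule shift_image_subset[OF ER])
  have "f x \<in> sp (shift R ` E)" if x: "x \<in> carrier A" for x
  proof -
    have "f x \<in> sp (f ` shift A ` carrier A)"
      by (rule f.image_sp) (use x spA A.sh(1) in auto)
    moreover have "f ` shift A ` carrier A \<subseteq> shift R ` E" using fs YE by (auto simp: Y_def)
    ultimately show ?thesis using sp_mono[OF _ sE] by blast
  qed
  moreover have "g x \<in> sp (shift R ` E)" if x: "x \<in> carrier B" for x
  proof -
    have "g x \<in> sp (g ` shift B ` carrier B)"
      by (rule g.image_sp) (use x spB B.sh(1) in auto)
    moreover have "g ` shift B ` carrier B \<subseteq> shift R ` E" using gs YE by (auto simp: Y_def)
    ultimately show ?thesis using sp_mono[OF _ sE] by blast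
  qed
  ultimately have "Y \<subseteq> sp (shift R ` E)" by (auto simp: Y_def)
  note E = generated_subalgebra[OF Y E_def sY this]
  interpret E: field_difference_algebra k "R\<lparr>carrier := E\<rparr>" by (rule restrict_algebra[OF E(1)])
  have fE: "algebra_hom k (struct_map A) A (struct_map R) (R\<lparr>carrier := E\<rparr>) f"
  proof (intro algebra_hom.intro algebra_hom_axioms.intro A.field_algebra_axioms)
    show "field_algebra k (struct_map R) (R\<lparr>carrier := E\<rparr>)" using E.field_algebra_axioms by simp
    show "f \<in> ring_hom A (R\<lparr>carrier := E\<rparr>)"
      by (rule ring_hom_memI) (use f.f_simps YE in \<open>auto simp: Y_def\<close>)
  qed (rule f.f_scalar)
  have gE: "algebra_hom k (struct_map B) B (struct_map R) (R\<lparr>carrier := E\<rparr>) g"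
  proof (intro algebra_hom.intro algebra_hom_axioms.intro B.field_algebra_axioms)
    show "field_algebra k (struct_map R) (R\<lparr>carrier := E\<rparr>)" using E.field_algebra_axioms by simp
    show "g \<in> ring_hom B (R\<lparr>carrier := E\<rparr>)"
      by (rule ring_hom_memI) (use g.f_simps YE in \<open>auto simp: Y_def\<close>)
  qed (rule g.f_scalar)
  have "separable_algebra k (struct_map R) (R\<lparr>carrier := E\<rparr>)"
  proof (rule separable_generated[OF fE gE sepA sepB])
    fix Z assume Z: "subring Z (R\<lparr>carrier := E\<rparr>)" "f ` carrier A \<subseteq> Z" "g ` carrier B \<subseteq> Z"
    have "subring Z R" by (rule subring_of_subring[OF sub Z(1)])
    moreover have "struct_map R ` carrier k \<union> Y \<subseteq> Z"
      using Z(2,3) f.f_scalar[symmetric] by (auto simp: Y_def)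
    ultimately show "carrier (R\<lparr>carrier := E\<rparr>) \<subseteq> Z"
      using generate_ring_min_subring1[OF gen] by (simp add: E_def)
  qed
  then have "core_subalgebra E" using E by (simp add: core_subalgebra_def)
  then show ?thesis using YE by (intro that[of E]) (auto simp: Y_def)
qed

text \<open>The union defining the strong core is directed, as any two core subalgebras lie in a
  third one; so sums and products can be formed inside a single member.\<close>

lemma strong_core_subalgebra: "difference_subalgebra k (strong_core k R) R"
proof -
  have pair: "\<exists>E. core_subalgebra E \<and> x \<in> E \<and> y \<in> E"
    if xy: "x \<in> strong_core k R" "y \<in> strong_core k R" for x y
  proof -
    obtain A B where A: "core_subalgebra A" "x \<in> A" and B: "core_subalgebra B" "y \<in> B"
      using xy by (auto simp: strong_core_eq)
    note A' = core_subalgebraE[OF A(1)] and B' = core_subalgebraE[OF B(1)]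
    interpret A: field_difference_algebra k "R\<lparr>carrier := A\<rparr>" by (rule A'(5))
    interpret B: field_difference_algebra k "R\<lparr>carrier := B\<rparr>" by (rule B'(5))
    have incl: "algebra_hom k (struct_map (R\<lparr>carrier := C\<rparr>)) (R\<lparr>carrier := C\<rparr>) (struct_map R) R (\<lambda>x. x)"
      if "field_difference_algebra k (R\<lparr>carrier := C\<rparr>)" "C \<subseteq> carrier R" for C
    proof -
      interpret C: field_difference_algebra k "R\<lparr>carrier := C\<rparr>" by fact
      show ?thesis
        by (intro algebra_hom.intro algebra_hom_axioms.intro C.field_algebra_axioms field_algebra_axioms)
          (use that(2) in \<open>auto simp: ring_hom_def\<close>)
    qed
    obtain E where "core_subalgebra E" "(\<lambda>x. x) ` carrier (R\<lparr>carrier := A\<rparr>) \<subseteq> E"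
      "(\<lambda>x. x) ` carrier (R\<lparr>carrier := B\<rparr>) \<subseteq> E"
      by (rule generated_core_subalgebra[OF A'(5) B'(5) incl[OF A'(5,2)] incl[OF B'(5,2)]])
        (use A'(6,7) B'(6,7) in \<open>auto simp: lspan_carrier_update\<close>)
    then show ?thesis using A(2) B(2) by auto
  qed
  have inc: "E \<subseteq> strong_core k R" if "core_subalgebra E" for E using that by (auto simp: strong_core_eq)
  have "subring (strong_core k R) R"
  proof (rule subringI)
    show "strong_core k R \<subseteq> carrier R" using core_subalgebraE(2) by (auto simp: strong_core_eq)
    show "\<one> \<in> strong_core k R"
      using inc[OF core_subalgebra_scalars] subringE(3)[OF core_subalgebraE(1)[OF core_subalgebra_scalars]] by blast
    fix x y assume x: "x \<in> strong_core k R" and y: "y \<in> strong_core k R"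
    obtain E where E: "core_subalgebra E" "x \<in> E" "y \<in> E" using pair[OF x y] by blast
    note cl = subringE[OF core_subalgebraE(1)[OF E(1)]]
    show "\<ominus> x \<in> strong_core k R" using cl(5)[OF E(2)] inc[OF E(1)] by blast
    show "x \<otimes> y \<in> strong_core k R" using cl(6)[OF E(2,3)] inc[OF E(1)] by blast
    show "x \<oplus> y \<in> strong_core k R" using cl(7)[OF E(2,3)] inc[OF E(1)] by blast
  qed
  moreover have "struct_map R ` carrier k \<subseteq> strong_core k R" by (rule inc[OF core_subalgebra_scalars])
  moreover have "shift R ` strong_core k R \<subseteq> strong_core k R"
  proof
    fix y assume "y \<in> shift R ` strong_core k R"
    then obtain A x where "core_subalgebra A" "x \<in> A" "y = shift R x" by (auto simp: strong_core_eq)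
    then show "y \<in> strong_core k R" using core_subalgebraE(4)[of A] inc[of A] by blast
  qed
  ultimately show ?thesis by (simp add: difference_subalgebra_def)
qed

end

lemma lspan_tensor:
  "lspan k (struct_map (tensor k R S)) (tensor k R S) B =
    lspan k (\<lambda>a. pure_tensor k (struct_map R) R (struct_map S) S (struct_map R a) \<one>\<^bsub>S\<^esub>)
      (tensor_ring k (struct_map R) R (struct_map S) S) B"
  by (rule lspan_cong) simp_all

lemma tensor_field_difference_algebra:
  assumes "field_difference_algebra k R" "field_difference_algebra k S"
  shows "field_difference_algebra k (tensor k R S)"
  using assms tensor_difference_algebra[of k R S] by (simp add: field_difference_algebra_def)

lemma (in algebra_tensor) tsp_smult:
  assumes "x \<in> tsp A B" "A \<subseteq> carrier R" "B \<subseteq> carrier S" "a \<in> carrier k"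
    "\<And>r. r \<in> A \<Longrightarrow> \<phi> a \<otimes>\<^bsub>R\<^esub> r \<in> A"
  shows "pt (\<phi> a) \<one>\<^bsub>S\<^esub> \<otimes>\<^bsub>T\<^esub> x \<in> tsp A B"
  using assms(1)
proof (induction rule: tspan.induct)
  case zero
  then show ?case using assms(4) by (simp add: tspan.zero)
next
  case (step r s x)
  have "r \<in> carrier R" "s \<in> carrier S" "x \<in> carrier T" using step assms tsp_closed by auto
  then have "pt (\<phi> a) \<one>\<^bsub>S\<^esub> \<otimes>\<^bsub>T\<^esub> (pt r s \<oplus>\<^bsub>T\<^esub> x) = pt (\<phi> a \<otimes>\<^bsub>R\<^esub> r) s \<oplus>\<^bsub>T\<^esub> pt (\<phi> a) \<one>\<^bsub>S\<^esub> \<otimes>\<^bsub>T\<^esub> x"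
    using assms(4) by (simp add: ts.T.r_distr pt_mult)
  then show ?case using step assms(5) by (simp add: tspan.step)
qed

lemma (in algebra_tensor) span_subset_tsp:
  assumes "Y \<subseteq> tsp (R.sp W) B" "W \<subseteq> carrier R" "B \<subseteq> carrier S"
  shows "T.sp Y \<subseteq> tsp (R.sp W) B"
proof (rule T.sp_least)
  have W: "R.sp W \<subseteq> carrier R" by (rule R.sp_subset[OF assms(2)])
  show "tsp (R.sp W) B \<subseteq> carrier T" using tsp_closed[OF _ W assms(3)] by blast
  show "x \<oplus>\<^bsub>T\<^esub> y \<in> tsp (R.sp W) B" if "x \<in> tsp (R.sp W) B" "y \<in> tsp (R.sp W) B" for x y
    using tsp_add[OF that W assms(3)] .
  show "pt (\<phi> a) \<one>\<^bsub>S\<^esub> \<otimes>\<^bsub>T\<^esub> y \<in> tsp (R.sp W) B" if "a \<in> carrier k" "y \<in> tsp (R.sp W) B" for a y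
    by (rule tsp_smult[OF that(2) W assms(3) that(1)]) (use R.sp_smult that(1) assms(2) in blast)
qed (use assms in \<open>auto intro: tspan.zero\<close>)

section \<open>Tensor products of subalgebras inside the ambient tensor product\<close>

locale tensor_inclusion = A: algebra_tensor k \<phi> A \<psi> B + T: algebra_tensor k \<phi> R \<psi> S
  for k :: "('k, 'l) ring_scheme" and \<phi> :: "'k \<Rightarrow> 'a" and A :: "('a, 'm) ring_scheme"
    and \<psi> :: "'k \<Rightarrow> 'b" and B :: "('b, 'n) ring_scheme"
    and R :: "('a, 'o) ring_scheme" and S :: "('b, 'p) ring_scheme" +
  assumes id_left: "id \<in> ring_hom A R" and id_right: "id \<in> ring_hom B S"
begin

sublocale F: tensor_functor k \<phi> A \<psi> B k \<phi> R \<psi> S id id id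
  by (intro tensor_functor.intro tensor_functor_axioms.intro A.ts.tensor_setup_axioms T.ts.tensor_setup_axioms
      id_left id_right) simp_all

definition inc where "inc = tensor_map k \<phi> R \<psi> S (id :: 'a \<Rightarrow> 'a) (id :: 'b \<Rightarrow> 'b)"

lemma inc_hom: "inc \<in> ring_hom A.T T.T"
  unfolding inc_def by (rule F.map_hom)

lemma inc_pure: "a \<in> carrier A \<Longrightarrow> b \<in> carrier B \<Longrightarrow> inc (A.pt a b) = T.pt a b"
  unfolding inc_def using F.map_pure[of a b] by simp

text \<open>Pure tensors go to pure tensors with the same entries, so a span built in the smaller
  tensor product can be rebuilt in the larger one, term by term. This identifies
  \<open>tensor_image\<close> with a \<open>tspan\<close>.\<close>

lemma inc_tsp:
  assumes "A' \<subseteq> carrier A" "B' \<subseteq> carrier B"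
  shows "inc ` A.tsp A' B' = T.tsp A' B'"
proof (intro equalityI subsetI)
  note h = ring_hom_memE[OF inc_hom]
  have inc_zero: "inc \<zero>\<^bsub>A.T\<^esub> = \<zero>\<^bsub>T.T\<^esub>"
    by (rule ring_hom_zero[OF inc_hom A.ts.T.ring_axioms T.ts.T.ring_axioms])
  fix x
  {
    assume "x \<in> inc ` A.tsp A' B'"
    then obtain z where z: "z \<in> A.tsp A' B'" "x = inc z" by blast
    from z(1) have "inc z \<in> T.tsp A' B'"
    proof (induction rule: tspan.induct)
      case (step a b z)
      have "a \<in> carrier A" "b \<in> carrier B" "z \<in> carrier A.T" using step assms A.tsp_closed by auto
      then show ?case using step by (simp add: h inc_pure tspan.step)
    qed (simp add: inc_zero tspan.zero)
    then show "x \<in> T.tsp A' B'" using z(2) by simp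
  next
    assume "x \<in> T.tsp A' B'"
    then have "\<exists>z. z \<in> A.tsp A' B' \<and> x = inc z"
    proof (induction rule: tspan.induct)
      case zero
      show ?case by (rule exI[of _ "\<zero>\<^bsub>A.T\<^esub>"]) (simp add: inc_zero tspan.zero)
    next
      case (step a b x)
      then obtain z where z: "z \<in> A.tsp A' B'" "x = inc z" by blast
      have "a \<in> carrier A" "b \<in> carrier B" "z \<in> carrier A.T" using step z assms A.tsp_closed by auto
      then have "T.pt a b \<oplus>\<^bsub>T.T\<^esub> x = inc (A.pt a b \<oplus>\<^bsub>A.T\<^esub> z)" using z by (simp add: h inc_pure)
      then show ?case using step z tspan.step[of a A' b B' z k \<phi> A \<psi> B] by blast
    qed
    then show "x \<in> inc ` A.tsp A' B'" by blast
  }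
qed

end

lemma (in field_difference_algebra) restrict_inclusion:
  assumes "difference_subalgebra k A R"
  shows "id \<in> ring_hom (R\<lparr>carrier := A\<rparr>) R"
  using assms subringE(1)[of A R] by (auto simp: ring_hom_def difference_subalgebra_def)

text \<open>One half of the harder inclusion: the left factors of \<open>c\<close> can be taken from
  the strong core of \<open>R\<close>. Applied to the exchanged tensor product it also treats
  \<open>S\<close>.\<close>

lemma slices_in_strong_core:
  assumes "field_difference_algebra k R" "field_difference_algebra k S"
    and C: "field_difference_algebra.core_subalgebra k (tensor k R S) C" and c: "c \<in> C"
  obtains W where "W \<subseteq> strong_core k R" "finite W" "c \<in> tspan k (struct_map R) R (struct_map S) S W (carrier S)"
proof -
  interpret R: field_difference_algebra k R by fact
  interpret S: field_difference_algebra k S by fact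
  interpret TR: field_difference_algebra k "tensor k R S"
    by (rule tensor_field_difference_algebra) fact+
  interpret RS: algebra_tensor k "struct_map R" R "struct_map S" S
    by (rule algebra_tensor.intro) unfold_locales
  interpret st: tensor_functor k "struct_map R" R "struct_map S" S k "struct_map R" R "struct_map S" S
    "shift k" "shift R" "shift S"
    by (rule tensor_shift_functor) unfold_locales
  note C' = TR.core_subalgebraE[OF C]
  note TM = ring_hom_memE[OF st.map_hom]
  let ?C = "(tensor k R S)\<lparr>carrier := C\<rparr>"
  interpret C: field_difference_algebra k ?C by (rule C'(5))
  have CT: "C \<subseteq> carrier RS.T" using C'(2) by simp
  obtain F where F: "finite F" "F \<subseteq> carrier ?C" "carrier ?C = C.sp F"
    using C.separable_finite C'(6) by auto
  have FC: "F \<subseteq> C" and CF: "C = RS.T.sp F"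
    using F(2,3) by (simp_all add: lspan_carrier_update lspan_tensor del: tensor_simps(7))
  have FT: "F \<subseteq> carrier RS.T" using FC CT by blast
  have "\<exists>W. finite W \<and> W \<subseteq> (\<lambda>\<xi>. RS.lslice \<xi> x) ` linear_forms k (struct_map S) S \<and> x \<in> RS.tsp W (carrier S)"
    if "x \<in> F" for x
  proof -
    have "x \<in> RS.tsp (carrier R) (carrier S)" using that FT RS.tsp_carrier by blast
    then show ?thesis using RS.slice_support[OF subset_refl] by metis
  qed
  \<comment> \<open>For each member of the finite spanning set \<open>F\<close> of \<open>C\<close>,
    finitely many slices already serve as left factors. Their union \<open>W\<close> spans the
    smallest space of left factors for \<open>C\<close>.\<close>
  then obtain U where U: "\<And>x. x \<in> F \<Longrightarrow> finite (U x)"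
    "\<And>x. x \<in> F \<Longrightarrow> U x \<subseteq> (\<lambda>\<xi>. RS.lslice \<xi> x) ` linear_forms k (struct_map S) S"
    "\<And>x. x \<in> F \<Longrightarrow> x \<in> RS.tsp (U x) (carrier S)"
    by metis
  define W where "W = (\<Union>x\<in>F. U x)"
  have fW: "finite W" using F(1) U(1) by (simp add: W_def)
  have slices: "\<exists>x\<in>F. \<exists>\<xi>\<in>linear_forms k (struct_map S) S. w = RS.lslice \<xi> x" if "w \<in> W" for w
    using that U(2) by (force simp: W_def)
  have WR: "W \<subseteq> carrier R"
  proof
    fix w assume "w \<in> W"
    then obtain x \<xi> where x: "x \<in> F" "\<xi> \<in> linear_forms k (struct_map S) S" "w = RS.lslice \<xi> x"
      using slices by blast
    show "w \<in> carrier R" unfolding x(3) by (rule RS.lslice_closed[OF x(2) subsetD[OF FT x(1)]])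
  qed
  have F_tsp: "x \<in> RS.tsp W (carrier S)" if "x \<in> F" for x
    using U(3)[OF that] RS.tsp_mono[of "U x" W "carrier S" "carrier S"] that by (auto simp: W_def)
  have W_sp: "W \<subseteq> R.sp W" using R.sp_base[OF _ WR] by blast
  have C_tsp: "C \<subseteq> RS.tsp (R.sp W) (carrier S)"
  proof -
    have "F \<subseteq> RS.tsp (R.sp W) (carrier S)"
      using F_tsp RS.tsp_mono[OF W_sp subset_refl] by blast
    then show ?thesis unfolding CF using RS.span_subset_tsp[OF _ WR subset_refl] by blast
  qed
  have sW: "shift R ` W \<subseteq> carrier R" by (rule R.shift_image_subset[OF WR])
  have shift_tsp: "shift (tensor k R S) x \<in> RS.tsp (shift R ` W) (carrier S)" if "x \<in> RS.tsp W (carrier S)" for x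
    using that
  proof (induction rule: tspan.induct)
    case zero
    then show ?case
      using ring_hom_zero[OF st.map_hom RS.ts.T.ring_axioms RS.ts.T.ring_axioms] by (simp add: tspan.zero)
  next
    case (step r s x)
    have "r \<in> carrier R" "s \<in> carrier S" "x \<in> carrier RS.T" using step WR RS.tsp_closed[OF _ WR subset_refl] by auto
    then show ?case using step S.sh(1) by (simp add: TM st.map_pure tspan.step)
  qed
  have "shift (tensor k R S) ` C \<subseteq> TR.sp (shift (tensor k R S) ` F)"
  proof -
    have "C = TR.sp F" using CF by (simp add: lspan_tensor del: tensor_simps(7))
    moreover have "F \<subseteq> carrier (tensor k R S)" using FT by simp
    ultimately show ?thesis using TR.shift_sp[of F] by blast
  qed
  then have "TR.sp (shift (tensor k R S) ` C) \<subseteq> TR.sp (shift (tensor k R S) ` F)"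
    by (rule TR.sp_idem) (rule TR.shift_image_subset, use FT in simp)
  then have "C \<subseteq> RS.T.sp (shift (tensor k R S) ` F)"
    using C'(7) unfolding lspan_tensor by (rule subset_trans[rotated])
  moreover have "shift (tensor k R S) ` F \<subseteq> RS.tsp (R.sp (shift R ` W)) (carrier S)"
  proof -
    have "RS.tsp (shift R ` W) (carrier S) \<subseteq> RS.tsp (R.sp (shift R ` W)) (carrier S)"
      by (rule RS.tsp_mono) (use R.sp_base[OF _ sW] in auto)
    then show ?thesis using shift_tsp F_tsp by blast
  qed
  \<comment> \<open>As \<open>C\<close> is spanned by the shifts of \<open>F\<close>, shifted left
    factors suffice for all of \<open>C\<close>.\<close>
  ultimately have C_shift: "C \<subseteq> RS.tsp (R.sp (shift R ` W)) (carrier S)"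
    using RS.span_subset_tsp[OF _ sW subset_refl] by blast
  \<comment> \<open>Minimality of the space of left factors: slices of elements of \<open>C\<close>
    lie in every space that can serve, hence in the span of the shifted \<open>W\<close>.\<close>
  have W_sub: "W \<subseteq> R.sp (shift R ` W)"
  proof
    fix w assume "w \<in> W"
    then obtain x \<xi> where x: "x \<in> F" "\<xi> \<in> linear_forms k (struct_map S) S" "w = RS.lslice \<xi> x"
      using slices by blast
    have "w \<in> R.sp (R.sp (shift R ` W))"
      unfolding x(3) by (rule RS.lslice_tsp[OF x(2) R.sp_subset[OF sW] subset_refl]) (use x(1) FC C_shift in blast)
    then show "w \<in> R.sp (shift R ` W)" using R.sp_idem[OF subset_refl sW] by blast
  qed
  have stable: "shift R ` R.sp W \<subseteq> R.sp W" by (rule R.shift_stable_span[OF fW WR W_sub])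
  \<comment> \<open>The span of \<open>W\<close> is stable under the shift but not under products;
    the ring generated by it is the candidate for a core subalgebra.\<close>
  define A where "A = generate_ring R (struct_map R ` carrier k \<union> W)"
  have gen: "struct_map R ` carrier k \<union> W \<subseteq> carrier R" using WR by auto
  have subA: "subring A R" unfolding A_def by (rule R.generate_ring_is_subring[OF gen])
  have AR: "A \<subseteq> carrier R" by (rule subringE(1)[OF subA])
  have genA: "struct_map R ` carrier k \<union> W \<subseteq> A"
    using generate_ring.incl[of _ "struct_map R ` carrier k \<union> W" R] unfolding A_def by blast
  have spW_A: "R.sp W \<subseteq> A"
    by (rule R.sp_least) (use AR genA subringE[OF subA] in auto)
  have "shift R ` W \<subseteq> A" using stable W_sp spW_A by blast
  moreover have "W \<subseteq> R.sp (shift R ` A)"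
    using W_sub R.sp_mono[of "shift R ` W" "shift R ` A"] genA R.shift_image_subset[OF AR] by blast
  ultimately have A: "difference_subalgebra k A R" "A \<subseteq> R.sp (shift R ` A)"
    using R.generated_subalgebra[OF WR A_def] by auto
  let ?A = "R\<lparr>carrier := A\<rparr>"
  interpret A: field_difference_algebra k ?A by (rule R.restrict_algebra[OF A(1)])
  have faA: "field_algebra k (struct_map R) ?A" using A.field_algebra_axioms by simp
  interpret inc: tensor_inclusion k "struct_map R" ?A "struct_map S" S R S
    by (intro tensor_inclusion.intro tensor_inclusion_axioms.intro algebra_tensor.intro faA
        R.field_algebra_axioms S.field_algebra_axioms R.restrict_inclusion[OF A(1)])
      (auto simp: ring_hom_def)
  note inc_h = ring_hom_memE[OF inc.inc_hom]
  have inc_slice: "RS.lslice \<xi> (inc.inc z) = inc.A.lslice \<xi> z"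
    if \<xi>: "\<xi> \<in> linear_forms k (struct_map S) S" and z: "z \<in> carrier inc.A.T" for \<xi> z
    using z
  proof (induction rule: inc.A.T_induct)
    case (pure r s)
    then show ?case using AR inc.inc_pure[OF pure]
      by (simp add: RS.lslice_pure[OF \<xi>] inc.A.lslice_pure[OF \<xi>] subset_iff)
  next
    case (add x y)
    then show ?case by (simp add: inc_h RS.lslice_add[OF \<xi>] inc.A.lslice_add[OF \<xi>])
  qed
  interpret inch: ring_hom_ring inc.A.T RS.T inc.inc
    by (rule ring_hom_ringI2[OF inc.A.ts.T.ring_axioms RS.ts.T.ring_axioms inc.inc_hom])
  \<comment> \<open>Slices commute with the inclusion of A \<otimes> S into R \<otimes> S, and in A
    \<otimes> S they detect zero.\<close>
  have inc_inj: "inj_on inc.inc (carrier inc.A.T)"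
  proof (rule inj_onI)
    fix x y assume xy: "x \<in> carrier inc.A.T" "y \<in> carrier inc.A.T" "inc.inc x = inc.inc y"
    let ?z = "x \<ominus>\<^bsub>inc.A.T\<^esub> y"
    have z: "?z \<in> carrier inc.A.T" using xy by simp
    have "inc.inc ?z = \<zero>\<^bsub>RS.T\<^esub>" using xy by (simp add: a_minus_def RS.ts.T.r_neg)
    then have "inc.A.lslice \<xi> ?z = \<zero>\<^bsub>?A\<^esub>" if "\<xi> \<in> linear_forms k (struct_map S) S" for \<xi>
      using inc_slice[OF that z] RS.lslice_zero[OF that] by simp
    then have "?z = \<zero>\<^bsub>inc.A.T\<^esub>" by (rule inc.A.slices_zero[OF z])
    then show "x = y" using xy(1,2) by simp
  qed
  have C_inc: "\<exists>z. z \<in> inc.A.tsp (R.sp W) (carrier S) \<and> z \<in> carrier inc.A.T \<and> inc.inc z = x" if "x \<in> C" for x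
  proof -
    have "x \<in> inc.inc ` inc.A.tsp (R.sp W) (carrier S)"
      using inc.inc_tsp[of "R.sp W" "carrier S"] spW_A C_tsp that by auto
    moreover have "inc.A.tsp (R.sp W) (carrier S) \<subseteq> carrier inc.A.T"
      using inc.A.tsp_closed[of _ "R.sp W" "carrier S"] spW_A by auto
    ultimately show ?thesis by blast
  qed
  \<comment> \<open>Regards \<open>C\<close> as a subalgebra of A \<otimes> S, where
    \<open>W\<close> generates the left factor, so that \<open>separable_of_slices\<close> applies
    to \<open>A\<close> in place of \<open>R\<close>.\<close>
  define \<gamma> where "\<gamma> x = inv_into (carrier inc.A.T) inc.inc x" for x
  have \<gamma>_inc: "\<gamma> (inc.inc z) = z" if "z \<in> carrier inc.A.T" for z
    using inc_inj that by (simp add: \<gamma>_def)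
  have \<gamma>: "\<gamma> x \<in> carrier inc.A.T" "inc.inc (\<gamma> x) = x" "\<gamma> x \<in> inc.A.tsp (R.sp W) (carrier S)" if "x \<in> C" for x
    using C_inc[OF that] \<gamma>_inc by auto
  have \<gamma>I: "\<gamma> x = z" if "inc.inc z = x" "z \<in> carrier inc.A.T" for x z using \<gamma>_inc that by auto
  have \<gamma>_hom: "algebra_hom k (struct_map ?C) ?C (\<lambda>a. inc.A.pt (struct_map R a) \<one>\<^bsub>S\<^esub>) inc.A.T \<gamma>"
  proof (intro algebra_hom.intro algebra_hom_axioms.intro C.field_algebra_axioms inc.A.T.field_algebra_axioms)
    show "\<gamma> \<in> ring_hom ?C inc.A.T"
    proof (rule ring_hom_memI)
      fix x y assume "x \<in> carrier ?C" "y \<in> carrier ?C"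
      then have xy: "x \<in> C" "y \<in> C" by auto
      show "\<gamma> x \<in> carrier inc.A.T" by (rule \<gamma>(1)[OF xy(1)])
      show "\<gamma> (x \<otimes>\<^bsub>?C\<^esub> y) = \<gamma> x \<otimes>\<^bsub>inc.A.T\<^esub> \<gamma> y" "\<gamma> (x \<oplus>\<^bsub>?C\<^esub> y) = \<gamma> x \<oplus>\<^bsub>inc.A.T\<^esub> \<gamma> y"
        using xy by (auto intro!: \<gamma>I simp: \<gamma>(1,2) inc_h)
    next
      show "\<gamma> \<one>\<^bsub>?C\<^esub> = \<one>\<^bsub>inc.A.T\<^esub>" by (rule \<gamma>I) (simp_all add: inc_h)
    qed
    fix a assume a: "a \<in> carrier k"
    have "struct_map R a \<in> A" using genA a by blast
    then show "\<gamma> (struct_map ?C a) = inc.A.pt (struct_map R a) \<one>\<^bsub>S\<^esub>"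
      by (intro \<gamma>I) (simp_all add: inc.inc_pure)
  qed
  have WA: "W \<subseteq> A" using genA by blast
  have "separable_algebra k (struct_map R) ?A"
  proof (rule inc.A.separable_of_slices[OF \<gamma>_hom _ fW])
    show "separable_algebra k (struct_map ?C) ?C" using C'(6) by simp
    show "W \<subseteq> carrier ?A" using WA by simp
    fix Z assume Z: "subring Z ?A" "struct_map R ` carrier k \<subseteq> Z" "W \<subseteq> Z"
    have "subring Z R" by (rule R.subring_of_subring[OF subA Z(1)])
    then have "A \<subseteq> Z" unfolding A_def using R.generate_ring_min_subring1[OF gen] Z(2,3) by blast
    then show "carrier ?A \<subseteq> Z" by simp
  next
    fix w assume "w \<in> W"
    then obtain x \<xi> where x: "x \<in> F" "\<xi> \<in> linear_forms k (struct_map S) S" "w = RS.lslice \<xi> x"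
      using slices by blast
    then have xC: "x \<in> C" using FC by blast
    have "w = inc.A.lslice \<xi> (\<gamma> x)"
      using inc_slice[OF x(2) \<gamma>(1)[OF xC]] \<gamma>(2)[OF xC] x(3) by simp
    then show "\<exists>x\<in>carrier ?C. \<exists>\<xi>\<in>linear_forms k (struct_map S) S. w = inc.A.lslice \<xi> (\<gamma> x)"
      using xC x(2) by auto
  next
    fix x assume "x \<in> carrier ?C"
    then show "\<gamma> x \<in> inc.A.tsp (inc.A.R.sp W) (carrier S)"
      using \<gamma>(3) by (simp add: lspan_carrier_update)
  qed
  then have "R.core_subalgebra A" using A by (simp add: R.core_subalgebra_def)
  then have core: "A \<subseteq> strong_core k R" by (auto simp: R.strong_core_eq)
  have "c \<in> RS.tsp (R.sp W) (carrier S)" using C_tsp c by blast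
  then obtain W' B' where W': "finite W'" "W' \<subseteq> R.sp W" "B' \<subseteq> carrier S" "c \<in> RS.tsp W' B'"
    by (rule RS.tsp_finite) blast
  then have "c \<in> RS.tsp W' (carrier S)" using RS.tsp_mono by blast
  moreover have "W' \<subseteq> strong_core k R" using W'(2) spW_A core by blast
  ultimately show ?thesis using W'(1) that by blast
qed

theorem lemma1p25:
  fixes k :: "'k diff_ring" and R :: "('k, 'r) diff_alg" and S :: "('k, 's) diff_alg"
  assumes "difference_field k"
    and "difference_algebra k R"
    and "difference_algebra k S"
  shows "strong_core k (tensor k R S) = tensor_image k R S (strong_core k R) (strong_core k S)"
proof -
  have R: "field_difference_algebra k R" and S: "field_difference_algebra k S"
    using assms by (simp_all add: field_difference_algebra_def)
  have RS: "field_difference_algebra k (tensor k R S)" and SR: "field_difference_algebra k (tensor k S R)"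
    by (intro tensor_field_difference_algebra R S)+
  interpret R: field_difference_algebra k R by (rule R)
  interpret S: field_difference_algebra k S by (rule S)
  interpret RS: field_difference_algebra k "tensor k R S" by (rule RS)
  interpret SR: field_difference_algebra k "tensor k S R" by (rule SR)
  interpret T: algebra_tensor k "struct_map R" R "struct_map S" S
    by (rule algebra_tensor.intro) unfold_locales
  interpret T': algebra_tensor k "struct_map S" S "struct_map R" R
    by (rule algebra_tensor.intro) unfold_locales
  interpret st: tensor_functor k "struct_map R" R "struct_map S" S k "struct_map R" R "struct_map S" S
    "shift k" "shift R" "shift S"
    by (rule tensor_shift_functor) unfold_locales
  interpret st': tensor_functor k "struct_map S" S "struct_map R" R k "struct_map S" S "struct_map R" R
    "shift k" "shift S" "shift R"
    by (rule tensor_shift_functor) unfold_locales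
  let ?A = "strong_core k R" and ?B = "strong_core k S"
  note A = R.strong_core_subalgebra and B = S.strong_core_subalgebra
  have AR: "?A \<subseteq> carrier R" and BS: "?B \<subseteq> carrier S"
    using A B by (auto simp: difference_subalgebra_def dest: subringE(1))
  interpret A: field_difference_algebra k "R\<lparr>carrier := ?A\<rparr>" by (rule R.restrict_algebra[OF A])
  interpret B: field_difference_algebra k "S\<lparr>carrier := ?B\<rparr>" by (rule S.restrict_algebra[OF B])
  have fA: "field_algebra k (struct_map R) (R\<lparr>carrier := ?A\<rparr>)" using A.field_algebra_axioms by simp
  have fB: "field_algebra k (struct_map S) (S\<lparr>carrier := ?B\<rparr>)" using B.field_algebra_axioms by simp
  interpret inc: tensor_inclusion k "struct_map R" "R\<lparr>carrier := ?A\<rparr>" "struct_map S" "S\<lparr>carrier := ?B\<rparr>" R S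
    by (intro tensor_inclusion.intro tensor_inclusion_axioms.intro algebra_tensor.intro fA fB
        R.field_algebra_axioms S.field_algebra_axioms R.restrict_inclusion[OF A] S.restrict_inclusion[OF B])
  have image: "tensor_image k R S ?A ?B = T.tsp ?A ?B"
    using inc.inc_tsp[of ?A ?B] inc.A.tsp_carrier unfolding tensor_image_def inc.inc_def by simp
  have sub_core: "T.tsp ?A ?B \<subseteq> strong_core k (tensor k R S)"
  proof
    have "subring (strong_core k (tensor k R S)) (tensor k R S)"
      using RS.strong_core_subalgebra by (simp add: difference_subalgebra_def)
    note cl = subringE[OF this]
    \<comment> \<open>The embedded copies of a core subalgebra through \<open>a\<close> and one
      through \<open>b\<close> generate a core subalgebra of R \<otimes> S, and it contains the
      product a \<otimes> b.\<close>
    have pure: "T.pt a b \<in> strong_core k (tensor k R S)" if a: "a \<in> ?A" and b: "b \<in> ?B" for a b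
    proof -
      obtain M where M: "R.core_subalgebra M" "a \<in> M" using a by (auto simp: R.strong_core_eq)
      obtain N where N: "S.core_subalgebra N" "b \<in> N" using b by (auto simp: S.strong_core_eq)
      note M' = R.core_subalgebraE[OF M(1)] and N' = S.core_subalgebraE[OF N(1)]
      interpret M: field_difference_algebra k "R\<lparr>carrier := M\<rparr>" by (rule M'(5))
      interpret N: field_difference_algebra k "S\<lparr>carrier := N\<rparr>" by (rule N'(5))
      have f: "algebra_hom k (struct_map (R\<lparr>carrier := M\<rparr>)) (R\<lparr>carrier := M\<rparr>)
          (struct_map (tensor k R S)) (tensor k R S) (\<lambda>r. T.pt r \<one>\<^bsub>S\<^esub>)"
        by (intro algebra_hom.intro algebra_hom_axioms.intro M.field_algebra_axioms RS.field_algebra_axioms)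
          (use ring_hom_memE[OF T.left_hom] M'(2) in \<open>auto simp: ring_hom_def subset_iff\<close>)
      have g: "algebra_hom k (struct_map (S\<lparr>carrier := N\<rparr>)) (S\<lparr>carrier := N\<rparr>)
          (struct_map (tensor k R S)) (tensor k R S) (\<lambda>s. T.pt \<one>\<^bsub>R\<^esub> s)"
        by (intro algebra_hom.intro algebra_hom_axioms.intro N.field_algebra_axioms RS.field_algebra_axioms)
          (use ring_hom_memE[OF T.right_hom] N'(2) in \<open>auto simp: ring_hom_def subset_iff T.scalar_right\<close>)
      obtain E where E: "RS.core_subalgebra E" "(\<lambda>r. T.pt r \<one>\<^bsub>S\<^esub>) ` carrier (R\<lparr>carrier := M\<rparr>) \<subseteq> E"
        "(\<lambda>s. T.pt \<one>\<^bsub>R\<^esub> s) ` carrier (S\<lparr>carrier := N\<rparr>) \<subseteq> E"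
        by (rule RS.generated_core_subalgebra[OF M'(5) N'(5) f g])
          (use M'(2,6,7) N'(2,6,7) in \<open>auto simp: lspan_carrier_update st.map_pure subset_iff R.sh S.sh\<close>)
      then have "T.pt a \<one>\<^bsub>S\<^esub> \<in> E" "T.pt \<one>\<^bsub>R\<^esub> b \<in> E" using M(2) N(2) by auto
      then have "T.pt a \<one>\<^bsub>S\<^esub> \<otimes>\<^bsub>tensor k R S\<^esub> T.pt \<one>\<^bsub>R\<^esub> b \<in> E"
        by (rule subringE(6)[OF RS.core_subalgebraE(1)[OF E(1)]])
      moreover have "T.pt a \<one>\<^bsub>S\<^esub> \<otimes>\<^bsub>tensor k R S\<^esub> T.pt \<one>\<^bsub>R\<^esub> b = T.pt a b"
        using subsetD[OF M'(2) M(2)] subsetD[OF N'(2) N(2)] by (simp add: T.pt_mult)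
      ultimately show ?thesis using E(1) by (auto simp: RS.strong_core_eq)
    qed
    fix x assume "x \<in> T.tsp ?A ?B"
    then show "x \<in> strong_core k (tensor k R S)"
    proof (induction rule: tspan.induct)
      case zero
      then show ?case using cl(2) by simp
    next
      case (step a b x)
      then show ?case using cl(7)[OF pure[OF step.hyps(1,2)] step.IH] by simp
    qed
  qed
  have "strong_core k (tensor k R S) \<subseteq> T.tsp ?A ?B"
  proof
    fix c assume "c \<in> strong_core k (tensor k R S)"
    then obtain C where C: "RS.core_subalgebra C" "c \<in> C" by (auto simp: RS.strong_core_eq)
    note C' = RS.core_subalgebraE[OF C(1)]
    let ?C = "(tensor k R S)\<lparr>carrier := C\<rparr>"
    interpret C: field_difference_algebra k ?C by (rule C'(5))
    have CT: "x \<in> carrier T.T" if "x \<in> C" for x using C'(2) that by auto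
    have cT: "c \<in> carrier T.T" by (rule CT[OF C(2)])
    obtain W where W: "W \<subseteq> ?A" "c \<in> T.tsp W (carrier S)"
      by (rule slices_in_strong_core[OF R S C]) blast
    have WR: "W \<subseteq> carrier R" using W(1) AR by blast
    note sw = ring_hom_memE[OF T.swap_hom]
    have swap: "algebra_hom k (struct_map ?C) ?C (struct_map (tensor k S R)) (tensor k S R) T.swap"
    proof (intro algebra_hom.intro algebra_hom_axioms.intro C.field_algebra_axioms SR.field_algebra_axioms)
      show "T.swap \<in> ring_hom ?C (tensor k S R)"
        by (rule ring_hom_memI) (use sw CT in auto)
      fix a assume "a \<in> carrier k"
      then show "T.swap (struct_map ?C a) = struct_map (tensor k S R) a"
        by (simp add: T.swap_pure T'.scalar_right)
    qed
    have swap_shift: "T.swap (shift (tensor k R S) x) = shift (tensor k S R) (T.swap x)" if "x \<in> carrier T.T" for x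
      using that
    proof (induction rule: T.T_induct)
      case (pure r s)
      then show ?case by (simp add: st.map_pure st'.map_pure T.swap_pure R.sh S.sh)
    next
      case (add x y)
      then show ?case
        by (simp add: ring_hom_memE[OF st.map_hom] ring_hom_memE[OF st'.map_hom] sw)
    qed
    \<comment> \<open>The exchanged copy of \<open>C\<close> is placed in a core subalgebra by using
      the generation lemma with both maps equal to \<open>T.swap\<close>; this avoids transporting
      the core conditions along an isomorphism.\<close>
    obtain E where E: "SR.core_subalgebra E" "T.swap ` carrier ?C \<subseteq> E"
      by (rule SR.generated_core_subalgebra[OF C'(5) C'(5) swap swap])
        (use C'(6,7) CT swap_shift in \<open>auto simp: lspan_carrier_update\<close>)
    have "T.swap c \<in> E" using E(2) C(2) by auto
    then obtain U where U: "U \<subseteq> ?B" "T.swap c \<in> T'.tsp U (carrier R)"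
      by (rule slices_in_strong_core[OF S R E(1)]) blast
    have US: "U \<subseteq> carrier S" using U(1) BS by blast
    \<comment> \<open>At this point the exchanged \<open>c\<close> has representations with left
      factors in \<open>U\<close> and with right factors in \<open>W\<close>. Choosing slices as
      left factors keeps the right factors in \<open>W\<close>, and by the first representation
      these slices lie in the span of \<open>U\<close>.\<close>
    have "T.swap c \<in> T'.tsp (carrier S) W" by (rule T.swap_tsp[OF W(2) WR subset_refl])
    then obtain V where V: "V \<subseteq> (\<lambda>\<xi>. T'.lslice \<xi> (T.swap c)) ` linear_forms k (struct_map R) R"
      "T.swap c \<in> T'.tsp V W"
      by (rule T'.slice_support[OF WR]) blast
    have "V \<subseteq> S.sp U" using V(1) T'.lslice_tsp[OF _ US subset_refl U(2)] by blast
    also have "S.sp U \<subseteq> ?B"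
    proof (rule S.sp_least[OF BS _ _ _ U(1)])
      have sub: "subring ?B S" and k: "struct_map S ` carrier k \<subseteq> ?B"
        using B by (auto simp: difference_subalgebra_def)
      note cl = subringE[OF sub]
      show "\<zero>\<^bsub>S\<^esub> \<in> ?B" by (rule cl(2))
      show "x \<oplus>\<^bsub>S\<^esub> y \<in> ?B" if "x \<in> ?B" "y \<in> ?B" for x y by (rule cl(7)[OF that])
      show "struct_map S a \<otimes>\<^bsub>S\<^esub> y \<in> ?B" if "a \<in> carrier k" "y \<in> ?B" for a y
        by (rule cl(6)) (use k that in auto)
    qed
    finally have VB: "V \<subseteq> ?B" .
    have "T'.swap (T.swap c) \<in> T.tsp W V"
      by (rule T'.swap_tsp[OF V(2) _ WR]) (use VB BS in blast)
    then have "c \<in> T.tsp W V" using T.swap_swap[OF cT] by simp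
    then show "c \<in> T.tsp ?A ?B" using T.tsp_mono[OF W(1) VB] by blast
  qed
  with sub_core image show ?thesis by simp
qed

end
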